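(* Let $n\ge2$ and let $(S_1,\dots,S_{n-1},P)$ be a c.n.u. $\Gamma_n$-contraction on a Hilbert space $\mathcal H$ such that $P^*$ commutes with each $S_i$, $1\le i\le n-1$. Let $\mathcal H=\mathcal H_1^{\circ}\oplus\mathcal H_2^{\circ}\oplus\mathcal H_3^{\circ}$ be the orthogonal decomposition of $\mathcal H$ determined by the c.n.u. contraction $P$ in which $\mathcal H_1^\circ=\{x:\lim_k\|P^kx\|=0\}$, $\mathcal H_3^\circ=\{x:\lim_k\|P^kx\|=\|x\|\}$ and $\mathcal H_2^\circ$ is the orthogonal complement of $\mathcal H_1^\circ\oplus\mathcal H_3^\circ$. Then: (1) $\mathcal H_1^\circ$ and $\mathcal H_3^\circ$ are joint invariant subspaces for $S_1,\dots,S_{n-1}$ and $P$; (2) $\mathcal H_2^\circ$ is a joint invariant subspace for $S_1^*,\dots,S_{n-1}^*$ and $P^*$; (3) $(S_1|_{\mathcal H_1^\circ},\dots,S_{n-1}|_{\mathcal H_1^\circ},P|_{\mathcal H_1^\circ})$ is a strongly stable $\Gamma_n$-contraction; (4) $(S_1^*|_{\mathcal H_2^\circ},\dots,S_{n-1}^*|_{\mathcal H_2^\circ},P^*|_{\mathcal H_2^\circ})$ is a c.n.u. $\Gamma_n$-contraction; (5) $(S_1|_{\mathcal H_3^\circ},\dots,S_{n-1}|_{\mathcal H_3^\circ},P|_{\mathcal H_3^\circ})$ is a c.n.u. $\Gamma_n$-isometry.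
   Context: All operators are bounded linear operators on complex Hilbert spaces; subspaces are closed. A compact set $K\subset\mathbb C^n$ is a spectral set for a commuting $n$-tuple $\underline T$ if the Taylor joint spectrum of $\underline T$ lies in $K$ and $\|f(\underline T)\|\le\sup_{K}|f|$ for every rational function $f$ with poles off $K$. The closed symmetrized polydisc is $\Gamma_n=\pi_n(\overline{\mathbb D}^n)$, where $\pi_n(z_1,\dots,z_n)=(\sum_i z_i,\sum_{i<j}z_iz_j,\dots,\prod_i z_i)$, and $b\Gamma_n=\pi_n(\mathbb T^n)$. A $\Gamma_n$-contraction is a commuting $n$-tuple $(S_1,\dots,S_{n-1},P)$ having $\Gamma_n$ as a spectral set (then $P$ is a contraction). A $\Gamma_n$-unitary is a commuting tuple of normal operators with Taylor joint spectrum contained in $b\Gamma_n$. A $\Gamma_n$-isometry is the restriction of a $\Gamma_n$-unitary to a joint invariant subspace. A contraction is c.n.u. (completely non-unitary) if no nonzero reducing subspace exists on which it is unitary; a $\Gamma_n$-contraction is c.n.u. if its last component $P$ is c.n.u., and strongly stable if $\|P^kx\|\to0$ for all $x$. Known one-variable fact: for a c.n.u. contraction $P$ on $\mathcal H$, $\mathcal H$ admits a unique orthogonal decomposition $\mathcal H_1^\circ\oplus\mathcal H_2^\circ\oplus\mathcal H_3^\circ$, with $\mathcal H_1^\circ,\mathcal H_3^\circ$ invariant for $P$ and $\mathcal H_2^\circ$ invariant for $P^*$, such that $\lim_k\|P^kx\|$ equals $0$ for $x\in\mathcal H_1^\circ$, is $<\|x\|$ for nonzero $x\in\mathcal H_2^\circ$,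 and equals $\|x\|$ for $x\in\mathcal H_3^\circ$; these are the subspaces described in the statement. *)

theory Defs
  imports "HOL-Analysis.Analysis" "HOL-Library.Poly_Mapping"
begin

section \<open>Complex Hilbert spaces\<close>

text \<open>The inner product is linear in its first argument.\<close>

class chilbert_space = real_normed_vector + complete_space +
  fixes scaleC :: "complex \<Rightarrow> 'a \<Rightarrow> 'a" (infixr \<open>*\<^sub>C\<close> 75)
    and cinner :: "'a \<Rightarrow> 'a \<Rightarrow> complex"
  assumes scaleR_scaleC: "r *\<^sub>R x = complex_of_real r *\<^sub>C x"
    and scaleC_add_right: "c *\<^sub>C (x + y) = c *\<^sub>C x + c *\<^sub>C y"
    and scaleC_add_left: "(c + d) *\<^sub>C x = c *\<^sub>C x + d *\<^sub>C x"
    and scaleC_scaleC: "c *\<^sub>C (d *\<^sub>C x) = (c * d) *\<^sub>C x"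
    and scaleC_one: "1 *\<^sub>C x = x"
    and cinner_commute: "cinner x y = cnj (cinner y x)"
    and cinner_add_left: "cinner (x + y) z = cinner x z + cinner y z"
    and cinner_scaleC_left: "cinner (c *\<^sub>C x) y = c * cinner x y"
    and cinner_self: "cinner x x = complex_of_real ((norm x)\<^sup>2)"

lemma cinner_add_right: "cinner x (y + z) = cinner x y + cinner x z"
  by (metis cinner_add_left cinner_commute complex_cnj_add)

lemma cinner_scaleC_right: "cinner x (c *\<^sub>C y) = cnj c * cinner x y"
  by (metis cinner_scaleC_left cinner_commute complex_cnj_mult)

lemma norm_scaleC: "norm (c *\<^sub>C x) = cmod c * norm (x::'a::chilbert_space)"
proof -
  have "complex_of_real ((norm (c *\<^sub>C x))\<^sup>2) = c * cnj c * complex_of_real ((norm x)\<^sup>2)"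
    unfolding cinner_self[symmetric] cinner_scaleC_left cinner_scaleC_right by simp
  also have "\<dots> = complex_of_real ((cmod c * norm x)\<^sup>2)"
    by (simp add: complex_norm_square[symmetric] power_mult_distrib)
  finally have "(norm (c *\<^sub>C x))\<^sup>2 = (cmod c * norm x)\<^sup>2"
    using of_real_eq_iff by blast
  then show ?thesis by (simp add: power2_eq_iff_nonneg)
qed

lemma norm_cinner_le: "cmod (cinner x y) \<le> norm x * norm (y::'a::chilbert_space)"
proof (cases "y = 0")
  case True
  have "cinner x (0::'a) = 0" using cinner_add_right[of x 0 0] by simp
  then show ?thesis using True by simp
next
  case False
  define c where "c = - cinner x y / complex_of_real ((norm y)\<^sup>2)"
  have n: "(norm y)\<^sup>2 > 0" using False by simp
  have "complex_of_real ((norm (x + c *\<^sub>C y))\<^sup>2)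
      = complex_of_real ((norm x)\<^sup>2) + cnj c * cinner x y + c * cnj (cinner x y)
        + c * cnj c * complex_of_real ((norm y)\<^sup>2)"
    unfolding cinner_self[symmetric] cinner_add_left cinner_add_right
      cinner_scaleC_left cinner_scaleC_right cinner_commute[of y x]
    by (simp add: algebra_simps)
  also have "\<dots> = complex_of_real ((norm x)\<^sup>2 - (cmod (cinner x y))\<^sup>2 / (norm y)\<^sup>2)"
    using n unfolding c_def of_real_diff of_real_divide complex_norm_square[of "cinner x y"]
    by (simp add: field_simps power2_eq_square)
  finally have "(norm (x + c *\<^sub>C y))\<^sup>2 = (norm x)\<^sup>2 - (cmod (cinner x y))\<^sup>2 / (norm y)\<^sup>2"
    using of_real_eq_iff by blast
  then have "0 \<le> (norm x)\<^sup>2 - (cmod (cinner x y))\<^sup>2 / (norm y)\<^sup>2"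
    by (metis zero_le_power2)
  then have "(cmod (cinner x y))\<^sup>2 \<le> (norm x * norm y)\<^sup>2"
    using n by (simp add: field_simps)
  then show ?thesis by (rule power2_le_imp_le) simp
qed


section \<open>The Hilbert space of square-summable sequences\<close>

text \<open>This space is the host for the (minimal) normal extensions in the definition
  of a \<open>\<Gamma>\<^sub>n\<close>-isometry below.\<close>

typedef (overloaded) 'a ell2 =
  "{f :: nat \<Rightarrow> 'a::chilbert_space. summable (\<lambda>i. (norm (f i))\<^sup>2)}"
  morphisms seq_of Abs_ell2
  by (rule exI[of _ "\<lambda>_. 0"]) simp

setup_lifting type_definition_ell2

lemma summable_seq_of: "summable (\<lambda>i. (norm (seq_of x i))\<^sup>2)"
  using seq_of by blast

lemma norm_add_square_le: "(norm (a + b))\<^sup>2 \<le> 2 * (norm a)\<^sup>2 + 2 * (norm (b::'a::real_normed_vector))\<^sup>2"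
proof -
  have "(norm (a + b))\<^sup>2 \<le> (norm a + norm b)\<^sup>2"
    by (intro power_mono norm_triangle_ineq) simp
  also have "\<dots> \<le> 2 * (norm a)\<^sup>2 + 2 * (norm b)\<^sup>2"
    using zero_le_power2[of "norm a - norm b"] by (simp add: power2_eq_square algebra_simps)
  finally show ?thesis .
qed

lemma square_summable_add:
  fixes f g :: "nat \<Rightarrow> 'a::real_normed_vector"
  assumes "summable (\<lambda>i. (norm (f i))\<^sup>2)" "summable (\<lambda>i. (norm (g i))\<^sup>2)"
  shows "summable (\<lambda>i. (norm (f i + g i))\<^sup>2)"
proof (rule summable_comparison_test')
  show "summable (\<lambda>i. 2 * (norm (f i))\<^sup>2 + 2 * (norm (g i))\<^sup>2)"
    using assms by (intro summable_add summable_mult)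
  show "norm ((norm (f i + g i))\<^sup>2) \<le> 2 * (norm (f i))\<^sup>2 + 2 * (norm (g i))\<^sup>2" for i
    using norm_add_square_le[of "f i" "g i"] by simp
qed

lemma square_summable_cinner:
  fixes f g :: "nat \<Rightarrow> 'a::chilbert_space"
  assumes "summable (\<lambda>i. (norm (f i))\<^sup>2)" "summable (\<lambda>i. (norm (g i))\<^sup>2)"
  shows "summable (\<lambda>i. cinner (f i) (g i))"
proof (rule summable_comparison_test')
  show "summable (\<lambda>i. (norm (f i))\<^sup>2 + (norm (g i))\<^sup>2)"
    using assms by (rule summable_add)
  show "norm (cinner (f i) (g i)) \<le> (norm (f i))\<^sup>2 + (norm (g i))\<^sup>2" for i
  proof -
    have "norm (f i) * norm (g i) \<le> (norm (f i))\<^sup>2 + (norm (g i))\<^sup>2"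
      using sum_squares_bound[of "norm (f i)" "norm (g i)"]
        mult_nonneg_nonneg[OF norm_ge_zero[of "f i"] norm_ge_zero[of "g i"]] by linarith
    then show ?thesis using norm_cinner_le[of "f i" "g i"] by linarith
  qed
qed

instantiation ell2 :: (chilbert_space) real_normed_vector
begin

lift_definition zero_ell2 :: "'a ell2" is "\<lambda>_. 0" by simp

lift_definition plus_ell2 :: "'a ell2 \<Rightarrow> 'a ell2 \<Rightarrow> 'a ell2" is "\<lambda>f g i. f i + g i"
  by (simp add: square_summable_add)

lift_definition uminus_ell2 :: "'a ell2 \<Rightarrow> 'a ell2" is "\<lambda>f i. - f i" by simp

lift_definition minus_ell2 :: "'a ell2 \<Rightarrow> 'a ell2 \<Rightarrow> 'a ell2" is "\<lambda>f g i. f i - g i"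
  using square_summable_add[where g = "\<lambda>i. - g i" for g] by fastforce

lift_definition scaleR_ell2 :: "real \<Rightarrow> 'a ell2 \<Rightarrow> 'a ell2" is "\<lambda>r f i. r *\<^sub>R f i"
  by (simp add: power_mult_distrib summable_mult)

definition norm_ell2 :: "'a ell2 \<Rightarrow> real" where
  "norm_ell2 x = sqrt (suminf (\<lambda>i. (norm (seq_of x i))\<^sup>2))"

definition dist_ell2 :: "'a ell2 \<Rightarrow> 'a ell2 \<Rightarrow> real" where
  "dist_ell2 x y = norm (x - y)"

definition sgn_ell2 :: "'a ell2 \<Rightarrow> 'a ell2" where
  "sgn_ell2 x = inverse (norm x) *\<^sub>R x"

definition uniformity_ell2 :: "('a ell2 \<times> 'a ell2) filter" where
  "uniformity_ell2 = (INF e\<in>{0<..}. principal {(x, y). dist x y < e})"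

definition open_ell2 :: "'a ell2 set \<Rightarrow> bool" where
  "open_ell2 U \<longleftrightarrow> (\<forall>x\<in>U. \<forall>\<^sub>F (x', y) in uniformity. x' = x \<longrightarrow> y \<in> U)"

lemma partial_le_norm_ell2: "L2_set (\<lambda>i. norm (seq_of x i)) {..<k} \<le> norm (x::'a ell2)"
  unfolding norm_ell2_def L2_set_def
  by (intro real_sqrt_le_mono sum_le_suminf summable_seq_of) auto

lemma norm_ell2_le:
  assumes "\<And>k. L2_set (\<lambda>i. norm (seq_of x i)) {..<k} \<le> B"
  shows "norm (x::'a ell2) \<le> B"
proof -
  have B: "0 \<le> B" using assms[of 0] by simp
  have "(\<Sum>i<k. (norm (seq_of x i))\<^sup>2) \<le> B\<^sup>2" for k
    using power_mono[OF assms[of k], of 2] by (simp add: L2_set_def sum_nonneg)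
  then have "suminf (\<lambda>i. (norm (seq_of x i))\<^sup>2) \<le> B\<^sup>2"
    by (intro suminf_le_const summable_seq_of)
  then show ?thesis unfolding norm_ell2_def using B real_le_lsqrt
    by (simp add: real_sqrt_le_iff real_le_lsqrt)
qed

instance
proof
  fix a b x y z :: "'a ell2" and r s :: real
    and U :: "'a ell2 set"
  show "a + b + x = a + (b + x)" by transfer (simp add: add.assoc)
  show "a + b = b + a" by transfer (simp add: add.commute)
  show "0 + a = a" by transfer simp
  show "- a + a = 0" by transfer simp
  show "a - b = a + - b" by transfer simp
  show "r *\<^sub>R (x + y) = r *\<^sub>R x + r *\<^sub>R y" by transfer (simp add: scaleR_add_right)
  show "(r + s) *\<^sub>R x = r *\<^sub>R x + s *\<^sub>R x" by transfer (simp add: scaleR_add_left)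
  show "r *\<^sub>R s *\<^sub>R x = (r * s) *\<^sub>R x" by transfer simp
  show "1 *\<^sub>R x = x" by transfer simp
  show "dist x y = norm (x - y)" by (rule dist_ell2_def)
  show "sgn x = inverse (norm x) *\<^sub>R x" by (rule sgn_ell2_def)
  show "uniformity = (INF e\<in>{0<..}. principal {(x :: 'a ell2, y). dist x y < e})" by (rule uniformity_ell2_def)
  show "open U \<longleftrightarrow> (\<forall>x\<in>U. \<forall>\<^sub>F (x', y) in uniformity. x' = x \<longrightarrow> y \<in> U)" by (rule open_ell2_def)

  show "norm x = 0 \<longleftrightarrow> x = 0"
  proof
    assume "norm x = 0"
    then have "suminf (\<lambda>i. (norm (seq_of x i))\<^sup>2) = 0" by (simp add: norm_ell2_def)
    then have "\<forall>i. seq_of x i = 0"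
      by (subst (asm) suminf_eq_zero_iff) (auto intro: summable_seq_of)
    then show "x = 0" by transfer auto
  next
    assume "x = 0"
    then show "norm x = 0" by (simp add: norm_ell2_def zero_ell2.rep_eq)
  qed

  show "norm (x + y) \<le> norm x + norm y"
  proof (rule norm_ell2_le)
    fix k
    have "L2_set (\<lambda>i. norm (seq_of (x + y) i)) {..<k}
        \<le> L2_set (\<lambda>i. norm (seq_of x i) + norm (seq_of y i)) {..<k}"
      by (rule L2_set_mono) (auto simp: plus_ell2.rep_eq norm_triangle_ineq)
    also have "\<dots> \<le> L2_set (\<lambda>i. norm (seq_of x i)) {..<k} + L2_set (\<lambda>i. norm (seq_of y i)) {..<k}"
      by (rule L2_set_triangle_ineq)
    also have "\<dots> \<le> norm x + norm y"
      by (intro add_mono partial_le_norm_ell2)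
    finally show "L2_set (\<lambda>i. norm (seq_of (x + y) i)) {..<k} \<le> norm x + norm y" .
  qed

  show "norm (r *\<^sub>R x) = \<bar>r\<bar> * norm x"
    by (simp add: norm_ell2_def scaleR_ell2.rep_eq power_mult_distrib
        suminf_mult[OF summable_seq_of] real_sqrt_mult)
qed

end

instance ell2 :: (chilbert_space) complete_space
proof
  fix X :: "nat \<Rightarrow> 'a ell2"
  assume "Cauchy X"
  have coord: "norm (seq_of x i) \<le> norm x" for x :: "'a ell2" and i
    using member_le_L2_set[of "{..<Suc i}" i "\<lambda>i. norm (seq_of x i)"]
      partial_le_norm_ell2[of x "Suc i"] by simp
  have C: "\<exists>N. \<forall>m\<ge>N. \<forall>n\<ge>N. norm (X m - X n) < e" if "e > 0" for e
    using \<open>Cauchy X\<close> that unfolding Cauchy_def dist_ell2_def by blast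
  have "Cauchy (\<lambda>k. seq_of (X k) i)" for i
    unfolding Cauchy_def dist_norm
    using C coord by (metis (no_types, lifting) minus_ell2.rep_eq order_le_less_trans)
  then have "\<exists>l. (\<lambda>k. seq_of (X k) i) \<longlonglongrightarrow> l" for i
    using Cauchy_convergent_iff convergent_def by blast
  then obtain L where L: "\<And>i. (\<lambda>k. seq_of (X k) i) \<longlonglongrightarrow> L i" by metis
  have bound: "(\<Sum>i<k. (norm (seq_of (X m) i - L i))\<^sup>2) \<le> e\<^sup>2"
    if Xm: "\<And>n. n \<ge> N \<Longrightarrow> norm (X m - X n) < e" for e N m k
  proof (rule LIMSEQ_le_const2)
    show "(\<lambda>n. \<Sum>i<k. (norm (seq_of (X m) i - seq_of (X n) i))\<^sup>2)
        \<longlonglongrightarrow> (\<Sum>i<k. (norm (seq_of (X m) i - L i))\<^sup>2)"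
      by (intro tendsto_intros L)
    have "(\<Sum>i<k. (norm (seq_of (X m) i - seq_of (X n) i))\<^sup>2) \<le> e\<^sup>2" if "n \<ge> N" for n
    proof -
      have "L2_set (\<lambda>i. norm (seq_of (X m - X n) i)) {..<k} \<le> e"
        using partial_le_norm_ell2[of "X m - X n" k] Xm[OF that] by linarith
      from power_mono[OF this, of 2] show ?thesis
        by (simp add: L2_set_def minus_ell2.rep_eq sum_nonneg)
    qed
    then show "\<exists>N. \<forall>n\<ge>N. (\<Sum>i<k. (norm (seq_of (X m) i - seq_of (X n) i))\<^sup>2) \<le> e\<^sup>2" by blast
  qed
  have sumD: "summable (\<lambda>i. (norm (seq_of (X m) i - L i))\<^sup>2)"
    if Xm: "\<And>n. n \<ge> N \<Longrightarrow> norm (X m - X n) < e" for e N m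
    using bound[of N m e, OF Xm]
    by (intro bounded_imp_summable[of _ "e\<^sup>2"]) (simp_all del: sum.lessThan_Suc flip: lessThan_Suc_atMost)
  obtain N1 where N1: "\<forall>m\<ge>N1. \<forall>n\<ge>N1. norm (X m - X n) < 1" using C[of 1] by auto
  have s1: "summable (\<lambda>i. (norm (seq_of (X N1) i - L i))\<^sup>2)"
    using sumD[of N1 N1 1] N1 by blast
  have "summable (\<lambda>i. (norm (- (seq_of (X N1) i - L i) + seq_of (X N1) i))\<^sup>2)"
    by (intro square_summable_add summable_seq_of) (use s1 in \<open>simp only: norm_minus_cancel\<close>)
  then have sL: "summable (\<lambda>i. (norm (L i))\<^sup>2)" by simp
  define l where "l = Abs_ell2 L"
  have sl: "seq_of l = L" unfolding l_def using sL by (simp add: Abs_ell2_inverse)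
  have "X \<longlonglongrightarrow> l"
  proof (rule metric_LIMSEQ_I)
    fix r :: real assume r: "0 < r"
    obtain N where N: "\<forall>m\<ge>N. \<forall>n\<ge>N. norm (X m - X n) < r / 2" using C[of "r/2"] r by auto
    have "norm (X m - l) \<le> r / 2" if "m \<ge> N" for m
    proof (rule norm_ell2_le)
      fix k
      have "(\<Sum>i<k. (norm (seq_of (X m) i - L i))\<^sup>2) \<le> (r / 2)\<^sup>2"
        using bound[of N m "r/2" k] N that by blast
      then show "L2_set (\<lambda>i. norm (seq_of (X m - l) i)) {..<k} \<le> r / 2"
        unfolding L2_set_def minus_ell2.rep_eq sl using r
        by (intro real_le_lsqrt) (auto simp: sum_nonneg)
    qed
    then show "\<exists>no. \<forall>n\<ge>no. dist (X n) l < r"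
      unfolding dist_ell2_def using r by (intro exI[of _ N]) (smt (verit) field_sum_of_halves)
  qed
  then show "convergent X" by (rule convergentI)
qed

instantiation ell2 :: (chilbert_space) chilbert_space
begin

lift_definition scaleC_ell2 :: "complex \<Rightarrow> 'a ell2 \<Rightarrow> 'a ell2" is "\<lambda>c f i. c *\<^sub>C f i"
  by (simp add: norm_scaleC power_mult_distrib summable_mult)

definition cinner_ell2 :: "'a ell2 \<Rightarrow> 'a ell2 \<Rightarrow> complex" where
  "cinner_ell2 x y = suminf (\<lambda>i. cinner (seq_of x i) (seq_of y i))"

instance
proof
  fix x y z :: "'a ell2" and c d :: complex and r :: real
  show "r *\<^sub>R x = complex_of_real r *\<^sub>C x" by transfer (simp add: scaleR_scaleC)
  show "c *\<^sub>C (x + y) = c *\<^sub>C x + c *\<^sub>C y" by transfer (simp add: scaleC_add_right)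
  show "(c + d) *\<^sub>C x = c *\<^sub>C x + d *\<^sub>C x" by transfer (simp add: scaleC_add_left)
  show "c *\<^sub>C d *\<^sub>C x = (c * d) *\<^sub>C x" by transfer (simp add: scaleC_scaleC)
  show "1 *\<^sub>C x = x" by transfer (simp add: scaleC_one)

  have "cinner y x = suminf (\<lambda>i. cnj (cinner (seq_of x i) (seq_of y i)))"
    unfolding cinner_ell2_def by (subst cinner_commute) simp
  also have "\<dots> = cnj (cinner x y)"
    unfolding cinner_ell2_def
    by (intro sums_unique[symmetric] sums_cnj[THEN iffD2] summable_sums
        square_summable_cinner summable_seq_of)
  finally show "cinner x y = cnj (cinner y x)" by simp

  show "cinner (x + y) z = cinner x z + cinner y z"
    unfolding cinner_ell2_def plus_ell2.rep_eq cinner_add_left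
    by (intro suminf_add[symmetric] square_summable_cinner summable_seq_of)

  show "cinner (c *\<^sub>C x) y = c * cinner x y"
    unfolding cinner_ell2_def scaleC_ell2.rep_eq cinner_scaleC_left
    by (intro suminf_mult square_summable_cinner summable_seq_of)

  have "0 \<le> suminf (\<lambda>i. (norm (seq_of x i))\<^sup>2)"
    by (intro suminf_nonneg summable_seq_of) simp
  then show "cinner x x = complex_of_real ((norm x)\<^sup>2)"
    unfolding cinner_ell2_def norm_ell2_def cinner_self
    by (simp add: suminf_of_real[OF summable_seq_of] flip: of_real_power)
qed

end


section \<open>Operators on closed subspaces\<close>

text \<open>A Hilbert space is a closed subspace \<open>M\<close> of a type of class
  \<open>chilbert_space\<close>; the values outside \<open>M\<close> of an operator on \<open>M\<close> are irrelevant.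
  In particular the restriction of \<open>T\<close> to an invariant subspace \<open>M\<close> is represented by
  \<open>T\<close> itself, regarded as an operator on \<open>M\<close>.\<close>

definition closed_csubspace :: "'a::chilbert_space set \<Rightarrow> bool" where
  "closed_csubspace M \<longleftrightarrow> closed M \<and> 0 \<in> M \<and> (\<forall>x\<in>M. \<forall>y\<in>M. x + y \<in> M) \<and>
     (\<forall>c. \<forall>x\<in>M. c *\<^sub>C x \<in> M)"

definition clinear_on :: "'a::chilbert_space set \<Rightarrow> ('a \<Rightarrow> 'b::chilbert_space) \<Rightarrow> bool" where
  "clinear_on M T \<longleftrightarrow> (\<forall>x\<in>M. \<forall>y\<in>M. T (x + y) = T x + T y) \<and>
     (\<forall>c. \<forall>x\<in>M. T (c *\<^sub>C x) = c *\<^sub>C T x)"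

definition bounded_op_on :: "'a::chilbert_space set \<Rightarrow> ('a \<Rightarrow> 'a) \<Rightarrow> bool" where
  "bounded_op_on M T \<longleftrightarrow> T ` M \<subseteq> M \<and> clinear_on M T \<and>
     (\<exists>B. \<forall>x\<in>M. norm (T x) \<le> B * norm x)"

definition onorm_on :: "'a::chilbert_space set \<Rightarrow> ('a \<Rightarrow> 'a) \<Rightarrow> real" where
  "onorm_on M T = (SUP x\<in>M. norm (T x) / norm x)"

text \<open>The adjoint of \<open>T\<close> as an operator on \<open>M\<close>; it exists by the Riesz representation
  theorem if \<open>M\<close> is a closed subspace and \<open>T\<close> is bounded on \<open>M\<close>.\<close>

definition adj_on :: "'a::chilbert_space set \<Rightarrow> ('a \<Rightarrow> 'a) \<Rightarrow> 'a \<Rightarrow> 'a" where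
  "adj_on M T y = (THE z. z \<in> M \<and> (\<forall>x\<in>M. cinner (T x) y = cinner x z))"

abbreviation adj :: "('a::chilbert_space \<Rightarrow> 'a) \<Rightarrow> 'a \<Rightarrow> 'a" where
  "adj \<equiv> adj_on UNIV"

definition normal_on :: "'a::chilbert_space set \<Rightarrow> ('a \<Rightarrow> 'a) \<Rightarrow> bool" where
  "normal_on M T \<longleftrightarrow> bounded_op_on M T \<and>
     (\<forall>x\<in>M. adj_on M T (T x) = T (adj_on M T x))"

definition unitary_on :: "'a::chilbert_space set \<Rightarrow> ('a \<Rightarrow> 'a) \<Rightarrow> bool" where
  "unitary_on M T \<longleftrightarrow> bounded_op_on M T \<and>
     (\<forall>x\<in>M. adj_on M T (T x) = x \<and> T (adj_on M T x) = x)"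

definition contraction_on :: "'a::chilbert_space set \<Rightarrow> ('a \<Rightarrow> 'a) \<Rightarrow> bool" where
  "contraction_on M T \<longleftrightarrow> bounded_op_on M T \<and> onorm_on M T \<le> 1"

definition reducing_subspace :: "'a::chilbert_space set \<Rightarrow> ('a \<Rightarrow> 'a) \<Rightarrow> 'a set \<Rightarrow> bool" where
  "reducing_subspace M T L \<longleftrightarrow> closed_csubspace L \<and> L \<subseteq> M \<and> T ` L \<subseteq> L \<and> adj_on M T ` L \<subseteq> L"

definition cnu_on :: "'a::chilbert_space set \<Rightarrow> ('a \<Rightarrow> 'a) \<Rightarrow> bool" where
  "cnu_on M T \<longleftrightarrow> contraction_on M T \<and>
     \<not> (\<exists>L. reducing_subspace M T L \<and> L \<noteq> {0} \<and> unitary_on L T)"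

text \<open>An \<open>n\<close>-tuple is indexed by \<open>{1..n}\<close>; the other values are irrelevant.\<close>

definition commuting_tuple ::
    "nat \<Rightarrow> 'a::chilbert_space set \<Rightarrow> (nat \<Rightarrow> 'a \<Rightarrow> 'a) \<Rightarrow> bool" where
  "commuting_tuple n M T \<longleftrightarrow> closed_csubspace M \<and> (\<forall>i\<in>{1..n}. bounded_op_on M (T i)) \<and>
     (\<forall>i\<in>{1..n}. \<forall>j\<in>{1..n}. \<forall>x\<in>M. T i (T j x) = T j (T i x))"

definition joint_invariant ::
    "nat \<Rightarrow> (nat \<Rightarrow> 'a::chilbert_space \<Rightarrow> 'a) \<Rightarrow> 'a set \<Rightarrow> bool" where
  "joint_invariant n T M \<longleftrightarrow> closed_csubspace M \<and> (\<forall>i\<in>{1..n}. T i ` M \<subseteq> M)"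


section \<open>Taylor joint spectrum\<close>

text \<open>Points of complex \<open>n\<close>-space are functions supported in \<open>{1..n}\<close>. On this set the
  product topology of \<open>nat \<Rightarrow> complex\<close> is the usual topology.\<close>

definition cspace :: "nat \<Rightarrow> (nat \<Rightarrow> complex) set" where
  "cspace n = {z. \<forall>i. i \<notin> {1..n} \<longrightarrow> z i = 0}"

text \<open>The Koszul complex of \<open>T\<close> on \<open>M\<close>: an element of the tensor product of \<open>M\<close> with the
  exterior algebra on \<open>e\<^sub>1, \<dots>, e\<^sub>n\<close> is given by its coefficients at the monomials
  \<open>e\<^sub>I\<close> (factors in increasing order), and the boundary map is
  \<open>x \<otimes> e\<^sub>I \<mapsto> \<Sum>j. T\<^sub>j x \<otimes> (e\<^sub>j \<and> e\<^sub>I)\<close>.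
  This map is homogeneous of degree one, so exactness at every stage amounts to the equality
  of its kernel and its range on the whole graded space.\<close>

definition koszul_space :: "nat \<Rightarrow> 'a::chilbert_space set \<Rightarrow> (nat set \<Rightarrow> 'a) set" where
  "koszul_space n M =
     {x. \<forall>I. (I \<subseteq> {1..n} \<longrightarrow> x I \<in> M) \<and> (\<not> I \<subseteq> {1..n} \<longrightarrow> x I = 0)}"

definition koszul_map ::
    "nat \<Rightarrow> (nat \<Rightarrow> 'a::chilbert_space \<Rightarrow> 'a) \<Rightarrow> (nat set \<Rightarrow> 'a) \<Rightarrow> nat set \<Rightarrow> 'a" where
  "koszul_map n T x J = (if J \<subseteq> {1..n}
     then \<Sum>j\<in>J. (- 1) ^ card {i\<in>J. i < j} *\<^sub>C T j (x (J - {j})) else 0)"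

definition koszul_exact ::
    "nat \<Rightarrow> 'a::chilbert_space set \<Rightarrow> (nat \<Rightarrow> 'a \<Rightarrow> 'a) \<Rightarrow> bool" where
  "koszul_exact n M T \<longleftrightarrow>
     {x \<in> koszul_space n M. koszul_map n T x = (\<lambda>_. 0)} = koszul_map n T ` koszul_space n M"

definition taylor_spectrum ::
    "nat \<Rightarrow> 'a::chilbert_space set \<Rightarrow> (nat \<Rightarrow> 'a \<Rightarrow> 'a) \<Rightarrow> (nat \<Rightarrow> complex) set" where
  "taylor_spectrum n M T =
     {z \<in> cspace n. \<not> koszul_exact n M (\<lambda>i x. T i x - z i *\<^sub>C x)}"


section \<open>Rational functions and spectral sets\<close>

text \<open>Complex polynomials in the variables \<open>z\<^sub>1, \<dots>, z\<^sub>n\<close>: the exponent of \<open>z\<^sub>i\<close> in the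
  monomial \<open>m\<close> is \<open>lookup m i\<close>.\<close>

definition polys :: "nat \<Rightarrow> ((nat \<Rightarrow>\<^sub>0 nat) \<Rightarrow>\<^sub>0 complex) set" where
  "polys n = {p. \<forall>m \<in> Poly_Mapping.keys p. Poly_Mapping.keys m \<subseteq> {1..n}}"

definition poly_at :: "nat \<Rightarrow> ((nat \<Rightarrow>\<^sub>0 nat) \<Rightarrow>\<^sub>0 complex) \<Rightarrow> (nat \<Rightarrow> complex) \<Rightarrow> complex" where
  "poly_at n p z =
     (\<Sum>m\<in>Poly_Mapping.keys p. Poly_Mapping.lookup p m * (\<Prod>i=1..n. z i ^ Poly_Mapping.lookup m i))"

definition monom_op ::
    "nat \<Rightarrow> (nat \<Rightarrow>\<^sub>0 nat) \<Rightarrow> (nat \<Rightarrow> 'a::chilbert_space \<Rightarrow> 'a) \<Rightarrow> 'a \<Rightarrow> 'a" where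
  "monom_op n m T = foldr (\<lambda>i f. (T i ^^ Poly_Mapping.lookup m i) \<circ> f) [1..<Suc n] id"

definition poly_op ::
    "nat \<Rightarrow> ((nat \<Rightarrow>\<^sub>0 nat) \<Rightarrow>\<^sub>0 complex) \<Rightarrow> (nat \<Rightarrow> 'a::chilbert_space \<Rightarrow> 'a) \<Rightarrow> 'a \<Rightarrow> 'a" where
  "poly_op n p T x = (\<Sum>m\<in>Poly_Mapping.keys p. Poly_Mapping.lookup p m *\<^sub>C monom_op n m T x)"

text \<open>\<open>(p/q)(T) = p(T) q(T)\<^sup>-\<^sup>1\<close>. If \<open>q\<close> has no zero on the Taylor spectrum of \<open>T\<close>, then
  \<open>q(T)\<close> is invertible by the spectral mapping theorem.\<close>

definition rat_op ::
    "nat \<Rightarrow> 'a::chilbert_space set \<Rightarrow> ((nat \<Rightarrow>\<^sub>0 nat) \<Rightarrow>\<^sub>0 complex) \<Rightarrow> ((nat \<Rightarrow>\<^sub>0 nat) \<Rightarrow>\<^sub>0 complex) \<Rightarrow>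
     (nat \<Rightarrow> 'a \<Rightarrow> 'a) \<Rightarrow> 'a \<Rightarrow> 'a" where
  "rat_op n M p q T = poly_op n p T \<circ> inv_into M (poly_op n q T)"

definition spectral_set ::
    "nat \<Rightarrow> 'a::chilbert_space set \<Rightarrow> (nat \<Rightarrow> 'a \<Rightarrow> 'a) \<Rightarrow> (nat \<Rightarrow> complex) set \<Rightarrow> bool" where
  "spectral_set n M T K \<longleftrightarrow>
     commuting_tuple n M T \<and> compact K \<and> K \<subseteq> cspace n \<and> taylor_spectrum n M T \<subseteq> K \<and>
     (\<forall>p\<in>polys n. \<forall>q\<in>polys n. (\<forall>z\<in>K. poly_at n q z \<noteq> 0) \<longrightarrow>
        onorm_on M (rat_op n M p q T) \<le> (SUP z\<in>K. cmod (poly_at n p z / poly_at n q z)))"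


section \<open>The symmetrized polydisc and the associated operator tuples\<close>

definition symmetrization :: "nat \<Rightarrow> (nat \<Rightarrow> complex) \<Rightarrow> nat \<Rightarrow> complex" where
  "symmetrization n z k = (if k \<in> {1..n}
     then \<Sum>I | I \<subseteq> {1..n} \<and> card I = k. \<Prod>i\<in>I. z i else 0)"

definition Gamma :: "nat \<Rightarrow> (nat \<Rightarrow> complex) set" where
  "Gamma n = symmetrization n ` {z \<in> cspace n. \<forall>i\<in>{1..n}. cmod (z i) \<le> 1}"

definition bGamma :: "nat \<Rightarrow> (nat \<Rightarrow> complex) set" where
  "bGamma n = symmetrization n ` {z \<in> cspace n. \<forall>i\<in>{1..n}. cmod (z i) = 1}"

definition Gamma_contraction ::
    "nat \<Rightarrow> 'a::chilbert_space set \<Rightarrow> (nat \<Rightarrow> 'a \<Rightarrow> 'a) \<Rightarrow> bool" where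
  "Gamma_contraction n M T \<longleftrightarrow> spectral_set n M T (Gamma n)"

definition Gamma_unitary ::
    "nat \<Rightarrow> 'a::chilbert_space set \<Rightarrow> (nat \<Rightarrow> 'a \<Rightarrow> 'a) \<Rightarrow> bool" where
  "Gamma_unitary n M T \<longleftrightarrow> commuting_tuple n M T \<and> (\<forall>i\<in>{1..n}. normal_on M (T i)) \<and>
     taylor_spectrum n M T \<subseteq> bGamma n"

text \<open>\<open>T\<close> is, up to the isometric embedding \<open>V\<close>, the restriction of the \<open>\<Gamma>\<^sub>n\<close>-unitary \<open>U\<close>
  on \<open>K\<close> to the joint invariant subspace \<open>V ` M\<close>. Taking \<open>K\<close> among the closed subspaces of
  \<open>'a ell2\<close> is no restriction: given any \<open>\<Gamma>\<^sub>n\<close>-unitary extension, the smallest subspace that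
  contains \<open>V ` M\<close> and reduces all \<open>U i\<close> is the closed span of the images of \<open>V ` M\<close> under the
  countably many monomials in the adjoints of the \<open>U i\<close>. So its Hilbert dimension is at most
  that of \<open>'a ell2\<close>, and the restriction of a \<open>\<Gamma>\<^sub>n\<close>-unitary to a joint reducing subspace is
  again a \<open>\<Gamma>\<^sub>n\<close>-unitary.\<close>

definition Gamma_isometry ::
    "nat \<Rightarrow> 'a::chilbert_space set \<Rightarrow> (nat \<Rightarrow> 'a \<Rightarrow> 'a) \<Rightarrow> bool" where
  "Gamma_isometry n M T \<longleftrightarrow> closed_csubspace M \<and>
     (\<exists>(K :: 'a ell2 set) U V. Gamma_unitary n K U \<and>
        clinear_on M V \<and> V ` M \<subseteq> K \<and> (\<forall>x\<in>M. norm (V x) = norm x) \<and>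
        (\<forall>i\<in>{1..n}. \<forall>x\<in>M. T i x \<in> M \<and> V (T i x) = U i (V x)))"

definition strongly_stable ::
    "nat \<Rightarrow> 'a::chilbert_space set \<Rightarrow> (nat \<Rightarrow> 'a \<Rightarrow> 'a) \<Rightarrow> bool" where
  "strongly_stable n M T \<longleftrightarrow> (\<forall>x\<in>M. (\<lambda>k. norm ((T n ^^ k) x)) \<longlonglongrightarrow> 0)"

definition cnu_tuple ::
    "nat \<Rightarrow> 'a::chilbert_space set \<Rightarrow> (nat \<Rightarrow> 'a \<Rightarrow> 'a) \<Rightarrow> bool" where
  "cnu_tuple n M T \<longleftrightarrow> cnu_on M (T n)"


section \<open>The decomposition determined by a c.n.u. contraction\<close>

definition stable_part :: "('a::chilbert_space \<Rightarrow> 'a) \<Rightarrow> 'a set" where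
  "stable_part P = {x. (\<lambda>k. norm ((P ^^ k) x)) \<longlonglongrightarrow> 0}"

definition isometric_part :: "('a::chilbert_space \<Rightarrow> 'a) \<Rightarrow> 'a set" where
  "isometric_part P = {x. (\<lambda>k. norm ((P ^^ k) x)) \<longlonglongrightarrow> norm x}"

definition middle_part :: "('a::chilbert_space \<Rightarrow> 'a) \<Rightarrow> 'a set" where
  "middle_part P = {x. \<forall>y\<in>stable_part P. \<forall>z\<in>isometric_part P. cinner x (y + z) = 0}"

end

theory Submission
  imports
    Defs
    "HOL-Computational_Algebra.Fundamental_Theorem_Algebra"
    "HOL-Computational_Algebra.Formal_Power_Series"
    "HOL-Real_Asymp.Real_Asymp"
begin

unbundle no vec_syntax
unbundle fps_syntax

text \<open>
  Each \<open>S\<^sub>i\<close> commutes with \<open>P\<close> and with \<open>P\<^sup>*\<close>. The stable part of \<open>P\<close> is invariant under every bounded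
  operator that commutes with \<open>P\<close>. The isometric part consists of the vectors with \<open>P\<^sup>*\<^sup>k P\<^sup>k x = x\<close> for
  all \<open>k\<close>, so it is invariant under every operator that commutes with \<open>P\<close> and \<open>P\<^sup>*\<close>. The middle part is
  the orthogonal complement of their sum, so it is invariant under the adjoints.

  To pass from \<open>\<Gamma>\<^sub>n\<close>-contractions to restrictions and adjoints, the definition by the Taylor spectrum
  and by rational functions is reduced to the estimate \<open>\<parallel>p(T)\<parallel> \<le> sup \<bar>p\<bar>\<close> over \<open>\<Gamma>\<^sub>n\<close> for polynomials \<open>p\<close>
  (\<open>Gamma_contractionI\<close>), which obviously passes to restrictions and, by conjugating coefficients, to
  adjoints. Three facts make this reduction work. A point \<open>z\<close> of the Taylor spectrum satisfies
  \<open>\<bar>p(z)\<bar> \<le> \<parallel>p(T)\<parallel>\<close>, because \<open>p(T) - p(z)\<close> acts as zero on the cohomology of the Koszul complex of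
  \<open>T - z\<close> and therefore cannot be invertible (\<open>taylor_spectrum_not_bij\<close>). The set \<open>\<Gamma>\<^sub>n\<close> is polynomially
  convex (\<open>Gamma_polynomially_convex\<close>). And a polynomial without zeros on \<open>\<Gamma>\<^sub>n\<close> has a reciprocal that
  polynomials approximate uniformly on \<open>\<Gamma>\<^sub>n\<close> (\<open>approx_invertible_of_nonvanishing\<close>).

  On the isometric part, \<open>P\<close> is an isometry \<open>V\<close> without unitary part, since a unitary part would reduce
  \<open>P\<close>. The \<open>S\<^sub>i\<close> commute there with \<open>V\<close> and its adjoint, and this forces them to vanish
  (\<open>wandering_vanish\<close>, \<open>pure_isometry_vanish\<close>). Indeed, let \<open>A\<^sub>i\<close> be the restriction of \<open>S\<^sub>i\<close> to the
  wandering subspace of \<open>V\<close>. Every unimodular number \<open>z\<close> is an approximate eigenvalue of \<open>V\<close>, with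
  approximate eigenvectors \<open>\<Sum>k<m. z\<^sup>-\<^sup>k V\<^sup>k e\<close> on which \<open>S\<^sub>i\<close> acts as \<open>A\<^sub>i\<close> acts on \<open>e\<close>. So
  \<open>(A\<^sub>1, \<dots>, A\<^sub>n\<^sub>-\<^sub>1, z)\<close> satisfies the polynomial estimate over the slice \<open>s\<^sub>n = z\<close> of \<open>\<Gamma>\<^sub>n\<close>, where
  \<open>s\<^sub>n\<^sub>-\<^sub>i = z cnj s\<^sub>i\<close>. Hence \<open>A\<^sub>n\<^sub>-\<^sub>i = z A\<^sub>i\<^sup>*\<close>, and as \<open>z\<close> is arbitrary, \<open>A\<^sub>i = 0\<close>. The tuple on the isometric
  part is thus \<open>(0, \<dots>, 0, V)\<close>. It extends to \<open>(0, \<dots>, 0, U)\<close> with \<open>U\<close> a bilateral shift, and the points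
  \<open>(0, \<dots>, 0, c)\<close> with \<open>\<bar>c\<bar> = 1\<close> lie in \<open>b\<Gamma>\<^sub>n\<close>, being symmetrizations of the roots of \<open>t\<^sup>n + (-1)\<^sup>n c\<close>.
\<close>

section \<open>Inner product geometry\<close>

lemma scaleC_zero_left [simp]: "0 *\<^sub>C (x::'a::chilbert_space) = 0"
  using scaleR_scaleC[of 0 x] by simp

lemma scaleC_zero_right [simp]: "c *\<^sub>C (0::'a::chilbert_space) = 0"
  using norm_scaleC[of c 0] by simp

lemma scaleC_one' [simp]: "1 *\<^sub>C (x::'a::chilbert_space) = x"
  by (rule scaleC_one)

lemma scaleC_minus1: "(-1) *\<^sub>C (x::'a::chilbert_space) = - x"
  using scaleR_scaleC[of "-1" x] by simp

lemma scaleC_minus_left: "(-c) *\<^sub>C (x::'a::chilbert_space) = - (c *\<^sub>C x)"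
  by (metis mult_minus1 scaleC_minus1 scaleC_scaleC)

lemma scaleC_minus_right: "c *\<^sub>C (- x::'a::chilbert_space) = - (c *\<^sub>C x)"
  by (metis mult.commute scaleC_minus1 scaleC_scaleC)

lemma scaleC_diff_right: "c *\<^sub>C (x - y) = c *\<^sub>C x - c *\<^sub>C (y::'a::chilbert_space)"
  by (metis diff_conv_add_uminus scaleC_add_right scaleC_minus_right)

lemma scaleC_sum_right: "c *\<^sub>C (\<Sum>i\<in>A. f i) = (\<Sum>i\<in>A. c *\<^sub>C (f i::'a::chilbert_space))"
  by (induct A rule: infinite_finite_induct) (simp_all add: scaleC_add_right)

lemma cinner_zero_left [simp]: "cinner 0 (y::'a::chilbert_space) = 0"
  using cinner_add_left[of 0 0 y] by simp

lemma cinner_zero_right [simp]: "cinner (y::'a::chilbert_space) 0 = 0"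
  using cinner_add_right[of y 0 0] by simp

lemma cinner_minus_left [simp]: "cinner (- x) (y::'a::chilbert_space) = - cinner x y"
  using cinner_scaleC_left[of "-1" x y] by (simp add: scaleC_minus1)

lemma cinner_minus_right [simp]: "cinner x (- y::'a::chilbert_space) = - cinner x y"
  using cinner_scaleC_right[of x "-1" y] by (simp add: scaleC_minus1)

lemma cinner_diff_left: "cinner (x - y) (z::'a::chilbert_space) = cinner x z - cinner y z"
  by (metis cinner_add_left cinner_minus_left diff_conv_add_uminus)

lemma cinner_diff_right: "cinner z (x - y::'a::chilbert_space) = cinner z x - cinner z y"
  by (metis cinner_add_right cinner_minus_right diff_conv_add_uminus)

lemma cinner_eq_zero_self [simp]: "cinner x x = 0 \<longleftrightarrow> x = (0::'a::chilbert_space)"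
  by (simp add: cinner_self)

lemma power2_norm_add:
  "(norm (x + y))\<^sup>2 = (norm x)\<^sup>2 + 2 * Re (cinner x y) + (norm (y::'a::chilbert_space))\<^sup>2"
proof -
  have "complex_of_real ((norm (x + y))\<^sup>2)
      = complex_of_real ((norm x)\<^sup>2) + (cinner x y + cnj (cinner x y)) + complex_of_real ((norm y)\<^sup>2)"
    unfolding cinner_self[symmetric] cinner_add_left cinner_add_right cinner_commute[of y x]
    by simp
  also have "\<dots> = complex_of_real ((norm x)\<^sup>2 + 2 * Re (cinner x y) + (norm y)\<^sup>2)"
    by (simp add: complex_add_cnj)
  finally show ?thesis using of_real_eq_iff by blast
qed

lemma power2_norm_diff:
  "(norm (x - y))\<^sup>2 = (norm x)\<^sup>2 - 2 * Re (cinner x y) + (norm (y::'a::chilbert_space))\<^sup>2"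
  using power2_norm_add[of x "-y"] by simp

lemma parallelogram:
  "(norm (x - y))\<^sup>2 = 2 * (norm x)\<^sup>2 + 2 * (norm y)\<^sup>2 - (norm (x + y::'a::chilbert_space))\<^sup>2"
  by (simp add: power2_norm_add power2_norm_diff)

lemma cinner_eqI:
  fixes y z :: "'a::chilbert_space"
  assumes "\<And>x. cinner x y = cinner x z"
  shows "y = z"
  using assms[of "y - z"] by (metis cinner_diff_right cinner_eq_zero_self eq_iff_diff_eq_0)

lemma bounded_linear_cinner_left: "bounded_linear (\<lambda>x. cinner x (y::'a::chilbert_space))"
proof (rule bounded_linear_intro)
  show "cinner (x + z) y = cinner x y + cinner z y" for x z by (rule cinner_add_left)
  show "cinner (r *\<^sub>R x) y = r *\<^sub>R cinner x y" for r x
    by (simp add: scaleR_scaleC cinner_scaleC_left scaleR_conv_of_real)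
  show "norm (cinner x y) \<le> norm x * norm y" for x by (rule norm_cinner_le)
qed

section \<open>Operators on closed subspaces\<close>

lemma closed_csubspaceD:
  assumes "closed_csubspace M"
  shows "closed M" "0 \<in> M" "\<And>x y. x \<in> M \<Longrightarrow> y \<in> M \<Longrightarrow> x + y \<in> M"
    "\<And>c x. x \<in> M \<Longrightarrow> c *\<^sub>C x \<in> M"
    "\<And>x. x \<in> M \<Longrightarrow> - x \<in> M" "\<And>x y. x \<in> M \<Longrightarrow> y \<in> M \<Longrightarrow> x - y \<in> M"
    "\<And>r x. x \<in> M \<Longrightarrow> r *\<^sub>R x \<in> M"
proof -
  show *: "closed M" "0 \<in> M" "\<And>x y. x \<in> M \<Longrightarrow> y \<in> M \<Longrightarrow> x + y \<in> M"
    "\<And>c x. x \<in> M \<Longrightarrow> c *\<^sub>C x \<in> M"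
    using assms unfolding closed_csubspace_def by auto
  show m: "- x \<in> M" if "x \<in> M" for x using *(4)[OF that, of "-1"] by (simp add: scaleC_minus1)
  show "x - y \<in> M" if "x \<in> M" "y \<in> M" for x y using *(3)[OF that(1) m[OF that(2)]] by simp
  show "r *\<^sub>R x \<in> M" if "x \<in> M" for r x using *(4)[OF that] by (simp add: scaleR_scaleC)
qed

lemma closed_csubspace_sum:
  assumes "closed_csubspace M" "\<And>i. i \<in> A \<Longrightarrow> f i \<in> M"
  shows "(\<Sum>i\<in>A. f i) \<in> M"
  using assms(2) by (induct A rule: infinite_finite_induct) (auto simp: closed_csubspaceD[OF assms(1)])

lemma closed_csubspace_UNIV [simp]: "closed_csubspace UNIV"
  by (simp add: closed_csubspace_def)

lemma clinear_onD:
  assumes "closed_csubspace M" "clinear_on M T"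
  shows "\<And>x y. x \<in> M \<Longrightarrow> y \<in> M \<Longrightarrow> T (x + y) = T x + T y"
    "\<And>c x. x \<in> M \<Longrightarrow> T (c *\<^sub>C x) = c *\<^sub>C T x" "T 0 = 0"
    "\<And>x. x \<in> M \<Longrightarrow> T (- x) = - T x"
    "\<And>x y. x \<in> M \<Longrightarrow> y \<in> M \<Longrightarrow> T (x - y) = T x - T y"
proof -
  note M = closed_csubspaceD[OF assms(1)]
  show *: "\<And>x y. x \<in> M \<Longrightarrow> y \<in> M \<Longrightarrow> T (x + y) = T x + T y"
    "\<And>c x. x \<in> M \<Longrightarrow> T (c *\<^sub>C x) = c *\<^sub>C T x"
    using assms(2) by (auto simp: clinear_on_def)
  show "T 0 = 0" using *(2)[OF M(2), of 0] by simp
  show m: "T (- x) = - T x" if "x \<in> M" for x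
    using *(2)[OF that, of "-1"] by (simp add: scaleC_minus1)
  show "T (x - y) = T x - T y" if "x \<in> M" "y \<in> M" for x y
    using *(1)[OF that(1) M(5)[OF that(2)]] m[OF that(2)] by simp
qed

lemma clinear_on_sum:
  assumes "closed_csubspace M" "clinear_on M T" "\<And>i. i \<in> A \<Longrightarrow> f i \<in> M"
  shows "T (\<Sum>i\<in>A. f i) = (\<Sum>i\<in>A. T (f i))"
  using assms(3)
proof (induct A rule: infinite_finite_induct)
  case (insert a A)
  then have "(\<Sum>i\<in>A. f i) \<in> M" by (intro closed_csubspace_sum[OF assms(1)]) auto
  then show ?case using insert clinear_onD(1)[OF assms(1,2)] by auto
qed (use clinear_onD(3)[OF assms(1,2)] in auto)

lemma bounded_op_onD:
  assumes "bounded_op_on M T"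
  shows "\<And>x. x \<in> M \<Longrightarrow> T x \<in> M" "clinear_on M T"
  using assms by (auto simp: bounded_op_on_def)

lemma bounded_op_on_obtain_bound:
  assumes "bounded_op_on M T"
  obtains B where "B > 0" "\<And>x. x \<in> M \<Longrightarrow> norm (T x) \<le> B * norm x"
proof -
  obtain B where B: "\<And>x. x \<in> M \<Longrightarrow> norm (T x) \<le> B * norm x"
    using assms by (auto simp: bounded_op_on_def)
  have "norm (T x) \<le> max B 1 * norm x" if "x \<in> M" for x
    using B[OF that] by (meson dual_order.trans max.cobounded1 mult_right_mono norm_ge_zero)
  then show ?thesis using that[of "max B 1"] by auto
qed

lemma bounded_op_onI:
  assumes "\<And>x. x \<in> M \<Longrightarrow> T x \<in> M"
    and "\<And>x y. x \<in> M \<Longrightarrow> y \<in> M \<Longrightarrow> T (x + y) = T x + T y"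
    and "\<And>c x. x \<in> M \<Longrightarrow> T (c *\<^sub>C x) = c *\<^sub>C T x"
    and "\<And>x. x \<in> M \<Longrightarrow> norm (T x) \<le> B * norm x"
  shows "bounded_op_on M T"
  using assms unfolding bounded_op_on_def clinear_on_def by blast

lemma bounded_op_on_subset:
  assumes "bounded_op_on M T" "L \<subseteq> M" "T ` L \<subseteq> L"
  shows "bounded_op_on L T"
  using assms unfolding bounded_op_on_def clinear_on_def by (meson subset_iff)

lemma bounded_op_on_id: "bounded_op_on M (\<lambda>x. x)"
  unfolding bounded_op_on_def clinear_on_def by (auto intro: exI[of _ 1])

lemma bounded_op_on_scaleC:
  assumes "closed_csubspace M"
  shows "bounded_op_on M (\<lambda>x. c *\<^sub>C x)"
  by (rule bounded_op_onI[where B = "cmod c"])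
    (auto simp: scaleC_add_right scaleC_scaleC mult.commute norm_scaleC closed_csubspaceD[OF assms])

lemma bounded_op_on_add:
  assumes "closed_csubspace M" "bounded_op_on M A" "bounded_op_on M B"
  shows "bounded_op_on M (\<lambda>x. A x + B x)"
proof -
  obtain a where a: "\<And>x. x \<in> M \<Longrightarrow> norm (A x) \<le> a * norm x"
    using assms(2) by (auto simp: bounded_op_on_def)
  obtain b where b: "\<And>x. x \<in> M \<Longrightarrow> norm (B x) \<le> b * norm x"
    using assms(3) by (auto simp: bounded_op_on_def)
  have "norm (A x + B x) \<le> (a + b) * norm x" if "x \<in> M" for x
    using a[OF that] b[OF that] norm_triangle_ineq[of "A x" "B x"] by (simp add: distrib_right)
  then show ?thesis
    by (intro bounded_op_onI[where B = "a + b"])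
      (auto simp: scaleC_add_right assms bounded_op_onD closed_csubspaceD[OF assms(1)]
        clinear_onD[OF assms(1) bounded_op_onD(2)[OF assms(2)]]
        clinear_onD[OF assms(1) bounded_op_onD(2)[OF assms(3)]])
qed

lemma bounded_op_on_comp:
  assumes "bounded_op_on M A" "bounded_op_on M B"
  shows "bounded_op_on M (\<lambda>x. A (B x))"
proof -
  obtain a where a: "a > 0" "\<And>x. x \<in> M \<Longrightarrow> norm (A x) \<le> a * norm x"
    using bounded_op_on_obtain_bound[OF assms(1)] by blast
  obtain b where b: "\<And>x. x \<in> M \<Longrightarrow> norm (B x) \<le> b * norm x"
    using assms(2) by (auto simp: bounded_op_on_def)
  have "norm (A (B x)) \<le> (a * b) * norm x" if "x \<in> M" for x
    using a(2)[OF bounded_op_onD(1)[OF assms(2) that]] mult_left_mono[OF b[OF that], of a] a(1)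
    by (simp only: mult.assoc) linarith
  then show ?thesis
    using assms unfolding bounded_op_on_def clinear_on_def by (auto simp: image_subset_iff)
qed

lemma bounded_op_on_continuous:
  assumes "closed_csubspace M" "bounded_op_on M T"
  shows "continuous_on M T"
proof -
  obtain B where B: "B > 0" "\<And>x. x \<in> M \<Longrightarrow> norm (T x) \<le> B * norm x"
    using bounded_op_on_obtain_bound[OF assms(2)] by blast
  have "dist (T x) (T y) \<le> B * dist x y" if "x \<in> M" "y \<in> M" for x y
    using B(2)[OF closed_csubspaceD(6)[OF assms(1) that]]
      clinear_onD(5)[OF assms(1) bounded_op_onD(2)[OF assms(2)] that]
    by (simp add: dist_norm)
  then have "B-lipschitz_on M T" using B(1) by (auto intro!: lipschitz_onI)
  then show ?thesis by (rule lipschitz_on_continuous_on)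
qed

lemma bounded_op_on_tendsto:
  assumes "closed_csubspace M" "bounded_op_on M T" "\<And>k. f k \<in> M" "f \<longlonglongrightarrow> l"
  shows "(\<lambda>k. T (f k)) \<longlonglongrightarrow> T l"
proof -
  have "l \<in> M" using closed_sequentially[OF closed_csubspaceD(1)[OF assms(1)]] assms(3,4) by blast
  then show ?thesis
    using bounded_op_on_continuous[OF assms(1,2)] assms(3,4)
    unfolding continuous_on_sequentially comp_def by blast
qed

lemma funpow_in:
  assumes "\<And>x. x \<in> M \<Longrightarrow> T x \<in> M" "x \<in> M"
  shows "(T ^^ k) x \<in> M"
  using assms by (induct k) auto

lemma bounded_op_on_funpow:
  assumes "bounded_op_on M T"
  shows "bounded_op_on M (T ^^ k)"
proof (induct k)
  case 0 then show ?case using bounded_op_on_id by (simp add: id_def)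
next
  case (Suc k) then show ?case using bounded_op_on_comp[OF assms] by (simp add: comp_def)
qed

lemma onorm_on_leI:
  assumes "M \<noteq> {}" "\<And>x. x \<in> M \<Longrightarrow> norm (T x) \<le> B * norm x" "B \<ge> 0"
  shows "onorm_on M T \<le> B"
  unfolding onorm_on_def
proof (rule cSUP_least[OF assms(1)])
  fix x assume "x \<in> M"
  then show "norm (T x) / norm x \<le> B"
    using assms(2)[of x] assms(3) by (cases "x = 0") (auto simp: divide_le_eq)
qed

lemma onorm_on_leD:
  assumes "closed_csubspace M" "bounded_op_on M T" "onorm_on M T \<le> B" "x \<in> M"
  shows "norm (T x) \<le> B * norm x"
proof (cases "x = 0")
  case True
  then show ?thesis using clinear_onD(3)[OF assms(1) bounded_op_onD(2)[OF assms(2)]] by simp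
next
  case False
  obtain C where C: "C > 0" "\<And>x. x \<in> M \<Longrightarrow> norm (T x) \<le> C * norm x"
    using bounded_op_on_obtain_bound[OF assms(2)] by blast
  have "bdd_above ((\<lambda>x. norm (T x) / norm x) ` M)"
  proof (rule bdd_aboveI2)
    fix x assume "x \<in> M"
    then show "norm (T x) / norm x \<le> C" using C(2)[of x] C(1) by (cases "x = 0") (auto simp: divide_le_eq)
  qed
  then have "norm (T x) / norm x \<le> B"
    using cSUP_upper[OF assms(4)] assms(3) unfolding onorm_on_def by (meson order_trans)
  then show ?thesis using False by (simp add: divide_le_eq)
qed


section \<open>The Riesz representation theorem and adjoints\<close>

text \<open>The representing vector is a multiple of the point of least norm in the hyperplane \<open>f = 1\<close>
  of \<open>M\<close>; by the parallelogram law every norm-minimizing sequence there is Cauchy.\<close>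

lemma Riesz_representation:
  fixes M :: "'a::chilbert_space set" and f :: "'a \<Rightarrow> complex"
  assumes M: "closed_csubspace M"
    and add: "\<And>x y. x \<in> M \<Longrightarrow> y \<in> M \<Longrightarrow> f (x + y) = f x + f y"
    and scale: "\<And>c x. x \<in> M \<Longrightarrow> f (c *\<^sub>C x) = c * f x"
    and bound: "\<And>x. x \<in> M \<Longrightarrow> cmod (f x) \<le> B * norm x"
  shows "\<exists>z\<in>M. \<forall>x\<in>M. f x = cinner x z"
proof (cases "\<forall>x\<in>M. f x = 0")
  case True
  then show ?thesis using closed_csubspaceD(2)[OF M] by (intro bexI[of _ 0]) auto
next
  case False
  note M' = closed_csubspaceD[OF M]
  then obtain x0 where x0: "x0 \<in> M" "f x0 \<noteq> 0" using False by blast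
  define C where "C = {x\<in>M. f x = 1}"
  define d where "d = (INF x\<in>C. norm x)"
  have C1: "(1 / f x0) *\<^sub>C x0 \<in> C" using x0 scale M'(4) by (simp add: C_def)
  have bdd: "bdd_below (norm ` C)" by (rule bdd_belowI2[of _ 0]) simp
  have d_le: "d \<le> norm x" if "x \<in> C" for x unfolding d_def using bdd that by (rule cINF_lower)
  have d0: "0 \<le> d" unfolding d_def using C1 by (intro cINF_greatest) auto
  have diff: "f (x - y) = f x - f y" if "x \<in> M" "y \<in> M" for x y
    using add[OF that(1) M'(5)[OF that(2)]] scale[OF that(2), of "-1"] by (simp add: scaleC_minus1)
  have "\<exists>x\<in>C. norm x < d + e" if "e > 0" for e
  proof (rule ccontr)
    assume "\<not> ?thesis"
    then have "d + e \<le> d" unfolding d_def using C1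
      by (intro cINF_greatest) (auto simp: not_less d_def)
    then show False using that by simp
  qed
  then have "\<forall>k. \<exists>x. x \<in> C \<and> norm x < d + 1 / real (Suc k)"
    by (meson of_nat_0_less_iff zero_less_Suc zero_less_divide_1_iff)
  then obtain x where x: "\<And>k. x k \<in> C" "\<And>k. norm (x k) < d + 1 / real (Suc k)" by metis
  have half: "(1/2) *\<^sub>C (y + z) \<in> C" if "y \<in> C" "z \<in> C" for y z
    using that M'(3,4) add scale by (auto simp: C_def)
  have sum_ge: "2 * d \<le> norm (y + z)" if "y \<in> C" "z \<in> C" for y z
    using d_le[OF half[OF that]] by (simp add: norm_scaleC)
  have lim: "(\<lambda>k. norm (x k)) \<longlonglongrightarrow> d"
  proof (rule tendsto_sandwich[of "\<lambda>_. d" _ _ "\<lambda>k. d + 1 / real (Suc k)"])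
    show "(\<lambda>k. d + 1 / real (Suc k)) \<longlonglongrightarrow> d"
      using tendsto_add[OF tendsto_const LIMSEQ_inverse_real_of_nat, of d] by (simp add: inverse_eq_divide)
  qed (use d_le x in \<open>auto intro!: always_eventually less_imp_le\<close>)
  have "Cauchy x"
  proof (rule metric_CauchyI)
    fix e :: real assume e: "e > 0"
    have "(\<lambda>k. (norm (x k))\<^sup>2) \<longlonglongrightarrow> d\<^sup>2" by (intro tendsto_intros lim)
    then have "\<forall>\<^sub>F k in sequentially. (norm (x k))\<^sup>2 < d\<^sup>2 + e\<^sup>2 / 4"
      by (rule order_tendstoD(2)) (use e in simp)
    then obtain N where N: "\<And>k. k \<ge> N \<Longrightarrow> (norm (x k))\<^sup>2 < d\<^sup>2 + e\<^sup>2 / 4"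
      by (auto simp: eventually_sequentially)
    have "dist (x m) (x k) < e" if "m \<ge> N" "k \<ge> N" for m k
    proof -
      have "(2 * d)\<^sup>2 \<le> (norm (x m + x k))\<^sup>2"
        using sum_ge[OF x(1) x(1)] d0 by (intro power_mono) auto
      then have "(norm (x m - x k))\<^sup>2 < e\<^sup>2"
        using parallelogram[of "x m" "x k"] N[OF that(1)] N[OF that(2)] by (simp add: power_mult_distrib)
      then show ?thesis using e by (simp add: dist_norm power2_less_imp_less)
    qed
    then show "\<exists>N. \<forall>m\<ge>N. \<forall>k\<ge>N. dist (x m) (x k) < e" by blast
  qed
  then obtain w where w: "x \<longlonglongrightarrow> w" using Cauchy_convergent_iff convergent_def by blast
  have wM: "w \<in> M" using closed_sequentially[OF M'(1) _ w] x(1) by (auto simp: C_def)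
  have nw: "norm w = d" using LIMSEQ_unique[OF tendsto_norm[OF w] lim] .
  have fw: "f w = 1"
  proof -
    have "(\<lambda>k. B * norm (x k - w)) \<longlonglongrightarrow> B * norm (w - w)" by (intro tendsto_intros w)
    moreover have "cmod (1 - f w) \<le> B * norm (x k - w)" for k
      using bound[of "x k - w"] diff[of "x k" w] x(1)[of k] wM M'(6) by (auto simp: C_def)
    ultimately have "cmod (1 - f w) \<le> B * norm (w - w)"
      using LIMSEQ_le_const by blast
    then show ?thesis by simp
  qed
  \<comment> \<open>Perturbing the minimizer \<open>w\<close> inside the kernel cannot decrease its norm.\<close>
  have orth: "cinner v w = 0" if v: "v \<in> M" "f v = 0" for v
  proof (cases "v = 0")
    case False
    \<comment> \<open>this multiple of \<open>v\<close> minimizes the norm of \<open>w + c v\<close>\<close>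
    define c where "c = - cinner w v / complex_of_real ((norm v)\<^sup>2)"
    have "w + c *\<^sub>C v \<in> C" using v wM fw M' add scale by (simp add: C_def)
    then have "(norm w)\<^sup>2 \<le> (norm (w + c *\<^sub>C v))\<^sup>2" using d_le nw d0 by (intro power_mono) auto
    also have "\<dots> = (norm w)\<^sup>2 - (cmod (cinner w v))\<^sup>2 / (norm v)\<^sup>2"
    proof -
      have "Re (cinner w (c *\<^sub>C v)) = - (cmod (cinner w v))\<^sup>2 / (norm v)\<^sup>2"
      proof -
        have "cinner w (c *\<^sub>C v) = complex_of_real (- (cmod (cinner w v))\<^sup>2 / (norm v)\<^sup>2)"
          unfolding cinner_scaleC_right c_def
          by (simp add: mult.commute flip: complex_norm_square)
        then show ?thesis by (simp only: Re_complex_of_real)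
      qed
      moreover have "(norm (c *\<^sub>C v))\<^sup>2 = (cmod (cinner w v))\<^sup>2 / (norm v)\<^sup>2"
        using False by (simp add: norm_scaleC c_def norm_divide norm_power power_mult_distrib power_divide)
          (simp add: field_simps power2_eq_square power4_eq_xxxx)
      ultimately show ?thesis unfolding power2_norm_add by simp
    qed
    finally have "(cmod (cinner w v))\<^sup>2 / (norm v)\<^sup>2 \<le> 0" by simp
    then have "cinner w v = 0" using False by (simp add: divide_le_0_iff)
    then show ?thesis by (metis cinner_commute complex_cnj_zero)
  qed simp
  have w0: "w \<noteq> 0" using fw scale[OF wM, of 0] by auto
  define z where "z = complex_of_real (1 / (norm w)\<^sup>2) *\<^sub>C w"
  have "f v = cinner v z" if v: "v \<in> M" for v
  proof -
    have "f (v - f v *\<^sub>C w) = 0" using diff[OF v M'(4)[OF wM]] scale[OF wM] fw by simp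
    then have "cinner (v - f v *\<^sub>C w) w = 0" using orth v wM M'(4,6) by blast
    then have "cinner v w = f v * complex_of_real ((norm w)\<^sup>2)"
      by (simp add: cinner_diff_left cinner_scaleC_left cinner_self)
    then show ?thesis using w0 by (simp add: z_def cinner_scaleC_right field_simps)
  qed
  moreover have "z \<in> M" using M'(4) wM by (simp add: z_def)
  ultimately show ?thesis by blast
qed

lemma adj_on_eqI:
  assumes M: "closed_csubspace M" and z: "z \<in> M" "\<And>x. x \<in> M \<Longrightarrow> cinner (T x) y = cinner x z"
  shows "adj_on M T y = z"
  unfolding adj_on_def
proof (rule the_equality)
  show "z \<in> M \<and> (\<forall>x\<in>M. cinner (T x) y = cinner x z)" using z by blast
  fix z' assume z': "z' \<in> M \<and> (\<forall>x\<in>M. cinner (T x) y = cinner x z')"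
  have "z' - z \<in> M" using M z z' closed_csubspaceD(6) by blast
  then have "cinner (z' - z) z' = cinner (z' - z) z" using z' z(2) by metis
  then have "cinner (z' - z) (z' - z) = 0" by (simp add: cinner_diff_right)
  then show "z' = z" by simp
qed

lemma adj_on_props:
  assumes M: "closed_csubspace M" and T: "bounded_op_on M T"
  shows "adj_on M T y \<in> M" "\<And>x. x \<in> M \<Longrightarrow> cinner (T x) y = cinner x (adj_on M T y)"
proof -
  obtain B where B: "B > 0" "\<And>x. x \<in> M \<Longrightarrow> norm (T x) \<le> B * norm x"
    using bounded_op_on_obtain_bound[OF T] by blast
  note lin = clinear_onD[OF M bounded_op_onD(2)[OF T]]
  have "\<exists>z\<in>M. \<forall>x\<in>M. cinner (T x) y = cinner x z"
  proof (rule Riesz_representation[OF M])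
    show "cmod (cinner (T x) y) \<le> (B * norm y) * norm x" if "x \<in> M" for x
      using norm_cinner_le[of "T x" y] mult_right_mono[OF B(2)[OF that], of "norm y"]
      by (simp add: mult.assoc mult.commute mult.left_commute)
  qed (simp_all add: lin cinner_add_left cinner_scaleC_left)
  then obtain z where z: "z \<in> M" "\<And>x. x \<in> M \<Longrightarrow> cinner (T x) y = cinner x z" by blast
  have "adj_on M T y = z" by (rule adj_on_eqI[OF M z])
  then show "adj_on M T y \<in> M" "\<And>x. x \<in> M \<Longrightarrow> cinner (T x) y = cinner x (adj_on M T y)"
    using z by auto
qed

lemma adj_on_props':
  assumes "closed_csubspace M" "bounded_op_on M T" "x \<in> M"
  shows "cinner y (T x) = cinner (adj_on M T y) x"
  using adj_on_props(2)[OF assms] by (metis cinner_commute)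

lemma bounded_op_on_adj_on:
  assumes M: "closed_csubspace M" and T: "bounded_op_on M T"
    and B: "\<And>x. x \<in> M \<Longrightarrow> norm (T x) \<le> B * norm x" "B \<ge> 0"
  shows "bounded_op_on M (adj_on M T)" "\<And>y. norm (adj_on M T y) \<le> B * norm y"
proof -
  note M' = closed_csubspaceD[OF M]
  note a = adj_on_props[OF M T]
  show le: "norm (adj_on M T y) \<le> B * norm y" for y
  proof -
    let ?z = "adj_on M T y"
    have "(norm ?z)\<^sup>2 = cmod (cinner (T ?z) y)" by (simp add: a cinner_self norm_power)
    also have "\<dots> \<le> B * norm ?z * norm y"
      using norm_cinner_le[of "T ?z" y] mult_right_mono[OF B(1)[OF a(1)], of "norm y" y] by simp
    finally have "norm ?z * norm ?z \<le> norm ?z * (B * norm y)"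
      by (simp add: power2_eq_square algebra_simps)
    then show ?thesis using B(2) by (cases "norm ?z = 0") auto
  qed
  have "adj_on M T (x + y) = adj_on M T x + adj_on M T y" for x y
    by (rule adj_on_eqI[OF M]) (auto simp: a M' cinner_add_right)
  moreover have "adj_on M T (c *\<^sub>C x) = c *\<^sub>C adj_on M T x" for c x
    by (rule adj_on_eqI[OF M]) (auto simp: a M' cinner_scaleC_right)
  ultimately show "bounded_op_on M (adj_on M T)"
    using a(1) le by (intro bounded_op_onI)
qed

lemma bounded_op_on_adj_on':
  assumes "closed_csubspace M" "bounded_op_on M T"
  shows "bounded_op_on M (adj_on M T)"
proof -
  obtain B where "B > 0" "\<And>x. x \<in> M \<Longrightarrow> norm (T x) \<le> B * norm x"
    using bounded_op_on_obtain_bound[OF assms(2)] by blast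
  then show ?thesis using bounded_op_on_adj_on(1)[OF assms, of B] by simp
qed

section \<open>Polynomials and their values at commuting tuples\<close>

definition poly_const :: "complex \<Rightarrow> (nat \<Rightarrow>\<^sub>0 nat) \<Rightarrow>\<^sub>0 complex" where
  "poly_const c = Poly_Mapping.single 0 c"

definition poly_var :: "nat \<Rightarrow> (nat \<Rightarrow>\<^sub>0 nat) \<Rightarrow>\<^sub>0 complex" where
  "poly_var i = Poly_Mapping.single (Poly_Mapping.single i 1) 1"

lemma poly_mapping_sum_single:
  "(\<Sum>m\<in>Poly_Mapping.keys p. Poly_Mapping.single m (Poly_Mapping.lookup p m)) = p"
  by (rule poly_mapping_eqI)
    (auto simp: lookup_sum lookup_single when_def in_keys_iff)

lemma polys_add: "p \<in> polys n \<Longrightarrow> q \<in> polys n \<Longrightarrow> p + q \<in> polys n"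
  unfolding polys_def using keys_add[of p q] by auto

lemma polys_mult: "p \<in> polys n \<Longrightarrow> q \<in> polys n \<Longrightarrow> p * q \<in> polys n"
  unfolding polys_def
proof (intro CollectI ballI)
  fix m
  assume p: "p \<in> {p. \<forall>m\<in>Poly_Mapping.keys p. Poly_Mapping.keys m \<subseteq> {1..n}}"
    and q: "q \<in> {p. \<forall>m\<in>Poly_Mapping.keys p. Poly_Mapping.keys m \<subseteq> {1..n}}"
    and "m \<in> Poly_Mapping.keys (p * q)"
  then obtain a b where ab: "a \<in> Poly_Mapping.keys p" "b \<in> Poly_Mapping.keys q" "m = a + b"
    using keys_mult[of p q] by blast
  show "Poly_Mapping.keys m \<subseteq> {1..n}"
    using keys_add[of a b] p q ab by blast
qed

lemma polys_single: "Poly_Mapping.keys m \<subseteq> {1..n} \<Longrightarrow> Poly_Mapping.single m c \<in> polys n"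
  by (auto simp: polys_def split: if_splits)

lemma polys_const [simp]: "poly_const c \<in> polys n"
  unfolding poly_const_def by (rule polys_single) simp

lemma polys_var [simp]: "i \<in> {1..n} \<Longrightarrow> poly_var i \<in> polys n"
  unfolding poly_var_def by (rule polys_single) simp

lemma polys_one [simp]: "1 \<in> polys n"
  using polys_const[of 1 n] by (simp add: poly_const_def)

lemma polys_power: "p \<in> polys n \<Longrightarrow> p ^ k \<in> polys n"
  by (induct k) (auto intro: polys_mult)

lemma polys_uminus: "p \<in> polys n \<Longrightarrow> - p \<in> polys n"
  by (simp add: polys_def)

lemma polys_diff: "p \<in> polys n \<Longrightarrow> q \<in> polys n \<Longrightarrow> p - q \<in> polys n"
  using polys_add[of p n "-q"] polys_uminus[of q n] by simp

lemma polys_sum: "(\<And>i. i \<in> A \<Longrightarrow> f i \<in> polys n) \<Longrightarrow> (\<Sum>i\<in>A. f i) \<in> polys n"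
proof (induct A rule: infinite_finite_induct)
  case (insert x F) then show ?case by (simp add: polys_add)
qed (use polys_single[of 0 n 0] in auto)

lemma polys_single_induct:
  assumes "p \<in> polys n"
    and single: "\<And>m c. Poly_Mapping.keys m \<subseteq> {1..n} \<Longrightarrow> Q (Poly_Mapping.single m c)"
    and add: "\<And>p q. p \<in> polys n \<Longrightarrow> q \<in> polys n \<Longrightarrow> Q p \<Longrightarrow> Q q \<Longrightarrow> Q (p + q)"
  shows "Q p"
proof -
  have "finite A \<Longrightarrow> A \<subseteq> Poly_Mapping.keys p \<Longrightarrow>
      Q (\<Sum>m\<in>A. Poly_Mapping.single m (Poly_Mapping.lookup p m))" for A
  proof (induct A rule: finite_induct)
    case empty
    then show ?case using single[of 0 0] by simp
  next
    case (insert m A)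
    have k: "a \<in> insert m A \<Longrightarrow> Poly_Mapping.keys a \<subseteq> {1..n}" for a
      using assms(1) insert(4) unfolding polys_def by blast
    have "(\<Sum>m\<in>A. Poly_Mapping.single m (Poly_Mapping.lookup p m)) \<in> polys n"
      using k by (intro polys_sum polys_single) auto
    then show ?case using insert k by (simp add: add polys_single single)
  qed
  from this[OF finite_keys order_refl] show ?thesis
    using poly_mapping_sum_single[of p] by simp
qed

text \<open>Evaluation, at points and at operators, respects sums and products; so facts about polynomials
  in a tuple reduce to constants and coordinates.\<close>

lemma polys_induct [consumes 1, case_names const var add mult]:
  assumes p: "p \<in> polys n"
    and const: "\<And>c. Q (poly_const c)"
    and var: "\<And>i. i \<in> {1..n} \<Longrightarrow> Q (poly_var i)"
    and add: "\<And>p q. p \<in> polys n \<Longrightarrow> q \<in> polys n \<Longrightarrow> Q p \<Longrightarrow> Q q \<Longrightarrow> Q (p + q)"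
    and mult: "\<And>p q. p \<in> polys n \<Longrightarrow> q \<in> polys n \<Longrightarrow> Q p \<Longrightarrow> Q q \<Longrightarrow> Q (p * q)"
  shows "Q p"
proof (rule polys_single_induct[where Q = Q, OF p _ add[where p = p and q = q for p q]])
  fix m :: "nat \<Rightarrow>\<^sub>0 nat" and c :: complex
  assume m: "Poly_Mapping.keys m \<subseteq> {1..n}"
  have step: "Q (Poly_Mapping.single (Poly_Mapping.single i k) 1)" if i: "i \<in> {1..n}" for i k
  proof (induct k)
    case 0
    then show ?case using const[of 1] by (simp add: poly_const_def)
  next
    case (Suc k)
    have "Poly_Mapping.single (Poly_Mapping.single i (Suc k)) (1::complex)
        = Poly_Mapping.single (Poly_Mapping.single i k) 1 * poly_var i"
      by (simp add: poly_var_def mult_single flip: single_add)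
    moreover have "Poly_Mapping.single (Poly_Mapping.single i k) 1 \<in> polys n"
      using i by (intro polys_single) auto
    ultimately show ?case using Suc i mult polys_var var by metis
  qed
  have "finite A \<Longrightarrow> A \<subseteq> Poly_Mapping.keys m \<Longrightarrow>
     Q (Poly_Mapping.single (\<Sum>i\<in>A. Poly_Mapping.single i (Poly_Mapping.lookup m i)) c) \<and>
     Poly_Mapping.single (\<Sum>i\<in>A. Poly_Mapping.single i (Poly_Mapping.lookup m i)) c \<in> polys n" for A
  proof (induct A rule: finite_induct)
    case empty
    then show ?case using const[of c] polys_const[of c n] by (simp add: poly_const_def)
  next
    case (insert i A)
    have i: "i \<in> {1..n}" using insert m by blast
    have "Poly_Mapping.single (Poly_Mapping.single i (Poly_Mapping.lookup m i)) 1 \<in> polys n"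
      using i by (intro polys_single) auto
    moreover have "Poly_Mapping.single (\<Sum>i\<in>insert i A. Poly_Mapping.single i (Poly_Mapping.lookup m i)) c
        = Poly_Mapping.single (Poly_Mapping.single i (Poly_Mapping.lookup m i)) 1 *
          Poly_Mapping.single (\<Sum>i\<in>A. Poly_Mapping.single i (Poly_Mapping.lookup m i)) c"
      using insert by (simp add: mult_single)
    ultimately show ?case using insert mult step[OF i] polys_mult by simp
  qed
  from this[OF finite_keys order_refl] show "Q (Poly_Mapping.single m c)"
    using poly_mapping_sum_single[of m] by simp
qed

subsection \<open>Evaluation at points\<close>

lemma poly_at_superset:
  assumes "finite K" "Poly_Mapping.keys p \<subseteq> K"
  shows "poly_at n p z =
    (\<Sum>m\<in>K. Poly_Mapping.lookup p m * (\<Prod>i=1..n. z i ^ Poly_Mapping.lookup m i))"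
  unfolding poly_at_def
  by (rule sum.mono_neutral_left[OF assms]) (auto simp: in_keys_iff)

lemma poly_at_add: "poly_at n (p + q) z = poly_at n p z + poly_at n q z"
proof -
  let ?K = "Poly_Mapping.keys p \<union> Poly_Mapping.keys q"
  show ?thesis
    using poly_at_superset[of ?K "p + q" n z] poly_at_superset[of ?K p n z]
      poly_at_superset[of ?K q n z] keys_add[of p q]
    by (simp add: lookup_add distrib_right sum.distrib)
qed

lemma poly_at_single:
  "poly_at n (Poly_Mapping.single m c) z = c * (\<Prod>i=1..n. z i ^ Poly_Mapping.lookup m i)"
  using poly_at_superset[of "{m}" "Poly_Mapping.single m c" n z] by simp

lemma poly_at_zero: "poly_at n 0 z = 0"
  by (simp add: poly_at_def)

lemma poly_at_sum: "poly_at n (\<Sum>i\<in>A. f i) z = (\<Sum>i\<in>A. poly_at n (f i) z)"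
  by (induct A rule: infinite_finite_induct) (simp_all add: poly_at_zero poly_at_add)

lemma poly_at_mult: "poly_at n (p * q) z = poly_at n p z * poly_at n q z"
proof -
  have *: "poly_at n (Poly_Mapping.single a c * Poly_Mapping.single b d) z
      = poly_at n (Poly_Mapping.single a c) z * poly_at n (Poly_Mapping.single b d) z" for a b c d
    by (simp add: mult_single poly_at_single lookup_add power_add prod.distrib mult_ac)
  have "poly_at n ((\<Sum>m\<in>A. Poly_Mapping.single m (f m)) * (\<Sum>m\<in>B. Poly_Mapping.single m (g m))) z
      = poly_at n (\<Sum>m\<in>A. Poly_Mapping.single m (f m)) z * poly_at n (\<Sum>m\<in>B. Poly_Mapping.single m (g m)) z"
    for A B :: "(nat \<Rightarrow>\<^sub>0 nat) set" and f g
    by (simp only: sum_product poly_at_sum *)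
  from this[of "Poly_Mapping.lookup p" "Poly_Mapping.keys p" "Poly_Mapping.lookup q" "Poly_Mapping.keys q"]
  show ?thesis by (simp only: poly_mapping_sum_single)
qed

lemma poly_at_const [simp]: "poly_at n (poly_const c) z = c"
  by (simp add: poly_const_def poly_at_single)

lemma poly_at_one [simp]: "poly_at n 1 z = 1"
  using poly_at_const[of n 1 z] by (simp add: poly_const_def)

lemma poly_at_var [simp]: "i \<in> {1..n} \<Longrightarrow> poly_at n (poly_var i) z = z i"
proof -
  assume i: "i \<in> {1..n}"
  have "(\<Prod>j=1..n. z j ^ Poly_Mapping.lookup (Poly_Mapping.single i 1) j) = (\<Prod>j=1..n. if j = i then z i else 1)"
    by (intro prod.cong) (auto simp: lookup_single when_def)
  then show ?thesis using i by (simp add: poly_var_def poly_at_single)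
qed

lemma poly_at_power: "poly_at n (p ^ k) z = poly_at n p z ^ k"
  by (induct k) (simp_all add: poly_at_mult)

lemma poly_at_diff: "poly_at n (p - q) z = poly_at n p z - poly_at n q z"
  using poly_at_add[of n "p - q" q z] by simp

subsection \<open>Evaluation at commuting tuples\<close>

lemma commuting_tupleD:
  assumes "commuting_tuple n M T"
  shows "closed_csubspace M" "\<And>i. i \<in> {1..n} \<Longrightarrow> bounded_op_on M (T i)"
    "\<And>i j x. i \<in> {1..n} \<Longrightarrow> j \<in> {1..n} \<Longrightarrow> x \<in> M \<Longrightarrow> T i (T j x) = T j (T i x)"
  using assms by (auto simp: commuting_tuple_def)

lemma funpow_commute:
  fixes A B :: "'a \<Rightarrow> 'a"
  assumes "\<And>x. x \<in> M \<Longrightarrow> A x \<in> M" "\<And>x. x \<in> M \<Longrightarrow> A (B x) = B (A x)" "x \<in> M"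
  shows "(A ^^ k) (B x) = B ((A ^^ k) x)"
proof (induct k)
  case (Suc k)
  then show ?case using assms(2)[OF funpow_in[where k = k, OF assms(1,3)]] by simp
qed simp

text \<open>Recursion over an arbitrary list of indices makes products of commuting powers accessible to
  induction.\<close>

primrec monom_list ::
    "nat list \<Rightarrow> (nat \<Rightarrow>\<^sub>0 nat) \<Rightarrow> (nat \<Rightarrow> 'a::chilbert_space \<Rightarrow> 'a) \<Rightarrow> 'a \<Rightarrow> 'a" where
  "monom_list [] m T x = x"
| "monom_list (i # xs) m T x = (T i ^^ Poly_Mapping.lookup m i) (monom_list xs m T x)"

lemma monom_op_eq: "monom_op n m T = monom_list [1..<Suc n] m T"
proof -
  have "foldr (\<lambda>i f. (T i ^^ Poly_Mapping.lookup m i) \<circ> f) xs id x = monom_list xs m T x" for xs x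
    by (induct xs) auto
  then show ?thesis unfolding monom_op_def by blast
qed

lemma monom_list_bounded:
  assumes T: "commuting_tuple n M T" and xs: "set xs \<subseteq> {1..n}"
  shows "bounded_op_on M (monom_list xs m T)"
  using xs
proof (induct xs)
  case Nil
  have "monom_list [] m T = (\<lambda>x. x)" by (rule ext) simp
  then show ?case using bounded_op_on_id by metis
next
  case (Cons i xs)
  then have "bounded_op_on M (\<lambda>x. (T i ^^ Poly_Mapping.lookup m i) (monom_list xs m T x))"
    using bounded_op_on_comp[OF bounded_op_on_funpow[OF commuting_tupleD(2)[OF T, of i]], of "monom_list xs m T"]
    by simp
  moreover have "monom_list (i # xs) m T = (\<lambda>x. (T i ^^ Poly_Mapping.lookup m i) (monom_list xs m T x))"
    by (rule ext) simp
  ultimately show ?case by metis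
qed

lemma monom_list_commute:
  assumes T: "commuting_tuple n M T" and xs: "set xs \<subseteq> {1..n}"
    and B: "\<And>x. x \<in> M \<Longrightarrow> B x \<in> M" "\<And>i x. i \<in> {1..n} \<Longrightarrow> x \<in> M \<Longrightarrow> T i (B x) = B (T i x)"
    and x: "x \<in> M"
  shows "monom_list xs m T (B x) = B (monom_list xs m T x)"
  using xs
proof (induct xs)
  case (Cons i xs)
  have "(T i ^^ k) (B y) = B ((T i ^^ k) y)" if "y \<in> M" for y k
    using Cons(2) that B(2)
    by (intro funpow_commute[of M] bounded_op_onD(1)[OF commuting_tupleD(2)[OF T]]) auto
  then show ?case
    using Cons bounded_op_onD(1)[OF monom_list_bounded[OF T, of xs]] x by simp
qed simp

lemma monom_list_add:
  assumes T: "commuting_tuple n M T" and xs: "set xs \<subseteq> {1..n}" and x: "x \<in> M"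
  shows "monom_list xs (m + m') T x = monom_list xs m T (monom_list xs m' T x)"
  using xs
proof (induct xs)
  case (Cons i xs)
  let ?b = "T i ^^ Poly_Mapping.lookup m' i"
  have i: "i \<in> {1..n}" and xs: "set xs \<subseteq> {1..n}" using Cons(2) by auto
  have b: "bounded_op_on M ?b"
    using i by (intro bounded_op_on_funpow commuting_tupleD(2)[OF T])
  have "monom_list xs m T (?b y) = ?b (monom_list xs m T y)" if "y \<in> M" for y
  proof (rule monom_list_commute[OF T xs _ _ that])
    show "T j (?b z) = ?b (T j z)" if "j \<in> {1..n}" "z \<in> M" for j z
      using that i
      by (intro funpow_commute[of M "T i" "T j", symmetric] bounded_op_onD(1)[OF commuting_tupleD(2)[OF T]]
          commuting_tupleD(3)[OF T]) auto
  qed (use bounded_op_onD(1)[OF b] in auto)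
  then show ?case
    using Cons xs bounded_op_onD(1)[OF monom_list_bounded[OF T xs]] x
    by (simp add: lookup_add funpow_add)
qed simp

lemma monom_op_bounded:
  "commuting_tuple n M T \<Longrightarrow> bounded_op_on M (monom_op n m T)"
  unfolding monom_op_eq by (rule monom_list_bounded) auto

lemma monom_op_add:
  "commuting_tuple n M T \<Longrightarrow> x \<in> M \<Longrightarrow> monom_op n (m + m') T x = monom_op n m T (monom_op n m' T x)"
  unfolding monom_op_eq by (rule monom_list_add) auto

lemma poly_op_superset:
  assumes "finite K" "Poly_Mapping.keys p \<subseteq> K"
  shows "poly_op n p T x = (\<Sum>m\<in>K. Poly_Mapping.lookup p m *\<^sub>C monom_op n m T x)"
  unfolding poly_op_def
  by (rule sum.mono_neutral_left[OF assms]) (auto simp: in_keys_iff)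

lemma poly_op_add: "poly_op n (p + q) T x = poly_op n p T x + poly_op n q T x"
proof -
  let ?K = "Poly_Mapping.keys p \<union> Poly_Mapping.keys q"
  show ?thesis
    using poly_op_superset[of ?K "p + q" n T x] poly_op_superset[of ?K p n T x]
      poly_op_superset[of ?K q n T x] keys_add[of p q]
    by (simp add: lookup_add scaleC_add_left sum.distrib)
qed

lemma poly_op_single: "poly_op n (Poly_Mapping.single m c) T x = c *\<^sub>C monom_op n m T x"
  using poly_op_superset[of "{m}" "Poly_Mapping.single m c" n T x] by simp

lemma poly_op_sum: "poly_op n (\<Sum>i\<in>A. f i) T x = (\<Sum>i\<in>A. poly_op n (f i) T x)"
  by (induct A rule: infinite_finite_induct) (simp_all add: poly_op_add, simp_all add: poly_op_def)

lemma poly_op_diff: "poly_op n (p - q) T x = poly_op n p T x - poly_op n q T x"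
  using poly_op_add[of n "p - q" q T x] by simp

lemma poly_op_const [simp]: "poly_op n (poly_const c) T x = c *\<^sub>C x"
proof -
  have "monom_list xs 0 T x = x" for xs
    by (induct xs) auto
  then show ?thesis by (simp add: poly_const_def poly_op_single monom_op_eq)
qed

lemma poly_op_one [simp]: "poly_op n 1 T x = x"
  using poly_op_const[of n 1 T x] by (simp add: poly_const_def)

lemma poly_op_var [simp]: "i \<in> {1..n} \<Longrightarrow> poly_op n (poly_var i) T x = T i x"
proof -
  assume i: "i \<in> {1..n}"
  have "distinct xs \<Longrightarrow> monom_list xs (Poly_Mapping.single i 1) T x = (if i \<in> set xs then T i x else x)" for xs
    by (induct xs) (auto simp: lookup_single when_def)
  from this[of "[1..<Suc n]"] show ?thesis
    using i by (simp add: poly_var_def poly_op_single monom_op_eq del: upt_Suc)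
qed

lemma poly_op_bounded:
  assumes "commuting_tuple n M T"
  shows "bounded_op_on M (poly_op n p T)"
proof -
  have "bounded_op_on M (poly_op n (\<Sum>m\<in>A. Poly_Mapping.single m (f m)) T)" for A and f :: "(nat \<Rightarrow>\<^sub>0 nat) \<Rightarrow> complex"
  proof (induct A rule: infinite_finite_induct)
    case (insert m A)
    have "bounded_op_on M (\<lambda>x. f m *\<^sub>C monom_op n m T x
        + poly_op n (\<Sum>m\<in>A. Poly_Mapping.single m (f m)) T x)"
      by (rule bounded_op_on_add[OF commuting_tupleD(1)[OF assms]
          bounded_op_on_comp[OF bounded_op_on_scaleC[OF commuting_tupleD(1)[OF assms]] monom_op_bounded[OF assms]]
          insert(3)])
    moreover have "poly_op n (\<Sum>m\<in>insert m A. Poly_Mapping.single m (f m)) T =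
        (\<lambda>x. f m *\<^sub>C monom_op n m T x + poly_op n (\<Sum>m\<in>A. Poly_Mapping.single m (f m)) T x)"
      by (rule ext) (simp only: sum.insert[OF insert(1,2)] poly_op_add poly_op_single)
    ultimately show ?case by (simp only:)
  qed (use bounded_op_on_scaleC[OF commuting_tupleD(1)[OF assms], of 0] in \<open>auto simp: poly_op_def[abs_def]\<close>)
  from this[of "\<lambda>m. Poly_Mapping.lookup p m" "Poly_Mapping.keys p"] show ?thesis
    using poly_mapping_sum_single[of p] by simp
qed

lemma poly_op_mult:
  assumes T: "commuting_tuple n M T" and x: "x \<in> M"
  shows "poly_op n (p * q) T x = poly_op n p T (poly_op n q T x)"
proof -
  note M = commuting_tupleD(1)[OF T]
  have *: "poly_op n (Poly_Mapping.single a c * Poly_Mapping.single b d) T x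
      = poly_op n (Poly_Mapping.single a c) T (poly_op n (Poly_Mapping.single b d) T x)" for a b c d
    using clinear_onD(2)[OF M bounded_op_onD(2)[OF monom_op_bounded[OF T]]
        bounded_op_onD(1)[OF monom_op_bounded[OF T] x]]
    by (simp add: mult_single poly_op_single monom_op_add[OF T x] scaleC_scaleC)
  have "poly_op n ((\<Sum>m\<in>A. Poly_Mapping.single m (f m)) * (\<Sum>m\<in>B. Poly_Mapping.single m (g m))) T x
      = poly_op n (\<Sum>m\<in>A. Poly_Mapping.single m (f m)) T
          (poly_op n (\<Sum>m\<in>B. Poly_Mapping.single m (g m)) T x)"
    for A B :: "(nat \<Rightarrow>\<^sub>0 nat) set" and f g
    unfolding sum_product poly_op_sum *
    by (intro sum.cong refl clinear_on_sum[OF M bounded_op_onD(2)[OF poly_op_bounded[OF T]], symmetric]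
        bounded_op_onD(1)[OF poly_op_bounded[OF T] x])
  from this[of "Poly_Mapping.lookup p" "Poly_Mapping.keys p" "Poly_Mapping.lookup q" "Poly_Mapping.keys q"]
  show ?thesis by (simp only: poly_mapping_sum_single)
qed

lemma poly_op_power:
  assumes T: "commuting_tuple n M T" and x: "x \<in> M"
  shows "poly_op n (p ^ k) T x = (poly_op n p T ^^ k) x"
proof (induct k)
  case (Suc k)
  then show ?case using poly_op_mult[OF T x, of p "p ^ k"] by simp
qed simp

lemma poly_op_commute:
  assumes T: "commuting_tuple n M T" and p: "p \<in> polys n"
    and B: "clinear_on M B" "\<And>x. x \<in> M \<Longrightarrow> B x \<in> M"
      "\<And>i x. i \<in> {1..n} \<Longrightarrow> x \<in> M \<Longrightarrow> T i (B x) = B (T i x)"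
    and x: "x \<in> M"
  shows "poly_op n p T (B x) = B (poly_op n p T x)"
  using p x
proof (induct p arbitrary: x rule: polys_induct)
  case (const c)
  then show ?case using clinear_onD(2)[OF commuting_tupleD(1)[OF T] B(1)] by simp
next
  case (add p q)
  then show ?case
    using clinear_onD(1)[OF commuting_tupleD(1)[OF T] B(1)] bounded_op_onD(1)[OF poly_op_bounded[OF T]]
    by (simp add: poly_op_add)
next
  case (mult p q)
  then show ?case
    using B(2) bounded_op_onD(1)[OF poly_op_bounded[OF T]] by (simp add: poly_op_mult[OF T])
qed (use B in auto)

lemma poly_op_commute_var:
  assumes T: "commuting_tuple n M T" and p: "p \<in> polys n" and i: "i \<in> {1..n}" and x: "x \<in> M"
  shows "poly_op n p T (T i x) = T i (poly_op n p T x)"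
  using bounded_op_onD[OF commuting_tupleD(2)[OF T i]] commuting_tupleD(3)[OF T _ i]
  by (intro poly_op_commute[OF T p _ _ _ x]) auto

section \<open>Exactness of the Koszul complex\<close>

definition koszul_sign :: "nat \<Rightarrow> nat set \<Rightarrow> complex" where
  "koszul_sign j J = (- 1) ^ card {i\<in>J. i < j}"

lemma koszul_map_eq:
  "J \<subseteq> {1..n} \<Longrightarrow> koszul_map n T x J = (\<Sum>j\<in>J. koszul_sign j J *\<^sub>C T j (x (J - {j})))"
  by (simp add: koszul_map_def koszul_sign_def)

lemma koszul_map_outside: "\<not> J \<subseteq> {1..n} \<Longrightarrow> koszul_map n T x J = 0"
  by (simp add: koszul_map_def)

lemma koszul_sign_square: "koszul_sign j J * koszul_sign j J = 1"
  by (simp add: koszul_sign_def flip: power_add mult_2)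

lemma koszul_sign_remove:
  assumes "finite J" "i \<in> J"
  shows "koszul_sign j (J - {i}) = (if i < j then - koszul_sign j J else koszul_sign j J)"
proof (cases "i < j")
  case True
  have "{k\<in>J. k < j} = insert i {k\<in>J - {i}. k < j}" using assms(2) True by auto
  then have "card {k\<in>J. k < j} = Suc (card {k\<in>J - {i}. k < j})" using assms(1) by simp
  then show ?thesis using True by (simp add: koszul_sign_def)
next
  case False
  then have "{k\<in>J - {i}. k < j} = {k\<in>J. k < j}" by auto
  then show ?thesis using False by (simp add: koszul_sign_def)
qed

lemma koszul_sign_insert:
  assumes "finite J" "i \<notin> J"
  shows "koszul_sign j (insert i J) = (if i < j then - koszul_sign j J else koszul_sign j J)"
  using koszul_sign_remove[of "insert i J" i j] assms by (simp split: if_splits)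

lemma koszul_spaceD:
  assumes "x \<in> koszul_space n M"
  shows "J \<subseteq> {1..n} \<Longrightarrow> x J \<in> M" "\<not> J \<subseteq> {1..n} \<Longrightarrow> x J = 0"
  using assms by (auto simp: koszul_space_def)

lemma koszul_spaceI:
  assumes "\<And>J. J \<subseteq> {1..n} \<Longrightarrow> x J \<in> M" "\<And>J. \<not> J \<subseteq> {1..n} \<Longrightarrow> x J = 0"
  shows "x \<in> koszul_space n M"
  using assms by (auto simp: koszul_space_def)

lemma koszul_map_space:
  assumes T: "commuting_tuple n M T" and x: "x \<in> koszul_space n M"
  shows "koszul_map n T x \<in> koszul_space n M"
proof (rule koszul_spaceI)
  fix J :: "nat set" assume J: "J \<subseteq> {1..n}"
  show "koszul_map n T x J \<in> M"
    unfolding koszul_map_eq[OF J]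
  proof (intro closed_csubspace_sum closed_csubspaceD(4) commuting_tupleD(1)[OF T])
    fix j assume "j \<in> J"
    then show "T j (x (J - {j})) \<in> M"
      using J by (intro bounded_op_onD(1)[OF commuting_tupleD(2)[OF T]] koszul_spaceD(1)[OF x]) auto
  qed
qed (rule koszul_map_outside)

text \<open>The terms that remove \<open>i\<close> and \<open>j\<close> in the two possible orders cancel: the operators commute and
  the signs are opposite.\<close>

lemma koszul_map_squared:
  assumes T: "commuting_tuple n M T" and x: "x \<in> koszul_space n M"
  shows "koszul_map n T (koszul_map n T x) = (\<lambda>_. 0)"
proof
  fix J :: "nat set"
  show "koszul_map n T (koszul_map n T x) J = 0"
  proof (cases "J \<subseteq> {1..n}")
    case True
    note M = commuting_tupleD(1)[OF T]
    have fin: "finite J" using True finite_subset by blast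
    define f where "f j i = (if i = j then 0 else (koszul_sign j J * koszul_sign i (J - {j})) *\<^sub>C
        T j (T i (x (J - {j} - {i}))))" for j i
    have TM: "T i y \<in> M" if "i \<in> J" "y \<in> M" for i y
      using that True bounded_op_onD(1)[OF commuting_tupleD(2)[OF T]] by blast
    have xM: "x (J - {a} - {b}) \<in> M" for a b using True by (intro koszul_spaceD(1)[OF x]) auto
    have anti: "f j i = - f i j" if "i \<in> J" "j \<in> J" for i j
    proof (cases "i = j")
      case False
      have "koszul_sign j J * koszul_sign i (J - {j}) = - (koszul_sign i J * koszul_sign j (J - {i}))"
        using that False by (auto simp: koszul_sign_remove[OF fin])
      moreover have "J - {j} - {i} = J - {i} - {j}" by auto
      moreover have "T j (T i (x (J - {i} - {j}))) = T i (T j (x (J - {i} - {j})))"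
        using that True xM by (intro commuting_tupleD(3)[OF T]) blast+
      ultimately show ?thesis using False by (simp add: f_def scaleC_minus_left)
    qed (simp add: f_def)
    have "koszul_map n T (koszul_map n T x) J = (\<Sum>j\<in>J. \<Sum>i\<in>J. f j i)"
      unfolding koszul_map_eq[OF True]
    proof (rule sum.cong[OF refl])
      fix j assume j: "j \<in> J"
      then have j': "j \<in> {1..n}" using True by auto
      note lin = bounded_op_onD(2)[OF commuting_tupleD(2)[OF T j']]
      have Mi: "T i (x (J - {j} - {i})) \<in> M" if "i \<in> J" for i
        using TM[OF that xM] .
      have "koszul_sign j J *\<^sub>C T j (koszul_map n T x (J - {j}))
          = koszul_sign j J *\<^sub>C T j (\<Sum>i\<in>J-{j}. koszul_sign i (J - {j}) *\<^sub>C T i (x (J - {j} - {i})))"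
        using True by (subst koszul_map_eq) auto
      also have "\<dots> = (\<Sum>i\<in>J-{j}. (koszul_sign j J * koszul_sign i (J - {j})) *\<^sub>C T j (T i (x (J - {j} - {i}))))"
        using Mi closed_csubspaceD(4)[OF M]
        by (subst clinear_on_sum[OF M lin]) (auto simp: clinear_onD(2)[OF M lin] scaleC_sum_right scaleC_scaleC)
      also have "\<dots> = (\<Sum>i\<in>J. f j i)"
        using fin j by (simp add: sum.remove[of J j] f_def)
      finally show "koszul_sign j J *\<^sub>C T j (koszul_map n T x (J - {j})) = (\<Sum>i\<in>J. f j i)" .
    qed
    moreover have "(\<Sum>j\<in>J. \<Sum>i\<in>J. f j i) = - (\<Sum>j\<in>J. \<Sum>i\<in>J. f j i)"
    proof -
      have "(\<Sum>j\<in>J. \<Sum>i\<in>J. f j i) = (\<Sum>j\<in>J. \<Sum>i\<in>J. - f i j)"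
        by (intro sum.cong refl anti)
      also have "\<dots> = - (\<Sum>i\<in>J. \<Sum>j\<in>J. f i j)" by (subst sum.swap) (simp add: sum_negf)
      finally show ?thesis .
    qed
    ultimately have "(2::real) *\<^sub>R koszul_map n T (koszul_map n T x) J = 0"
      unfolding scaleR_2 by (metis add_eq_0_iff)
    then show ?thesis by simp
  qed (rule koszul_map_outside)
qed

text \<open>Contraction with the \<open>k\<close>-th basis vector is a homotopy between multiplication by \<open>T k\<close>
  and zero, so \<open>T k\<close> acts as zero on the cohomology of the Koszul complex.\<close>

lemma koszul_contraction:
  assumes T: "commuting_tuple n M T" and x: "x \<in> koszul_space n M"
    and closed: "koszul_map n T x = (\<lambda>_. 0)" and k: "k \<in> {1..n}"
  shows "\<exists>y\<in>koszul_space n M. \<forall>J. koszul_map n T y J = T k (x J)"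
proof -
  note M = commuting_tupleD(1)[OF T]
  define h where "h I = (if I \<subseteq> {1..n} \<and> k \<notin> I then koszul_sign k I *\<^sub>C x (insert k I) else 0)" for I
  have "h \<in> koszul_space n M"
  proof (rule koszul_spaceI)
    fix J :: "nat set" assume "J \<subseteq> {1..n}"
    then show "h J \<in> M"
      using k koszul_spaceD(1)[OF x, of "insert k J"] closed_csubspaceD(2,4)[OF M] by (auto simp: h_def)
  qed (simp add: h_def)
  moreover have "koszul_map n T h J = T k (x J)" for J
  proof -
    note lin = clinear_onD[OF M bounded_op_onD(2)[OF commuting_tupleD(2)[OF T]]]
    have "T k (x J) = koszul_map n T h J"
    proof (cases "J \<subseteq> {1..n}")
      case False
      then show ?thesis using koszul_spaceD(2)[OF x False] lin(3)[OF k] by (simp add: koszul_map_outside)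
    next
      case J: True
      then have fin: "finite J" using finite_subset by blast
      show ?thesis
      proof (cases "k \<in> J")
        case True
        have "koszul_map n T h J = (\<Sum>j\<in>J. koszul_sign j J *\<^sub>C T j (h (J - {j})))"
          by (rule koszul_map_eq[OF J])
        also have "\<dots> = koszul_sign k J *\<^sub>C T k (h (J - {k}))"
        proof (subst sum.remove[OF fin True])
          have "koszul_sign j J *\<^sub>C T j (h (J - {j})) = 0" if "j \<in> J - {k}" for j
            using that True J lin(3)[of j] by (auto simp: h_def)
          then show "koszul_sign k J *\<^sub>C T k (h (J - {k})) + (\<Sum>j\<in>J - {k}. koszul_sign j J *\<^sub>C T j (h (J - {j})))
              = koszul_sign k J *\<^sub>C T k (h (J - {k}))" by simp
        qed
        also have "h (J - {k}) = koszul_sign k J *\<^sub>C x J"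
          using J True by (auto simp: h_def koszul_sign_remove[OF fin] insert_absorb)
        also have "koszul_sign k J *\<^sub>C T k (koszul_sign k J *\<^sub>C x J) = T k (x J)"
          by (simp add: lin(2)[OF k koszul_spaceD(1)[OF x J]] scaleC_scaleC koszul_sign_square)
        finally show ?thesis by simp
      next
        case False
        have kJ: "insert k J \<subseteq> {1..n}" using J k by auto
        have "0 = koszul_map n T x (insert k J)" using closed by simp
        also have "\<dots> = koszul_sign k (insert k J) *\<^sub>C T k (x (insert k J - {k})) +
            (\<Sum>j\<in>J. koszul_sign j (insert k J) *\<^sub>C T j (x (insert k J - {j})))"
          using fin False by (simp add: koszul_map_eq[OF kJ])
        also have "insert k J - {k} = J" using False by auto
        also have "koszul_sign k (insert k J) = koszul_sign k J"
          using koszul_sign_insert[OF fin False] by simp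
        finally have "0 = koszul_sign k J *\<^sub>C (koszul_sign k J *\<^sub>C T k (x J) +
            (\<Sum>j\<in>J. koszul_sign j (insert k J) *\<^sub>C T j (x (insert k J - {j}))))" by (metis scaleC_zero_right)
        then have "T k (x J) = - (\<Sum>j\<in>J. (koszul_sign k J * koszul_sign j (insert k J)) *\<^sub>C T j (x (insert k J - {j})))"
          by (simp add: scaleC_add_right scaleC_scaleC koszul_sign_square scaleC_sum_right eq_neg_iff_add_eq_0)
        also have "\<dots> = (\<Sum>j\<in>J. koszul_sign j J *\<^sub>C T j (h (J - {j})))"
          unfolding sum_negf[symmetric]
        proof (rule sum.cong[OF refl])
          fix j assume j: "j \<in> J"
          then have jk: "j \<noteq> k" and jn: "j \<in> {1..n}" using False J by auto
          have sub: "insert k (J - {j}) \<subseteq> {1..n}" using kJ by auto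
          have e: "insert k J - {j} = insert k (J - {j})" using jk by auto
          have h: "h (J - {j}) = koszul_sign k (J - {j}) *\<^sub>C x (insert k (J - {j}))"
            using J False by (auto simp: h_def)
          have s: "koszul_sign j J * koszul_sign k (J - {j}) = - (koszul_sign k J * koszul_sign j (insert k J))"
            using jk j by (auto simp: koszul_sign_remove[OF fin] koszul_sign_insert[OF fin False])
          show "- ((koszul_sign k J * koszul_sign j (insert k J)) *\<^sub>C T j (x (insert k J - {j})))
              = koszul_sign j J *\<^sub>C T j (h (J - {j}))"
            unfolding h e lin(2)[OF jn koszul_spaceD(1)[OF x sub]] scaleC_scaleC s
            by (simp add: scaleC_minus_left)
        qed
        finally show ?thesis by (simp add: koszul_map_eq[OF J])
      qed
    qed
    then show ?thesis by simp
  qed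
  ultimately show ?thesis by blast
qed

text \<open>\<open>A\<close> induces the zero map on the cohomology of the Koszul complex.\<close>

definition kills_cohomology ::
    "nat \<Rightarrow> 'a::chilbert_space set \<Rightarrow> (nat \<Rightarrow> 'a \<Rightarrow> 'a) \<Rightarrow> ('a \<Rightarrow> 'a) \<Rightarrow> bool" where
  "kills_cohomology n M T A \<longleftrightarrow> (\<forall>x\<in>koszul_space n M. koszul_map n T x = (\<lambda>_. 0) \<longrightarrow>
     (\<exists>y\<in>koszul_space n M. \<forall>J. koszul_map n T y J = A (x J)))"

lemma kills_cohomologyD:
  assumes "kills_cohomology n M T A" "x \<in> koszul_space n M" "koszul_map n T x = (\<lambda>_. 0)"
  obtains y where "y \<in> koszul_space n M" "\<And>J. koszul_map n T y J = A (x J)"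
  using assms unfolding kills_cohomology_def by metis

lemma kills_cohomologyI:
  assumes "\<And>x. x \<in> koszul_space n M \<Longrightarrow> koszul_map n T x = (\<lambda>_. 0) \<Longrightarrow>
    \<exists>y\<in>koszul_space n M. \<forall>J. koszul_map n T y J = A (x J)"
  shows "kills_cohomology n M T A"
  using assms unfolding kills_cohomology_def by simp

lemma koszul_map_commute:
  assumes T: "commuting_tuple n M T" and x: "x \<in> koszul_space n M"
    and B: "clinear_on M B" "\<And>x. x \<in> M \<Longrightarrow> B x \<in> M"
      "\<And>i x. i \<in> {1..n} \<Longrightarrow> x \<in> M \<Longrightarrow> T i (B x) = B (T i x)"
  shows "(\<lambda>J. B (x J)) \<in> koszul_space n M"
    "koszul_map n T (\<lambda>J. B (x J)) J = B (koszul_map n T x J)"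
proof -
  note M = commuting_tupleD(1)[OF T]
  note lin = clinear_onD[OF M B(1)]
  show "(\<lambda>J. B (x J)) \<in> koszul_space n M"
    by (rule koszul_spaceI) (auto simp: koszul_spaceD[OF x] B(2) lin(3))
  show "koszul_map n T (\<lambda>J. B (x J)) J = B (koszul_map n T x J)"
  proof (cases "J \<subseteq> {1..n}")
      case True
      have in_M: "T j (x (J - {j})) \<in> M" if "j \<in> J" for j
        using that True
        by (intro bounded_op_onD(1)[OF commuting_tupleD(2)[OF T]] koszul_spaceD(1)[OF x]) auto
      have "B (T j (x (J - {j}))) = T j (B (x (J - {j})))" if "j \<in> J" for j
        using that True by (intro B(3)[symmetric] koszul_spaceD(1)[OF x]) auto
      then show ?thesis
        using in_M closed_csubspaceD(4)[OF M]
        by (simp add: koszul_map_eq[OF True] clinear_on_sum[OF M B(1)] lin(2))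
  qed (simp add: koszul_map_outside lin(3))
qed

lemma kills_cohomology_comp:
  assumes T: "commuting_tuple n M T" and A: "kills_cohomology n M T A"
    and B: "clinear_on M B" "\<And>x. x \<in> M \<Longrightarrow> B x \<in> M"
      "\<And>i x. i \<in> {1..n} \<Longrightarrow> x \<in> M \<Longrightarrow> T i (B x) = B (T i x)"
  shows "kills_cohomology n M T (\<lambda>x. B (A x))"
proof (rule kills_cohomologyI)
  fix x assume "x \<in> koszul_space n M" "koszul_map n T x = (\<lambda>_. 0)"
  then obtain y where y: "y \<in> koszul_space n M" "\<And>J. koszul_map n T y J = A (x J)"
    using kills_cohomologyD[OF A] by blast
  have "koszul_map n T (\<lambda>J. B (y J)) J = B (A (x J))" for J
    using koszul_map_commute(2)[where B = B, OF T y(1) B] y(2) by simp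
  then show "\<exists>y\<in>koszul_space n M. \<forall>J. koszul_map n T y J = B (A (x J))"
    using koszul_map_commute(1)[where B = B, OF T y(1) B] by (intro bexI[of _ "\<lambda>J. B (y J)"]) auto
qed

lemma kills_cohomology_add:
  assumes T: "commuting_tuple n M T" and A: "kills_cohomology n M T A" and B: "kills_cohomology n M T B"
  shows "kills_cohomology n M T (\<lambda>x. A x + B x)"
proof (rule kills_cohomologyI)
  note M = commuting_tupleD(1)[OF T]
  fix x assume x: "x \<in> koszul_space n M" "koszul_map n T x = (\<lambda>_. 0)"
  obtain y where y: "y \<in> koszul_space n M" "\<And>J. koszul_map n T y J = A (x J)"
    using kills_cohomologyD[OF A x] by blast
  obtain z where z: "z \<in> koszul_space n M" "\<And>J. koszul_map n T z J = B (x J)"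
    using kills_cohomologyD[OF B x] by blast
  have "koszul_map n T (\<lambda>J. y J + z J) J = koszul_map n T y J + koszul_map n T z J" for J
  proof (cases "J \<subseteq> {1..n}")
    case True
    have "T j (y (J - {j}) + z (J - {j})) = T j (y (J - {j})) + T j (z (J - {j}))" if "j \<in> J" for j
      using that True by (intro clinear_onD(1)[OF M bounded_op_onD(2)[OF commuting_tupleD(2)[OF T]]]
          koszul_spaceD(1)[OF y(1)] koszul_spaceD(1)[OF z(1)]) auto
    then show ?thesis by (simp add: koszul_map_eq[OF True] scaleC_add_right sum.distrib)
  qed (simp add: koszul_map_outside)
  moreover have "(\<lambda>J. y J + z J) \<in> koszul_space n M"
    using closed_csubspaceD(3)[OF M] koszul_spaceD[OF y(1)] koszul_spaceD[OF z(1)]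
    by (intro koszul_spaceI) auto
  ultimately show "\<exists>y\<in>koszul_space n M. \<forall>J. koszul_map n T y J = A (x J) + B (x J)"
    using y(2) z(2) by (intro bexI[of _ "\<lambda>J. y J + z J"]) auto
qed

lemma commuting_tuple_shift:
  assumes T: "commuting_tuple n M T"
  shows "commuting_tuple n M (\<lambda>i x. T i x - z i *\<^sub>C x)"
proof -
  note M = commuting_tupleD(1)[OF T]
  have "bounded_op_on M (\<lambda>x. T i x - z i *\<^sub>C x)" if "i \<in> {1..n}" for i
    using bounded_op_on_add[OF M commuting_tupleD(2)[OF T that] bounded_op_on_scaleC[OF M, of "- z i"]]
    by (simp add: scaleC_minus_left)
  moreover have "T i (T j x - z j *\<^sub>C x) - z i *\<^sub>C (T j x - z j *\<^sub>C x)
      = T j (T i x - z i *\<^sub>C x) - z j *\<^sub>C (T i x - z i *\<^sub>C x)"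
    if "i \<in> {1..n}" "j \<in> {1..n}" "x \<in> M" for i j x
  proof -
    note lin = clinear_onD[OF M bounded_op_onD(2)[OF commuting_tupleD(2)[OF T]]]
    have "T i x \<in> M" "T j x \<in> M" using that bounded_op_onD(1)[OF commuting_tupleD(2)[OF T]] by auto
    then show ?thesis
      using that closed_csubspaceD(4)[OF M]
      by (simp add: lin(2,5) commuting_tupleD(3)[OF T that] scaleC_diff_right scaleC_scaleC mult.commute)
  qed
  ultimately show ?thesis using M by (simp add: commuting_tuple_def)
qed

text \<open>Each \<open>T\<^sub>i - z\<^sub>i\<close> kills the cohomology, and the operators that do so are stable under sums and
  under multiplication by operators in the commutant; \<open>p(T) - p(z)\<close> is generated in this way.\<close>

lemma kills_cohomology_poly:
  assumes T: "commuting_tuple n M T" and p: "p \<in> polys n"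
  shows "kills_cohomology n M (\<lambda>i x. T i x - z i *\<^sub>C x)
    (\<lambda>x. poly_op n p T x - poly_at n p z *\<^sub>C x)"
  using p
proof (induct p rule: polys_induct)
  case (const c)
  have z: "(\<lambda>J. 0) \<in> koszul_space n M"
    by (rule koszul_spaceI) (auto simp: closed_csubspaceD(2)[OF commuting_tupleD(1)[OF T]])
  have "koszul_map n (\<lambda>i x. T i x - z i *\<^sub>C x) (\<lambda>J. 0) J = 0" for J
  proof -
    have "T j 0 = 0" if "j \<in> {1..n}" for j
      using clinear_onD(3)[OF commuting_tupleD(1)[OF T] bounded_op_onD(2)[OF commuting_tupleD(2)[OF T that]]] .
    then show ?thesis by (auto simp: koszul_map_def intro!: sum.neutral)
  qed
  then show ?case using z by (intro kills_cohomologyI bexI[of _ "\<lambda>J. 0"]) auto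
next
  case (var i)
  show ?case
    using koszul_contraction[OF commuting_tuple_shift[OF T] _ _ var] by (intro kills_cohomologyI) (use var in simp)
next
  case (add p q)
  then show ?case
    using kills_cohomology_add[OF commuting_tuple_shift[OF T] add(3,4)]
    by (simp add: poly_op_add poly_at_add scaleC_add_left add_diff_add)
next
  case (mult p q)
  let ?T' = "\<lambda>i x. T i x - z i *\<^sub>C x"
  note T' = commuting_tuple_shift[OF T, of z]
  note M = commuting_tupleD(1)[OF T]
  note b = poly_op_bounded[OF T]
  have comm: "?T' i (poly_op n p T x) = poly_op n p T (?T' i x)" if "i \<in> {1..n}" "x \<in> M" for i x
    using that poly_op_commute_var[OF T mult(1) that] closed_csubspaceD(4)[OF M]
      bounded_op_onD(1)[OF commuting_tupleD(2)[OF T]]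
    by (simp add: clinear_onD(2,5)[OF M bounded_op_onD(2)[OF b]])
  have comm': "?T' i (poly_at n q z *\<^sub>C x) = poly_at n q z *\<^sub>C ?T' i x" if "i \<in> {1..n}" "x \<in> M" for i x
    using that clinear_onD(2)[OF M bounded_op_onD(2)[OF commuting_tupleD(2)[OF T]]]
    by (simp add: scaleC_diff_right scaleC_scaleC mult.commute)
  have "kills_cohomology n M ?T' (\<lambda>x. poly_op n p T (poly_op n q T x - poly_at n q z *\<^sub>C x)
      + poly_at n q z *\<^sub>C (poly_op n p T x - poly_at n p z *\<^sub>C x))"
    using comm comm' bounded_op_onD[OF b] bounded_op_onD[OF bounded_op_on_scaleC[OF M]]
    by (intro kills_cohomology_add[OF T'] kills_cohomology_comp[OF T' mult(4)]
        kills_cohomology_comp[OF T' mult(3)]) auto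
  moreover have "poly_op n p T (poly_op n q T x - poly_at n q z *\<^sub>C x)
      + poly_at n q z *\<^sub>C (poly_op n p T x - poly_at n p z *\<^sub>C x)
      = poly_op n (p * q) T x - poly_at n (p * q) z *\<^sub>C x" if "x \<in> M" for x
    using that closed_csubspaceD(4)[OF M] bounded_op_onD(1)[OF b]
    by (simp add: poly_op_mult[OF T] poly_at_mult scaleC_diff_right scaleC_scaleC mult.commute
        clinear_onD(2,5)[OF M bounded_op_onD(2)[OF b]])
  moreover have "kills_cohomology n M ?T' A \<longleftrightarrow> kills_cohomology n M ?T' B"
    if "\<And>x. x \<in> M \<Longrightarrow> A x = B x" "A 0 = B 0" for A B :: "'a \<Rightarrow> 'a"
  proof -
    have "A (x J) = B (x J)" if "x \<in> koszul_space n M" for x J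
      using \<open>\<And>x. x \<in> M \<Longrightarrow> A x = B x\<close> \<open>A 0 = B 0\<close> koszul_spaceD[OF that] by metis
    then show ?thesis unfolding kills_cohomology_def by simp
  qed
  ultimately show ?case using closed_csubspaceD(2)[OF M] by (metis (no_types, lifting))
qed

text \<open>If \<open>A\<close> is bijective on \<open>M\<close>, a cocycle \<open>x\<close> is \<open>A\<close> applied to the cocycle \<open>A\<^sup>-\<^sup>1 x\<close>, hence a
  coboundary.\<close>

lemma koszul_exact_invertible:
  assumes T: "commuting_tuple n M T" and A: "kills_cohomology n M T A"
    and lin: "clinear_on M A" and bij: "bij_betw A M M"
    and comm: "\<And>i x. i \<in> {1..n} \<Longrightarrow> x \<in> M \<Longrightarrow> T i (A x) = A (T i x)"
  shows "koszul_exact n M T"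
proof -
  note M = commuting_tupleD(1)[OF T]
  note M' = closed_csubspaceD[OF M]
  define B where "B = inv_into M A"
  have BM: "B x \<in> M" and AB: "A (B x) = x" if "x \<in> M" for x
    using bij that by (auto simp: B_def bij_betw_def intro: inv_into_into f_inv_into_f)
  have BA: "B (A x) = x" if "x \<in> M" for x
    using bij that by (simp add: B_def bij_betw_def inv_into_f_f)
  have Blin: "clinear_on M B"
    unfolding clinear_on_def
  proof (intro conjI ballI allI)
    show "B (x + y) = B x + B y" if "x \<in> M" "y \<in> M" for x y
      using BA[of "B x + B y"] that BM M'(3) by (simp add: clinear_onD(1)[OF M lin] AB)
    show "B (c *\<^sub>C x) = c *\<^sub>C B x" if "x \<in> M" for c x
      using BA[of "c *\<^sub>C B x"] that BM M'(4) by (simp add: clinear_onD(2)[OF M lin] AB)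
  qed
  have Bcomm: "T i (B x) = B (T i x)" if "i \<in> {1..n}" "x \<in> M" for i x
  proof -
    have m: "T i (B x) \<in> M" using that BM bounded_op_onD(1)[OF commuting_tupleD(2)[OF T]] by blast
    have "A (T i (B x)) = T i x" using comm[OF that(1) BM[OF that(2)]] AB[OF that(2)] by simp
    then show ?thesis using BA[OF m] by simp
  qed
  have "x \<in> koszul_map n T ` koszul_space n M"
    if x: "x \<in> koszul_space n M" and closed: "koszul_map n T x = (\<lambda>_. 0)" for x
  proof -
    have Bx: "(\<lambda>J. B (x J)) \<in> koszul_space n M"
      by (rule koszul_map_commute(1)[where B = B, OF T x Blin BM Bcomm])
    have "koszul_map n T (\<lambda>J. B (x J)) J = 0" for J
      using koszul_map_commute(2)[where B = B, OF T x Blin BM Bcomm] closed clinear_onD(3)[OF M Blin] by simp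
    then obtain y where y: "y \<in> koszul_space n M" "\<And>J. koszul_map n T y J = A (B (x J))"
      using kills_cohomologyD[OF A Bx] by blast
    have "A (B (x J)) = x J" for J
      using koszul_spaceD[OF x] AB M'(2) by (cases "J \<subseteq> {1..n}") auto
    then have "koszul_map n T y = x" using y(2) by auto
    then show ?thesis using y(1) by blast
  qed
  then show ?thesis
    unfolding koszul_exact_def using koszul_map_space[OF T] koszul_map_squared[OF T] by auto
qed

text \<open>One half of the spectral mapping theorem for the Taylor spectrum.\<close>

lemma taylor_spectrum_not_bij:
  assumes T: "commuting_tuple n M T" and p: "p \<in> polys n" and z: "z \<in> taylor_spectrum n M T"
  shows "\<not> bij_betw (\<lambda>x. poly_op n p T x - poly_at n p z *\<^sub>C x) M M"
proof
  assume bij: "bij_betw (\<lambda>x. poly_op n p T x - poly_at n p z *\<^sub>C x) M M"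
  note M = commuting_tupleD(1)[OF T]
  note b = poly_op_bounded[OF T]
  let ?A = "\<lambda>x. poly_op n p T x - poly_at n p z *\<^sub>C x"
  have bA: "bounded_op_on M ?A"
    using bounded_op_on_add[OF M b[of p] bounded_op_on_scaleC[OF M, of "- poly_at n p z"]]
    by (simp add: scaleC_minus_left)
  have "koszul_exact n M (\<lambda>i x. T i x - z i *\<^sub>C x)"
  proof (rule koszul_exact_invertible[OF commuting_tuple_shift[OF T] kills_cohomology_poly[OF T p] bounded_op_onD(2)[OF bA] bij])
    fix i x assume i: "i \<in> {1..n}" and x: "x \<in> M"
    have "T i (?A x) = ?A (T i x)"
      using x closed_csubspaceD(4)[OF M] bounded_op_onD(1)[OF b]
      by (simp add: clinear_onD(2,5)[OF M bounded_op_onD(2)[OF commuting_tupleD(2)[OF T i]]]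
          poly_op_commute_var[OF T p i x])
    then show "T i (?A x) - z i *\<^sub>C ?A x = ?A (T i x - z i *\<^sub>C x)"
      using x closed_csubspaceD(4)[OF M] bounded_op_onD(1)[OF commuting_tupleD(2)[OF T i]]
      by (simp add: clinear_onD(2,5)[OF M bounded_op_onD(2)[OF bA]])
  qed
  then show False using z by (simp add: taylor_spectrum_def)
qed

text \<open>The equation \<open>A x - c x = y\<close> says that \<open>x\<close> is a fixed point of a strict contraction.\<close>

lemma bij_betw_diff_scaleC:
  assumes M: "closed_csubspace M" and A: "bounded_op_on M A"
    and a: "\<And>x. x \<in> M \<Longrightarrow> norm (A x) \<le> a * norm x" "0 \<le> a" "a < cmod c"
  shows "bij_betw (\<lambda>x. A x - c *\<^sub>C x) M M"
proof (rule bij_betwI')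
  note M' = closed_csubspaceD[OF M]
  note lin = clinear_onD[OF M bounded_op_onD(2)[OF A]]
  fix x y
  {
    assume x: "x \<in> M" and y: "y \<in> M"
    show "A x - c *\<^sub>C x = A y - c *\<^sub>C y \<longleftrightarrow> x = y"
    proof
      assume "A x - c *\<^sub>C x = A y - c *\<^sub>C y"
      then have "A (x - y) = c *\<^sub>C (x - y)"
        using x y by (simp add: lin(5) scaleC_diff_right algebra_simps)
      then have "cmod c * norm (x - y) \<le> a * norm (x - y)"
        using a(1)[OF M'(6)[OF x y]] by (simp add: norm_scaleC)
      then show "x = y" using a(3) by (simp add: mult_le_cancel_right)
    qed simp
  }
  assume x: "x \<in> M"
  show "A x - c *\<^sub>C x \<in> M" using x bounded_op_onD(1)[OF A] M'(4,6) by blast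
next
  note M' = closed_csubspaceD[OF M]
  note lin = clinear_onD[OF M bounded_op_onD(2)[OF A]]
  fix y assume y: "y \<in> M"
  define g where "g x = (1/c) *\<^sub>C (A x - y)" for x
  have "\<exists>!x. x \<in> M \<and> g x = x"
  proof (rule Banach_fix[of M "a / cmod c"])
    show "complete M" using M'(1) by (simp add: complete_eq_closed)
    show "M \<noteq> {}" using y by blast
    show "0 \<le> a / cmod c" "a / cmod c < 1" using a(2,3) by (auto simp: divide_less_eq)
    show "g ` M \<subseteq> M" using y M'(4,6) bounded_op_onD(1)[OF A] by (auto simp: g_def)
    fix x z assume "x \<in> M" "z \<in> M"
    then have "g x - g z = (1/c) *\<^sub>C A (x - z)"
      by (simp add: g_def lin(5) flip: scaleC_diff_right)
    then have "norm (g x - g z) = norm (A (x - z)) / cmod c" by (simp add: norm_scaleC norm_divide)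
    also have "\<dots> \<le> a * norm (x - z) / cmod c"
      using a(1)[OF M'(6)[OF \<open>x \<in> M\<close> \<open>z \<in> M\<close>]] by (rule divide_right_mono) simp
    finally show "dist (g x) (g z) \<le> a / cmod c * dist x z" by (simp add: dist_norm)
  qed
  then obtain x where x: "x \<in> M" "g x = x" by blast
  have c: "c \<noteq> 0" using a by auto
  have "A x - y = c *\<^sub>C g x" using c by (simp add: g_def scaleC_scaleC)
  then have "y = A x - c *\<^sub>C x" using x(2) by (simp add: algebra_simps)
  then show "\<exists>x\<in>M. y = A x - c *\<^sub>C x" using x(1) by blast
qed

text \<open>A value of \<open>p\<close> larger than the norm of \<open>p(T)\<close> would make \<open>p(T) - p(z)\<close> invertible.\<close>

lemma taylor_spectrum_poly_bound:
  assumes T: "commuting_tuple n M T" and p: "p \<in> polys n" and z: "z \<in> taylor_spectrum n M T"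
    and a: "\<And>x. x \<in> M \<Longrightarrow> norm (poly_op n p T x) \<le> a * norm x" "0 \<le> a"
  shows "cmod (poly_at n p z) \<le> a"
  using bij_betw_diff_scaleC[OF commuting_tupleD(1)[OF T] poly_op_bounded[OF T] a]
    taylor_spectrum_not_bij[OF T p z] by (meson not_le)

section \<open>The symmetrized polydisc\<close>

definition elem_sym :: "nat \<Rightarrow> (nat \<Rightarrow> complex) \<Rightarrow> nat \<Rightarrow> complex" where
  "elem_sym n z k = (\<Sum>I | I \<subseteq> {1..n} \<and> card I = k. \<Prod>i\<in>I. z i)"

lemma symmetrization_eq: "symmetrization n z k = (if k \<in> {1..n} then elem_sym n z k else 0)"
  by (simp add: symmetrization_def elem_sym_def)

lemma symmetrization_cspace: "symmetrization n z \<in> cspace n"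
  by (auto simp: cspace_def symmetrization_def)

lemma GammaE:
  assumes "s \<in> Gamma n"
  obtains z where "s = symmetrization n z" "\<And>i. i \<in> {1..n} \<Longrightarrow> cmod (z i) \<le> 1" "z \<in> cspace n"
  using assms unfolding Gamma_def by blast

lemma elem_sym_0: "elem_sym n z 0 = 1"
proof -
  have "{I. I \<subseteq> {1..n} \<and> card I = 0} = {{}}"
    by (auto simp: card_eq_0_iff dest: finite_subset)
  then show ?thesis by (simp only: elem_sym_def) simp
qed

lemma elem_sym_top: "elem_sym n z n = (\<Prod>i=1..n. z i)"
proof -
  have "{I. I \<subseteq> {1..n} \<and> card I = n} = {{1..n}}"
    using card_subset_eq[of "{1..n}"] by auto
  then show ?thesis by (simp only: elem_sym_def) simp
qed

lemma prod_diff_by_card: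
  fixes f :: "nat \<Rightarrow> 'c::comm_ring_1"
  shows "(\<Prod>i=1..n. a - f i) =
    (\<Sum>k\<le>n. (- 1) ^ k * (\<Sum>I | I \<subseteq> {1..n} \<and> card I = k. \<Prod>i\<in>I. f i) * a ^ (n - k))"
proof -
  have card: "card I \<le> n" if "I \<subseteq> {1..n}" for I
    using card_mono[OF _ that] by simp
  have "(\<Prod>i=1..n. a - f i)
      = (\<Sum>I\<in>Pow {1..n}. (- 1) ^ card I * (\<Prod>i\<in>I. f i) * (\<Prod>i\<in>{1..n}-I. a))"
    by (rule prod_diff_conv_sum) simp
  also have "\<dots> = (\<Sum>k\<le>n. \<Sum>I\<in>{I \<in> Pow {1..n}. card I = k}.
      (- 1) ^ card I * (\<Prod>i\<in>I. f i) * (\<Prod>i\<in>{1..n}-I. a))"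
    by (rule sum.group[symmetric]) (use card in auto)
  also have "\<dots> = (\<Sum>k\<le>n. (- 1) ^ k * (\<Sum>I | I \<subseteq> {1..n} \<and> card I = k. \<Prod>i\<in>I. f i) * a ^ (n - k))"
  proof (rule sum.cong[OF refl])
    fix k
    have "(\<Sum>I\<in>{I \<in> Pow {1..n}. card I = k}. (- 1) ^ card I * (\<Prod>i\<in>I. f i) * (\<Prod>i\<in>{1..n}-I. a))
        = (\<Sum>I | I \<subseteq> {1..n} \<and> card I = k. (- 1) ^ k * (\<Prod>i\<in>I. f i) * a ^ (n - k))"
      by (intro sum.cong) (auto simp: card_Diff_subset finite_subset)
    also have "\<dots> = (- 1) ^ k * (\<Sum>I | I \<subseteq> {1..n} \<and> card I = k. \<Prod>i\<in>I. f i) * a ^ (n - k)"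
      by (simp add: sum_distrib_left sum_distrib_right)
    finally show "(\<Sum>I\<in>{I \<in> Pow {1..n}. card I = k}. (- 1) ^ card I * (\<Prod>i\<in>I. f i) * (\<Prod>i\<in>{1..n}-I. a))
      = (- 1) ^ k * (\<Sum>I | I \<subseteq> {1..n} \<and> card I = k. \<Prod>i\<in>I. f i) * a ^ (n - k)" .
  qed
  finally show ?thesis .
qed

text \<open>Every point is the symmetrization of the roots of a monic polynomial.\<close>

lemma symmetrization_surj:
  assumes "s \<in> cspace n"
  obtains z where "z \<in> cspace n" "symmetrization n z = s"
proof -
  \<comment> \<open>the elementary symmetric function of degree 0 is 1, but points vanish at the index 0\<close>
  define b where "b k = (if k = 0 then 1 else s k)" for k
  define p where "p = (\<Sum>k\<le>n. monom ((- 1) ^ k * b k) (n - k))"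
  have coeff: "poly.coeff p (n - k) = (- 1) ^ k * b k" if "k \<le> n" for k
  proof -
    have "poly.coeff p (n - k) = (\<Sum>j\<le>n. if j = k then (- 1) ^ k * b k else 0)"
      unfolding p_def coeff_sum using that by (intro sum.cong) auto
    then show ?thesis using that by simp
  qed
  have deg: "degree p \<le> n"
    unfolding p_def by (intro degree_sum_le) (auto intro: order_trans[OF degree_monom_le])
  have lead: "poly.coeff p n = 1" using coeff[of 0] by (simp add: b_def)
  then have degp: "degree p = n" using deg by (metis le_antisym le_degree one_neq_zero)
  obtain root where root: "smult (lead_coeff p) (\<Prod>i<degree p. [:- root i, 1:]) = p"
    by (rule complex_poly_decompose'[of p])
  define z where "z i = (if i \<in> {1..n} then root (i - 1) else 0)" for i
  have "p = (\<Prod>i<n. [:- root i, 1:])" using root lead by (simp add: degp)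
  also have "\<dots> = (\<Prod>i=1..n. [:- z i, 1:])"
    by (rule prod.reindex_bij_witness[of _ "\<lambda>i. i - 1" Suc]) (auto simp: z_def)
  also have "\<dots> = (\<Prod>i=1..n. [:0, 1:] - [:z i:])" by simp
  also have "\<dots> = (\<Sum>k\<le>n. (- 1) ^ k * (\<Sum>I | I \<subseteq> {1..n} \<and> card I = k. \<Prod>i\<in>I. [:z i:]) * [:0, 1:] ^ (n - k))"
    by (rule prod_diff_by_card)
  also have "\<dots> = (\<Sum>k\<le>n. monom ((- 1) ^ k * elem_sym n z k) (n - k))"
  proof (rule sum.cong[OF refl])
    fix k
    have "(\<Prod>i\<in>I. [:z i:]) = [:\<Prod>i\<in>I. z i:]" for I
      by (induct I rule: infinite_finite_induct) (auto simp: one_pCons)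
    moreover have "(\<Sum>I\<in>X. [:g I:]) = [:\<Sum>I\<in>X. g I:]" for X and g :: "nat set \<Rightarrow> complex"
      by (induct X rule: infinite_finite_induct) auto
    moreover have "(- 1) ^ k = [:(- 1) ^ k :: complex:]" by (induct k) (auto simp: one_pCons)
    ultimately show "(- 1) ^ k * (\<Sum>I | I \<subseteq> {1..n} \<and> card I = k. \<Prod>i\<in>I. [:z i:]) * [:0, 1:] ^ (n - k)
        = monom ((- 1) ^ k * elem_sym n z k) (n - k)"
      by (simp add: elem_sym_def monom_altdef mult.commute)
  qed
  finally have p2: "p = (\<Sum>k\<le>n. monom ((- 1) ^ k * elem_sym n z k) (n - k))" .
  have "elem_sym n z k = b k" if "k \<le> n" for k
  proof -
    have "poly.coeff p (n - k) = (\<Sum>j\<le>n. if j = k then (- 1) ^ k * elem_sym n z k else 0)"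
      unfolding p2 coeff_sum using that by (intro sum.cong) auto
    then have "(- 1) ^ k * elem_sym n z k = (- 1) ^ k * b k" using that coeff by simp
    then show ?thesis by simp
  qed
  then have "symmetrization n z = s"
    using assms by (auto simp: symmetrization_eq b_def cspace_def)
  moreover have "z \<in> cspace n" by (simp add: cspace_def z_def)
  ultimately show ?thesis using that by blast
qed

subsection \<open>Complete homogeneous polynomials and polynomial convexity\<close>

text \<open>At \<open>s = symmetrization n z\<close> this is the polynomial \<open>\<Prod>i. (1 - z\<^sub>i t)\<close>. The coefficients of its
  reciprocal are the complete homogeneous symmetric functions of \<open>z\<close>.\<close>

definition sym_fps :: "nat \<Rightarrow> (nat \<Rightarrow> complex) \<Rightarrow> complex fps" where
  "sym_fps n s = Abs_fps (\<lambda>k. if k = 0 then 1 else if k \<le> n then (- 1) ^ k * s k else 0)"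

lemma sym_fps_symmetrization:
  "sym_fps n (symmetrization n z) = (\<Prod>i=1..n. 1 - fps_const (z i) * fps_X)"
proof -
  have "(\<Prod>i=1..n. 1 - fps_const (z i) * fps_X) =
    (\<Sum>k\<le>n. (- 1) ^ k * (\<Sum>I | I \<subseteq> {1..n} \<and> card I = k. \<Prod>i\<in>I. fps_const (z i) * fps_X) * 1 ^ (n - k))"
    by (rule prod_diff_by_card)
  also have "\<dots> = (\<Sum>k\<le>n. fps_const ((- 1) ^ k * elem_sym n z k) * fps_X ^ k)"
  proof (rule sum.cong[OF refl])
    fix k
    have "(\<Prod>i\<in>I. fps_const (z i) * fps_X) = fps_const (\<Prod>i\<in>I. z i) * fps_X ^ card I" for I
      by (induct I rule: infinite_finite_induct) (auto simp: mult_ac simp flip: fps_const_mult)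
    then have "(\<Sum>I | I \<subseteq> {1..n} \<and> card I = k. \<Prod>i\<in>I. fps_const (z i) * fps_X)
        = (\<Sum>I | I \<subseteq> {1..n} \<and> card I = k. fps_const (\<Prod>i\<in>I. z i) * fps_X ^ k)"
      by (intro sum.cong) auto
    also have "\<dots> = fps_const (elem_sym n z k) * fps_X ^ k"
    proof -
      have "(\<Sum>I\<in>X. fps_const (g I)) = fps_const (\<Sum>I\<in>X. g I)" for X and g :: "nat set \<Rightarrow> complex"
        by (induct X rule: infinite_finite_induct) auto
      then show ?thesis by (simp add: elem_sym_def flip: sum_distrib_right)
    qed
    finally have *: "(\<Sum>I | I \<subseteq> {1..n} \<and> card I = k. \<Prod>i\<in>I. fps_const (z i) * fps_X)
        = fps_const (elem_sym n z k) * fps_X ^ k" .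
    have "(- 1) ^ k = fps_const ((- 1 :: complex) ^ k)" by (induct k) (simp_all flip: fps_const_neg fps_const_mult)
    then show "(- 1) ^ k * (\<Sum>I | I \<subseteq> {1..n} \<and> card I = k. \<Prod>i\<in>I. fps_const (z i) * fps_X) * 1 ^ (n - k)
      = fps_const ((- 1) ^ k * elem_sym n z k) * fps_X ^ k"
      unfolding * by (simp add: mult.assoc flip: fps_const_mult)
  qed
  also have "\<dots> = sym_fps n (symmetrization n z)"
  proof (rule fps_ext)
    fix m
    have "(\<Sum>k\<le>n. fps_const ((- 1) ^ k * elem_sym n z k) * fps_X ^ k) $ m
        = (\<Sum>k\<le>n. if k = m then (- 1) ^ m * elem_sym n z m else 0)"
      unfolding fps_sum_nth by (intro sum.cong refl) (auto simp: fps_X_power_nth)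
    also have "\<dots> = sym_fps n (symmetrization n z) $ m"
      by (auto simp: sym_fps_def symmetrization_eq elem_sym_0)
    finally show "(\<Sum>k\<le>n. fps_const ((- 1) ^ k * elem_sym n z k) * fps_X ^ k) $ m
        = sym_fps n (symmetrization n z) $ m" .
  qed
  finally show ?thesis by simp
qed

lemma sym_fps_inverse: "sym_fps n s * inverse (sym_fps n s) = 1"
  by (rule inverse_mult_eq_1') (simp add: sym_fps_def)

text \<open>Comparing coefficients in \<open>sym_fps n s * inverse (sym_fps n s) = 1\<close> gives a recursion for those of
  the reciprocal.\<close>

lemma complete_homogeneous_poly:
  "\<exists>p\<in>polys n. \<forall>s. poly_at n p s = inverse (sym_fps n s) $ k"
proof (induct k rule: less_induct)
  case (less k)
  show ?case
  proof (cases "k = 0")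
    case True
    then show ?thesis by (intro bexI[of _ 1]) (auto simp: sym_fps_def)
  next
    case False
    have "\<forall>j. \<exists>p. j < k \<longrightarrow> p \<in> polys n \<and> (\<forall>s. poly_at n p s = inverse (sym_fps n s) $ j)"
      using less by blast
    then obtain h where h: "\<And>j. j < k \<Longrightarrow> h j \<in> polys n"
      "\<And>j s. j < k \<Longrightarrow> poly_at n (h j) s = inverse (sym_fps n s) $ j" by metis
    define p where "p = poly_const (- 1) *
      (\<Sum>i\<in>{1..k} \<inter> {1..n}. poly_const ((- 1) ^ i) * poly_var i * h (k - i))"
    have "p \<in> polys n"
      unfolding p_def by (intro polys_mult polys_const polys_sum polys_var h) auto
    moreover have "poly_at n p s = inverse (sym_fps n s) $ k" for s
    proof -
      let ?H = "inverse (sym_fps n s)"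
      have "0 = (sym_fps n s * ?H) $ k" using False by (simp add: sym_fps_inverse)
      also have "\<dots> = ?H $ k + (\<Sum>i=1..k. sym_fps n s $ i * ?H $ (k - i))"
        by (simp add: fps_mult_nth sum.atLeast_Suc_atMost sym_fps_def)
      also have "(\<Sum>i=1..k. sym_fps n s $ i * ?H $ (k - i))
          = (\<Sum>i\<in>{1..k} \<inter> {1..n}. (- 1) ^ i * s i * ?H $ (k - i))"
        by (intro sum.mono_neutral_cong_right) (auto simp: sym_fps_def)
      also have "\<dots> = - poly_at n p s"
        unfolding p_def poly_at_mult poly_at_sum by (auto simp: h(2) intro!: sum.cong)
      finally show ?thesis by simp
    qed
    ultimately show ?thesis by blast
  qed
qed

lemma geometric_fps: "(1 - fps_const c * fps_X) * Abs_fps (\<lambda>k. c ^ k) = (1 :: complex fps)"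
proof (rule fps_ext)
  fix m show "((1 - fps_const c * fps_X) * Abs_fps (\<lambda>k. c ^ k)) $ m = (1 :: complex fps) $ m"
    by (cases m) (simp_all add: left_diff_distrib mult.assoc)
qed

text \<open>The reciprocal is a product of \<open>n\<close> geometric series with coefficients in the unit disc, and the
  \<open>k\<close>-th coefficient of a product with one of them is a sum of \<open>k + 1\<close> terms.\<close>

lemma complete_homogeneous_bound:
  assumes "s \<in> Gamma n"
  shows "cmod (inverse (sym_fps n s) $ k) \<le> real (k + 1) ^ n"
proof -
  obtain z where z: "s = symmetrization n z" "\<And>i. i \<in> {1..n} \<Longrightarrow> cmod (z i) \<le> 1"
    using assms by (rule GammaE) blast
  define G where "G A = (\<Prod>i\<in>A. Abs_fps (\<lambda>k. z i ^ k))" for A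
  have "finite A \<Longrightarrow> A \<subseteq> {1..n} \<Longrightarrow> cmod (G A $ k) \<le> real (k + 1) ^ card A" for A k
  proof (induct A arbitrary: k rule: finite_induct)
    case empty
    then show ?case by (simp add: G_def)
  next
    case (insert i A)
    have "cmod (G (insert i A) $ k) = cmod (\<Sum>j=0..k. z i ^ j * G A $ (k - j))"
      using insert by (simp add: G_def fps_mult_nth)
    also have "\<dots> \<le> (\<Sum>j=0..k. cmod (z i ^ j * G A $ (k - j)))" by (rule norm_sum)
    also have "\<dots> \<le> (\<Sum>j=0..k. real (k + 1) ^ card A)"
    proof (rule sum_mono)
      fix j assume "j \<in> {0..k}"
      have "cmod (z i ^ j * G A $ (k - j)) \<le> 1 * real (k - j + 1) ^ card A"
        unfolding norm_mult norm_power
        using insert z(2)[of i] by (intro mult_mono power_le_one) auto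
      also have "\<dots> \<le> real (k + 1) ^ card A" by (simp add: power_mono)
      finally show "cmod (z i ^ j * G A $ (k - j)) \<le> real (k + 1) ^ card A" .
    qed
    also have "\<dots> = real (k + 1) ^ card (insert i A)" using insert by simp
    finally show ?case .
  qed
  from this[of "{1..n}" k] have "cmod (G {1..n} $ k) \<le> real (k + 1) ^ n" by simp
  moreover have "inverse (sym_fps n s) = G {1..n}"
  proof (rule fps_inverse_unique)
    show "sym_fps n s * G {1..n} = 1"
      unfolding z(1) sym_fps_symmetrization G_def
      by (simp add: geometric_fps flip: prod.distrib)
  qed
  ultimately show ?thesis by simp
qed

text \<open>Multiplying the reciprocal by all factors \<open>1 - z\<^sub>i t\<close> except the \<open>j\<close>-th leaves the geometric series
  of \<open>z\<^sub>j\<close>. So its coefficients grow at most polynomially too, which excludes \<open>\<bar>z\<^sub>j\<bar> > 1\<close>.\<close>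

lemma Gamma_of_complete_homogeneous_bound:
  assumes s: "s \<in> cspace n" and bound: "\<And>k. cmod (inverse (sym_fps n s) $ k) \<le> real (k + 1) ^ n"
  shows "s \<in> Gamma n"
proof -
  obtain z where z: "z \<in> cspace n" "symmetrization n z = s"
    using symmetrization_surj[OF s] by blast
  have "cmod (z j) \<le> 1" if j: "j \<in> {1..n}" for j
  proof (rule ccontr)
    assume "\<not> cmod (z j) \<le> 1"
    then have big: "cmod (z j) > 1" by simp
    define Q where "Q = (\<Prod>i\<in>{1..n}-{j}. 1 - fps_const (z i) * fps_X)"
    define C where "C = (\<Sum>i\<le>n. cmod (Q $ i))"
    have split: "sym_fps n s = (1 - fps_const (z j) * fps_X) * Q"
      unfolding Q_def z(2)[symmetric] sym_fps_symmetrization using j by (intro prod.remove) auto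
    have G: "Abs_fps (\<lambda>k. z j ^ k) = Q * inverse (sym_fps n s)"
    proof -
      have "Abs_fps (\<lambda>k. z j ^ k) = Abs_fps (\<lambda>k. z j ^ k) * (sym_fps n s * inverse (sym_fps n s))"
        by (simp add: sym_fps_inverse)
      also have "\<dots> = ((1 - fps_const (z j) * fps_X) * Abs_fps (\<lambda>k. z j ^ k)) * (Q * inverse (sym_fps n s))"
        unfolding split by (simp only: mult_ac)
      finally show ?thesis by (simp add: geometric_fps)
    qed
    have Q0: "Q $ i = 0" if "i > n" for i
    proof -
      have "finite A \<Longrightarrow> card A < i \<Longrightarrow> (\<Prod>i\<in>A. 1 - fps_const (z i) * fps_X) $ i = 0" for A i
      proof (induct A arbitrary: i rule: finite_induct)
        case (insert a A)
        then show ?case by (cases i) (auto simp: left_diff_distrib mult.assoc)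
      qed auto
      moreover have "card ({1..n}-{j}) < i" using that j by (simp add: card_Diff_singleton)
      ultimately show ?thesis unfolding Q_def by simp
    qed
    have "cmod (z j) ^ k \<le> C * real (k + 1) ^ n" for k
    proof -
      have "cmod (z j) ^ k = cmod ((Q * inverse (sym_fps n s)) $ k)"
        by (simp add: norm_power flip: G)
      also have "\<dots> \<le> (\<Sum>i=0..k. cmod (Q $ i * inverse (sym_fps n s) $ (k - i)))"
        unfolding fps_mult_nth by (rule norm_sum)
      also have "\<dots> \<le> (\<Sum>i=0..k. cmod (Q $ i) * real (k + 1) ^ n)"
      proof (rule sum_mono)
        fix i assume "i \<in> {0..k}"
        have "cmod (inverse (sym_fps n s) $ (k - i)) \<le> real (k + 1) ^ n"
          by (rule order_trans[OF bound]) (simp add: power_mono)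
        then show "cmod (Q $ i * inverse (sym_fps n s) $ (k - i)) \<le> cmod (Q $ i) * real (k + 1) ^ n"
          by (simp add: norm_mult mult_left_mono)
      qed
      also have "\<dots> \<le> (\<Sum>i\<in>{0..k} \<union> {..n}. cmod (Q $ i) * real (k + 1) ^ n)"
        by (rule sum_mono2) auto
      also have "\<dots> = (\<Sum>i\<le>n. cmod (Q $ i) * real (k + 1) ^ n)"
        using Q0 by (intro sum.mono_neutral_right) auto
      finally show ?thesis by (simp add: C_def sum_distrib_right)
    qed
    moreover define a where "a = cmod (z j)"
    ultimately have le: "1 \<le> C * real (k + 1) ^ n / a ^ k" for k
    proof -
      have "0 < a ^ k" using big unfolding a_def by (intro zero_less_power) linarith
      then show ?thesis using \<open>\<And>k. cmod (z j) ^ k \<le> C * real (k + 1) ^ n\<close>[of k]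
        by (simp add: pos_le_divide_eq a_def)
    qed
    have "(\<lambda>k. C * real (k + 1) ^ n / a ^ k) \<longlonglongrightarrow> 0"
      using big unfolding a_def[symmetric] by real_asymp
    then have "1 \<le> (0::real)"
      using le by (intro LIMSEQ_le_const) auto
    then show False by simp
  qed
  then show ?thesis unfolding Gamma_def using z by (intro image_eqI[of _ _ z]) auto
qed

text \<open>Polynomial convexity of \<open>\<Gamma>\<^sub>n\<close>. The separating polynomials are the complete homogeneous
  symmetric polynomials: their values at the symmetrization of \<open>z\<close> are the Taylor coefficients of
  \<open>\<Prod>i. 1 / (1 - z\<^sub>i t)\<close>, which grow at most polynomially exactly when all \<open>\<bar>z\<^sub>i\<bar> \<le> 1\<close>.\<close>

lemma Gamma_polynomially_convex:
  assumes "s \<in> cspace n"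
    and hull: "\<And>p B. p \<in> polys n \<Longrightarrow> (\<And>w. w \<in> Gamma n \<Longrightarrow> cmod (poly_at n p w) \<le> B) \<Longrightarrow> 
      cmod (poly_at n p s) \<le> B"
  shows "s \<in> Gamma n"
proof (rule Gamma_of_complete_homogeneous_bound[OF assms(1)])
  fix k
  obtain p where p: "p \<in> polys n" "\<And>s. poly_at n p s = inverse (sym_fps n s) $ k"
    using complete_homogeneous_poly by blast
  show "cmod (inverse (sym_fps n s) $ k) \<le> real (k + 1) ^ n"
    using hull[OF p(1)] complete_homogeneous_bound unfolding p(2) by blast
qed

subsection \<open>Symmetries and the distinguished boundary\<close>

lemma Gamma_zero: "(\<lambda>_. 0) \<in> Gamma n"
proof -
  have "symmetrization n (\<lambda>_. 0) = (\<lambda>_. 0)"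
  proof
    fix k
    show "symmetrization n (\<lambda>_. 0) k = 0"
      unfolding symmetrization_def by (auto intro!: sum.neutral simp: card_gt_0_iff dest: finite_subset)
  qed
  then show ?thesis unfolding Gamma_def by (intro image_eqI[of _ _ "\<lambda>_. 0"]) (auto simp: cspace_def)
qed

lemma Gamma_cspace: "s \<in> Gamma n \<Longrightarrow> s \<in> cspace n"
  by (auto simp: Gamma_def symmetrization_cspace)

lemma Gamma_cnj: "s \<in> Gamma n \<Longrightarrow> (\<lambda>i. cnj (s i)) \<in> Gamma n"
proof -
  assume "s \<in> Gamma n"
  then obtain z where z: "s = symmetrization n z" "\<And>i. i \<in> {1..n} \<Longrightarrow> cmod (z i) \<le> 1" "z \<in> cspace n"
    by (rule GammaE) blast
  have "(\<lambda>i. cnj (s i)) = symmetrization n (\<lambda>i. cnj (z i))"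
    by (rule ext) (simp add: z(1) symmetrization_def)
  then show ?thesis unfolding Gamma_def
    using z by (intro image_eqI[of _ _ "\<lambda>i. cnj (z i)"]) (auto simp: cspace_def)
qed

lemma Gamma_dilation:
  assumes "s \<in> Gamma n" "0 \<le> r" "r \<le> 1"
  shows "(\<lambda>i. complex_of_real r ^ i * s i) \<in> Gamma n"
proof -
  obtain z where z: "s = symmetrization n z" "\<And>i. i \<in> {1..n} \<Longrightarrow> cmod (z i) \<le> 1" "z \<in> cspace n"
    using assms(1) by (rule GammaE) blast
  have "(\<lambda>i. complex_of_real r ^ i * s i) = symmetrization n (\<lambda>i. complex_of_real r * z i)"
    by (rule ext) (auto simp: z(1) symmetrization_def sum_distrib_left prod.distrib intro!: sum.cong)
  moreover have "cmod (complex_of_real r * z i) \<le> 1" if "i \<in> {1..n}" for i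
    using mult_mono[of r 1 "cmod (z i)" 1] z(2)[OF that] assms(2,3) by (simp add: norm_mult)
  ultimately show ?thesis unfolding Gamma_def
    using z(3) by (intro image_eqI[of _ _ "\<lambda>i. complex_of_real r * z i"]) (auto simp: cspace_def)
qed

lemma Gamma_last_le: "s \<in> Gamma n \<Longrightarrow> cmod (s n) \<le> 1"
proof -
  assume "s \<in> Gamma n"
  then obtain z where z: "s = symmetrization n z" "\<And>i. i \<in> {1..n} \<Longrightarrow> cmod (z i) \<le> 1"
    by (rule GammaE) blast
  have "cmod (\<Prod>i=1..n. z i) \<le> 1"
    unfolding prod_norm[symmetric] using z(2) by (intro prod_le_1) auto
  then show ?thesis by (auto simp: z(1) symmetrization_eq elem_sym_top)
qed

text \<open>If the product of numbers in the closed disc is unimodular, all of them are, and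
  then \<open>\<Prod>z / \<Prod>\<^bsub>I\<^esub>z = \<Prod>z \<cdot> cnj (\<Prod>\<^bsub>I\<^esub>z)\<close> for every set of indices.\<close>

lemma Gamma_unimodular_last:
  assumes s: "s \<in> Gamma n" and last: "cmod (s n) = 1" and i: "i \<in> {1..n-1}"
  shows "s (n - i) = cnj (s i) * s n"
proof -
  obtain z where z: "s = symmetrization n z" "\<And>i. i \<in> {1..n} \<Longrightarrow> cmod (z i) \<le> 1"
    using s by (rule GammaE) blast
  have n: "n \<ge> 1" using i by auto
  have sn: "s n = (\<Prod>i=1..n. z i)" using n by (simp add: z(1) symmetrization_eq elem_sym_top)
  have uni: "cmod (z j) = 1" if j: "j \<in> {1..n}" for j
  proof -
    have "1 = cmod (z j) * (\<Prod>i\<in>{1..n}-{j}. cmod (z i))"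
      using last prod.remove[of "{1..n}" j "\<lambda>i. cmod (z i)"] j by (simp add: sn flip: prod_norm)
    also have "\<dots> \<le> cmod (z j) * 1"
      using z(2) by (intro mult_left_mono prod_le_1) auto
    finally show ?thesis using z(2)[OF j] by simp
  qed
  have "elem_sym n z (n - i) = (\<Sum>I | I \<subseteq> {1..n} \<and> card I = i. \<Prod>j\<in>{1..n}-I. z j)"
    unfolding elem_sym_def
    by (rule sum.reindex_bij_witness[of _ "\<lambda>I. {1..n} - I" "\<lambda>I. {1..n} - I"])
      (use i in \<open>auto simp: card_Diff_subset finite_subset double_diff\<close>)
  also have "\<dots> = (\<Sum>I | I \<subseteq> {1..n} \<and> card I = i. cnj (\<Prod>j\<in>I. z j) * s n)"
  proof (rule sum.cong[OF refl])
    fix I assume "I \<in> {I. I \<subseteq> {1..n} \<and> card I = i}"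
    then have I: "I \<subseteq> {1..n}" by simp
    have "cnj (\<Prod>j\<in>I. z j) * (\<Prod>j\<in>I. z j) = (\<Prod>j\<in>I. cnj (z j) * z j)" by (simp add: prod.distrib)
    also have "\<dots> = 1"
    proof (rule prod.neutral, rule ballI)
      fix j assume "j \<in> I"
      then have "cmod (z j) = 1" using I uni by blast
      then show "cnj (z j) * z j = 1"
        by (metis complex_norm_square mult.commute of_real_1 power_one)
    qed
    finally have "cnj (\<Prod>j\<in>I. z j) * (\<Prod>j\<in>I. z j) = 1" .
    moreover have "s n = (\<Prod>j\<in>{1..n}-I. z j) * (\<Prod>j\<in>I. z j)"
      unfolding sn by (rule prod.subset_diff[OF I]) simp
    ultimately show "(\<Prod>j\<in>{1..n}-I. z j) = cnj (\<Prod>j\<in>I. z j) * s n"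
      by (simp add: mult.left_commute)
  qed
  also have "\<dots> = cnj (elem_sym n z i) * s n"
    by (simp add: elem_sym_def sum_distrib_right)
  finally show ?thesis using i by (auto simp: z(1) symmetrization_eq)
qed

text \<open>The point is the symmetrization of the roots of \<open>t\<^sup>n + (-1)\<^sup>n c\<close>, which are unimodular.\<close>

lemma bGamma_axis:
  assumes "n \<ge> 1" "cmod c = 1"
  shows "(\<lambda>i. if i = n then c else 0) \<in> bGamma n"
proof -
  let ?s = "\<lambda>i. if i = n then c else 0"
  have "?s \<in> cspace n" using assms(1) by (auto simp: cspace_def)
  then obtain z where z: "z \<in> cspace n" "symmetrization n z = ?s"
    using symmetrization_surj by blast
  have e: "elem_sym n z k = (if k = n then c else 0)" if "k \<in> {1..n}" for k
    using z(2) that by (metis symmetrization_eq)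
  have "cmod (z j) = 1" if j: "j \<in> {1..n}" for j
  proof -
    have "0 = (\<Prod>i=1..n. z j - z i)" using j by (auto intro!: prod_zero[symmetric])
    also have "\<dots> = (\<Sum>k\<le>n. (- 1) ^ k * elem_sym n z k * z j ^ (n - k))"
      unfolding elem_sym_def by (rule prod_diff_by_card)
    also have "\<dots> = (\<Sum>k\<in>{0,n}. (- 1) ^ k * elem_sym n z k * z j ^ (n - k))"
      using e by (intro sum.mono_neutral_right) auto
    also have "\<dots> = z j ^ n + (- 1) ^ n * c" using assms(1) e[of n] by (simp add: elem_sym_0)
    finally have "z j ^ n = - ((- 1) ^ n * c)" by (simp add: eq_neg_iff_add_eq_0)
    then have "cmod (z j) ^ n = 1" using assms(2) by (metis mult_1 norm_minus_cancel norm_mult norm_one norm_power power_one)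
    then show ?thesis using assms(1) using power_eq_imp_eq_base[of "cmod (z j)" n 1] by simp
  qed
  then show ?thesis unfolding bGamma_def using z by (intro image_eqI[of _ _ z]) auto
qed

section \<open>Polynomial characterization of \<open>\<Gamma>\<^sub>n\<close>-contractions\<close>

lemma continuous_on_poly_at: "continuous_on A (poly_at n p)"
proof -
  have "continuous_on A (\<lambda>z::nat \<Rightarrow> complex. z i)" for i
    by (rule continuous_on_subset[OF continuous_on_product_coordinates]) simp
  then show ?thesis unfolding poly_at_def[abs_def] by (intro continuous_intros)
qed

lemma poly_at_bounded_on_Gamma:
  assumes "compact (Gamma n)"
  obtains B where "B > 0" "\<And>w. w \<in> Gamma n \<Longrightarrow> cmod (poly_at n p w) \<le> B"
proof -
  have "bounded (poly_at n p ` Gamma n)"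
    by (intro compact_imp_bounded compact_continuous_image continuous_on_poly_at assms)
  then show ?thesis using that unfolding bounded_pos by blast
qed

text \<open>The reciprocal of \<open>q\<close> is a uniform limit of polynomials on \<open>\<Gamma>\<^sub>n\<close>; this is measured by the error
  in \<open>q r \<approx> 1\<close>, which is what acts on operators.\<close>

definition approx_invertible :: "nat \<Rightarrow> ((nat \<Rightarrow>\<^sub>0 nat) \<Rightarrow>\<^sub>0 complex) \<Rightarrow> bool" where
  "approx_invertible n q \<longleftrightarrow>
     (\<forall>e>0. \<exists>r\<in>polys n. \<forall>w\<in>Gamma n. cmod (1 - poly_at n q w * poly_at n r w) \<le> e)"

text \<open>With \<open>r\<close> an approximate reciprocal of \<open>q\<close> and \<open>u = 1 - q' r\<close>, the
  Neumann partial sums \<open>r (1 + u + \<dots> + u\<^sup>N\<^sup>-\<^sup>1)\<close> approximate the reciprocal of \<open>q'\<close>.\<close>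

lemma approx_invertible_perturb:
  assumes q: "approx_invertible n q" and q': "q' \<in> polys n" and d: "d > 0"
    and lower: "\<And>w. w \<in> Gamma n \<Longrightarrow> d \<le> cmod (poly_at n q w)"
    and close: "\<And>w. w \<in> Gamma n \<Longrightarrow> cmod (poly_at n q w - poly_at n q' w) \<le> d / 2"
  shows "approx_invertible n q'"
  unfolding approx_invertible_def
proof (intro allI impI)
  fix e :: real assume e: "e > 0"
  \<comment> \<open>an error of 1/4 leaves \<open>\<bar>u\<bar> \<le> 1/4 + 1/2 \<cdot> 5/4 < 1\<close>\<close>
  obtain r where r: "r \<in> polys n" "\<And>w. w \<in> Gamma n \<Longrightarrow> cmod (1 - poly_at n q w * poly_at n r w) \<le> 1/4"
    using q unfolding approx_invertible_def by (meson zero_less_divide_1_iff zero_less_numeral)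
  define u where "u = 1 - q' * r"
  have u: "u \<in> polys n" unfolding u_def by (intro polys_diff polys_one polys_mult q' r(1))
  have ub: "cmod (poly_at n u w) \<le> 7/8" if w: "w \<in> Gamma n" for w
  proof -
    let ?q = "poly_at n q w" and ?q' = "poly_at n q' w" and ?r = "poly_at n r w"
    have "cmod (?q * ?r) \<le> 5/4"
      using norm_triangle_ineq[of "?q * ?r - 1" 1] r(2)[OF w] by (simp add: norm_minus_commute)
    then have "d * cmod ?r \<le> 5/4"
      using mult_right_mono[OF lower[OF w], of "cmod ?r"] by (simp add: norm_mult)
    then have "cmod ((?q - ?q') * ?r) \<le> 5/8"
      using mult_right_mono[OF close[OF w], of "cmod ?r"] by (simp add: norm_mult)
    moreover have "poly_at n u w = (1 - ?q * ?r) + (?q - ?q') * ?r"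
      by (simp add: u_def poly_at_diff poly_at_mult algebra_simps)
    ultimately show ?thesis using norm_triangle_ineq[of "1 - ?q * ?r" "(?q - ?q') * ?r"] r(2)[OF w] by simp
  qed
  obtain N where N: "(7/8::real) ^ N < e" using real_arch_pow_inv[OF e, of "7/8"] by auto
  define R where "R = r * (\<Sum>m<N. u ^ m)"
  have "R \<in> polys n" unfolding R_def by (intro polys_mult r(1) polys_sum polys_power u)
  moreover have "cmod (1 - poly_at n q' w * poly_at n R w) \<le> e" if w: "w \<in> Gamma n" for w
  proof -
    have "poly_at n q' w * poly_at n R w = (1 - poly_at n u w) * (\<Sum>m<N. poly_at n u w ^ m)"
      by (simp add: R_def u_def poly_at_mult poly_at_sum poly_at_power poly_at_diff mult.assoc)
    also have "\<dots> = 1 - poly_at n u w ^ N" by (rule one_diff_power_eq[symmetric])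
    finally have "cmod (1 - poly_at n q' w * poly_at n R w) = cmod (poly_at n u w) ^ N"
      by (simp add: norm_power)
    also have "\<dots> \<le> (7/8) ^ N" using ub[OF w] by (intro power_mono) auto
    finally show ?thesis using N by simp
  qed
  ultimately show "\<exists>r\<in>polys n. \<forall>w\<in>Gamma n. cmod (1 - poly_at n q' w * poly_at n r w) \<le> e" by blast
qed

definition dilate :: "real \<Rightarrow> (nat \<Rightarrow> complex) \<Rightarrow> nat \<Rightarrow> complex" where
  "dilate r s = (\<lambda>i. complex_of_real r ^ i * s i)"

lemma dilate_Gamma: "s \<in> Gamma n \<Longrightarrow> r \<in> {0..1} \<Longrightarrow> dilate r s \<in> Gamma n"
  unfolding dilate_def by (rule Gamma_dilation) auto

lemma poly_dilation:
  assumes "q \<in> polys n"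
  shows "\<exists>q'\<in>polys n. \<forall>s. poly_at n q' s = poly_at n q (dilate c s)"
  using assms
proof (induct q rule: polys_induct)
  case (const d)
  then show ?case by (intro bexI[of _ "poly_const d"]) auto
next
  case (var i)
  then show ?case by (intro bexI[of _ "poly_const (complex_of_real c ^ i) * poly_var i"]) (auto simp: poly_at_mult dilate_def intro!: polys_mult)
next
  case (add p q)
  then obtain p' q' where "p' \<in> polys n" "q' \<in> polys n" "\<forall>s. poly_at n p' s = poly_at n p (dilate c s)"
    "\<forall>s. poly_at n q' s = poly_at n q (dilate c s)" by blast
  then show ?case by (intro bexI[of _ "p' + q'"]) (auto simp: poly_at_add intro!: polys_add)
next
  case (mult p q)
  then obtain p' q' where "p' \<in> polys n" "q' \<in> polys n" "\<forall>s. poly_at n p' s = poly_at n p (dilate c s)"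
    "\<forall>s. poly_at n q' s = poly_at n q (dilate c s)" by blast
  then show ?case by (intro bexI[of _ "p' * q'"]) (auto simp: poly_at_mult intro!: polys_mult)
qed

lemma poly_dilation_Lipschitz:
  assumes compact: "compact (Gamma n)" and q: "q \<in> polys n"
  shows "\<exists>L\<ge>0. \<forall>s\<in>Gamma n. \<forall>a\<in>{0..1}. \<forall>b\<in>{0..1}.
    cmod (poly_at n q (dilate a s) - poly_at n q (dilate b s))
      \<le> L * \<bar>a - b\<bar>"
  using q
proof (induct q rule: polys_induct)
  case (const c)
  then show ?case by (intro exI[of _ 0]) auto
next
  case (var i)
  obtain B where B: "B > 0" "\<And>w. w \<in> Gamma n \<Longrightarrow> cmod (poly_at n (poly_var i) w) \<le> B"
    using poly_at_bounded_on_Gamma[OF compact] by blast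
  have *: "cmod (poly_at n (poly_var i) (dilate a s) - poly_at n (poly_var i) (dilate b s))
      \<le> real i * B * \<bar>a - b\<bar>" if s: "s \<in> Gamma n" and ab: "a \<in> {0..1}" "b \<in> {0..1}" for s a b
  proof -
    have "cmod (complex_of_real a ^ i - complex_of_real b ^ i) \<le> real i * cmod (complex_of_real a - complex_of_real b)"
      using ab by (intro norm_power_diff) auto
    also have "\<dots> = real i * \<bar>a - b\<bar>" by (metis norm_of_real of_real_diff)
    finally have "cmod (complex_of_real a ^ i - complex_of_real b ^ i) * cmod (s i) \<le> real i * \<bar>a - b\<bar> * B"
      using B(2)[OF s] var B(1) by (intro mult_mono) auto
    then have "cmod ((complex_of_real a ^ i - complex_of_real b ^ i) * s i) \<le> real i * B * \<bar>a - b\<bar>"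
      by (simp add: norm_mult mult_ac)
    then show ?thesis using var by (simp add: left_diff_distrib dilate_def)
  qed
  show ?case using B(1) by (intro exI[of _ "real i * B"] conjI ballI *) auto
next
  case (add p q)
  obtain L where L0: "L \<ge> 0" and "\<forall>s\<in>Gamma n. \<forall>a\<in>{0..1}. \<forall>b\<in>{0..1}.
      cmod (poly_at n p (dilate a s) - poly_at n p (dilate b s)) \<le> L * \<bar>a - b\<bar>"
    using add(3) by (elim exE conjE)
  note L = L0 this(2)[rule_format]
  obtain K where K0: "K \<ge> 0" and "\<forall>s\<in>Gamma n. \<forall>a\<in>{0..1}. \<forall>b\<in>{0..1}.
      cmod (poly_at n q (dilate a s) - poly_at n q (dilate b s)) \<le> K * \<bar>a - b\<bar>"
    using add(4) by (elim exE conjE)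
  note K = K0 this(2)[rule_format]
  have *: "cmod (poly_at n (p + q) (dilate a s) - poly_at n (p + q) (dilate b s))
      \<le> (L + K) * \<bar>a - b\<bar>" if "s \<in> Gamma n" "a \<in> {0..1}" "b \<in> {0..1}" for s a b
    unfolding poly_at_add add_diff_add distrib_right
    by (rule order_trans[OF norm_triangle_ineq add_mono[OF L(2)[OF that] K(2)[OF that]]])
  show ?case using L(1) K(1) by (intro exI[of _ "L + K"] conjI ballI *) auto
next
  case (mult p q)
  obtain L where L0: "L \<ge> 0" and "\<forall>s\<in>Gamma n. \<forall>a\<in>{0..1}. \<forall>b\<in>{0..1}.
      cmod (poly_at n p (dilate a s) - poly_at n p (dilate b s)) \<le> L * \<bar>a - b\<bar>"
    using mult(3) by (elim exE conjE)
  note L = L0 this(2)[rule_format]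
  obtain K where K0: "K \<ge> 0" and "\<forall>s\<in>Gamma n. \<forall>a\<in>{0..1}. \<forall>b\<in>{0..1}.
      cmod (poly_at n q (dilate a s) - poly_at n q (dilate b s)) \<le> K * \<bar>a - b\<bar>"
    using mult(4) by (elim exE conjE)
  note K = K0 this(2)[rule_format]
  obtain B where B: "B > 0" "\<And>w. w \<in> Gamma n \<Longrightarrow> cmod (poly_at n p w) \<le> B"
    using poly_at_bounded_on_Gamma[OF compact] by blast
  obtain C where C: "C > 0" "\<And>w. w \<in> Gamma n \<Longrightarrow> cmod (poly_at n q w) \<le> C"
    using poly_at_bounded_on_Gamma[OF compact] by blast
  have *: "cmod (poly_at n (p * q) (dilate a s) - poly_at n (p * q) (dilate b s))
      \<le> (B * K + C * L) * \<bar>a - b\<bar>" if s: "s \<in> Gamma n" "a \<in> {0..1}" "b \<in> {0..1}" for s a b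
  proof -
    let ?a = "dilate a s" and ?b = "dilate b s"
    have g: "?a \<in> Gamma n" "?b \<in> Gamma n" using s by (auto intro: dilate_Gamma)
    have "poly_at n (p * q) ?a - poly_at n (p * q) ?b
        = poly_at n p ?a * (poly_at n q ?a - poly_at n q ?b) + poly_at n q ?b * (poly_at n p ?a - poly_at n p ?b)"
      by (simp add: poly_at_mult algebra_simps)
    also have "cmod \<dots> \<le> B * (K * \<bar>a - b\<bar>) + C * (L * \<bar>a - b\<bar>)"
      using B C g s L K
      by (intro order_trans[OF norm_triangle_ineq] add_mono) (auto simp: norm_mult intro!: mult_mono)
    finally show ?thesis by (simp add: algebra_simps)
  qed
  show ?case using B(1) C(1) L(1) K(1) by (intro exI[of _ "B * K + C * L"] conjI ballI *) auto
qed

text \<open>The dilations \<open>s \<mapsto> (r s\<^sub>1, r\<^sup>2 s\<^sub>2, \<dots>, r\<^sup>n s\<^sub>n)\<close>, \<open>0 \<le> r \<le> 1\<close>, map \<open>\<Gamma>\<^sub>n\<close> into itself and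
  deform \<open>q\<close> to a nonzero constant. Along this path \<open>\<bar>q\<bar>\<close> stays bounded below, and a Neumann series
  propagates the approximate invertibility in finitely many steps.\<close>

lemma approx_invertible_of_nonvanishing:
  assumes compact: "compact (Gamma n)" and q: "q \<in> polys n"
    and nz: "\<And>w. w \<in> Gamma n \<Longrightarrow> poly_at n q w \<noteq> 0"
  shows "approx_invertible n q"
proof -
  have "\<exists>x\<in>Gamma n. \<forall>y\<in>Gamma n. cmod (poly_at n q x) \<le> cmod (poly_at n q y)"
    using Gamma_zero by (intro continuous_attains_inf[OF compact] continuous_intros continuous_on_poly_at) auto
  then obtain w0 where w0: "w0 \<in> Gamma n" "\<And>y. y \<in> Gamma n \<Longrightarrow> cmod (poly_at n q w0) \<le> cmod (poly_at n q y)"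
    by blast
  define d where "d = cmod (poly_at n q w0)"
  have d: "d > 0" using nz[OF w0(1)] by (simp add: d_def)
  obtain L where L: "L \<ge> 0" "\<And>s a b. s \<in> Gamma n \<Longrightarrow> a \<in> {0..1} \<Longrightarrow> b \<in> {0..1} \<Longrightarrow>
      cmod (poly_at n q (dilate a s) - poly_at n q (dilate b s)) \<le> L * \<bar>a - b\<bar>"
    using poly_dilation_Lipschitz[OF compact q] by metis
  obtain N :: nat where N: "N > 0" "L / real N \<le> d / 2"
  proof -
    obtain N :: nat where N: "real N > 2 * L / d + 1" using reals_Archimedean2 by blast
    have p: "real N > 0" using N L(1) d by (smt (verit) divide_nonneg_pos)
    have "2 * L / d < real N" using N by simp
    then have "2 * L < real N * d" using d by (simp add: divide_less_eq)
    then have "L / real N \<le> d / 2" using p by (simp add: divide_le_eq mult.commute)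
    then show ?thesis using that p by simp
  qed
  obtain Q where Q: "\<And>c. Q c \<in> polys n" "\<And>c s. poly_at n (Q c) s = poly_at n q (dilate c s)"
    using poly_dilation[OF q] by metis
  have lower: "d \<le> cmod (poly_at n (Q a) w)" if "w \<in> Gamma n" "a \<in> {0..1}" for a w
    unfolding Q(2) d_def using that by (intro w0(2) dilate_Gamma)
  have "approx_invertible n (Q (real k / real N))" if "k \<le> N" for k
    using that
  proof (induct k)
    case 0
    define c where "c = poly_at n q (\<lambda>_. 0)"
    have c: "c \<noteq> 0" unfolding c_def by (rule nz[OF Gamma_zero])
    have "poly_at n (Q 0) w = c" if "w \<in> Gamma n" for w
    proof -
      have "w 0 = 0" using Gamma_cspace[OF that] by (simp add: cspace_def)
      then have "dilate 0 w = (\<lambda>_. 0)" by (auto simp: fun_eq_iff power_0_left dilate_def)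
      then show ?thesis by (simp add: Q(2) c_def)
    qed
    then show ?case unfolding approx_invertible_def
      using c by (intro allI impI bexI[of _ "poly_const (1 / c)"]) auto
  next
    case (Suc k)
    have in01: "real k / real N \<in> {0..1}" "real (Suc k) / real N \<in> {0..1}" using Suc(2) N(1) by auto
    show ?case
    proof (rule approx_invertible_perturb[OF Suc(1) Q(1) d])
      fix w assume w: "w \<in> Gamma n"
      show "d \<le> cmod (poly_at n (Q (real k / real N)) w)" by (rule lower[OF w in01(1)])
      have "\<bar>real k / real N - real (Suc k) / real N\<bar> = 1 / real N"
        using N(1) by (simp add: abs_real_def field_simps)
      then have "L * \<bar>real k / real N - real (Suc k) / real N\<bar> \<le> d / 2"
        using N(2) by (simp del: of_nat_Suc)
      then show "cmod (poly_at n (Q (real k / real N)) w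
          - poly_at n (Q (real (Suc k) / real N)) w) \<le> d / 2"
        unfolding Q(2) by (rule order_trans[OF L(2)[OF w in01]])
    qed (use Suc(2) in simp)
  qed
  from this[of N] show ?thesis using N(1) by (simp add: approx_invertible_def Q(2) dilate_def)
qed

text \<open>The von Neumann inequality for polynomials over \<open>\<Gamma>\<^sub>n\<close>. Quantifying over upper bounds instead of
  taking the supremum avoids boundedness side conditions.\<close>

definition Gamma_poly_bounded ::
    "nat \<Rightarrow> 'a::chilbert_space set \<Rightarrow> (nat \<Rightarrow> 'a \<Rightarrow> 'a) \<Rightarrow> bool" where
  "Gamma_poly_bounded n M T \<longleftrightarrow> (\<forall>p\<in>polys n. \<forall>B. (\<forall>w\<in>Gamma n. cmod (poly_at n p w) \<le> B) \<longrightarrow>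
     (\<forall>x\<in>M. norm (poly_op n p T x) \<le> B * norm x))"

lemma Gamma_poly_boundedD:
  assumes "Gamma_poly_bounded n M T" "p \<in> polys n" "\<And>w. w \<in> Gamma n \<Longrightarrow> cmod (poly_at n p w) \<le> B" "x \<in> M"
  shows "norm (poly_op n p T x) \<le> B * norm x"
  using assms unfolding Gamma_poly_bounded_def by blast

lemma Gamma_bound_nonneg:
  assumes "\<And>w. w \<in> Gamma n \<Longrightarrow> cmod (poly_at n p w) \<le> B"
  shows "0 \<le> B"
  using assms[OF Gamma_zero] norm_ge_zero order_trans by blast

lemma Gamma_contractionD:
  assumes "Gamma_contraction n M T"
  shows "commuting_tuple n M T" "compact (Gamma n)" "Gamma_poly_bounded n M T"
proof -
  show T: "commuting_tuple n M T" and "compact (Gamma n)"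
    using assms by (auto simp: Gamma_contraction_def spectral_set_def)
  note M = commuting_tupleD(1)[OF T]
  show "Gamma_poly_bounded n M T"
    unfolding Gamma_poly_bounded_def
  proof (intro ballI allI impI)
    fix p B x
    assume p: "p \<in> polys n" and B: "\<forall>w\<in>Gamma n. cmod (poly_at n p w) \<le> B" and x: "x \<in> M"
    have "onorm_on M (rat_op n M p 1 T) \<le> (SUP z\<in>Gamma n. cmod (poly_at n p z / poly_at n 1 z))"
      using assms p polys_one unfolding Gamma_contraction_def spectral_set_def
      by (metis poly_at_one zero_neq_one)
    also have "\<dots> \<le> B" using B Gamma_zero by (intro cSUP_least) auto
    finally have le: "onorm_on M (rat_op n M p 1 T) \<le> B" .
    have "rat_op n M p 1 T y = poly_op n p T y" if "y \<in> M" for y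
    proof -
      have "inv_into M (poly_op n 1 T) (poly_op n 1 T y) = y"
        using that by (intro inv_into_f_f) (auto simp: inj_on_def)
      then show ?thesis by (simp add: rat_op_def)
    qed
    then have "onorm_on M (rat_op n M p 1 T) = onorm_on M (poly_op n p T)"
      unfolding onorm_on_def by (intro arg_cong[where f = Sup] image_cong) auto
    then show "norm (poly_op n p T x) \<le> B * norm x"
      using onorm_on_leD[OF M poly_op_bounded[OF T] _ x] le by simp
  qed
qed

text \<open>Since \<open>\<Gamma>\<^sub>n\<close> is polynomially convex, the polynomial estimate alone confines the Taylor spectrum;
  and it extends to rational functions because their denominators are approximately invertible by
  polynomials.\<close>

lemma Gamma_contractionI:
  assumes T: "commuting_tuple n M T" and compact: "compact (Gamma n)" and bd: "Gamma_poly_bounded n M T"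
  shows "Gamma_contraction n M T"
proof -
  note M = commuting_tupleD(1)[OF T]
  note b = poly_op_bounded[OF T]
  have spectrum: "taylor_spectrum n M T \<subseteq> Gamma n"
  proof
    fix z assume z: "z \<in> taylor_spectrum n M T"
    then have "z \<in> cspace n" by (simp add: taylor_spectrum_def)
    then show "z \<in> Gamma n"
    proof (rule Gamma_polynomially_convex)
      fix p B assume p: "p \<in> polys n" and B: "\<And>w. w \<in> Gamma n \<Longrightarrow> cmod (poly_at n p w) \<le> B"
      show "cmod (poly_at n p z) \<le> B"
        using Gamma_poly_boundedD[OF bd p B] Gamma_bound_nonneg[OF B]
        by (intro taylor_spectrum_poly_bound[OF T p z]) auto
    qed
  qed
  have "onorm_on M (rat_op n M p q T) \<le> (SUP z\<in>Gamma n. cmod (poly_at n p z / poly_at n q z))"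
    if p: "p \<in> polys n" and q: "q \<in> polys n" and nz: "\<forall>z\<in>Gamma n. poly_at n q z \<noteq> 0" for p q
  proof -
    define K where "K = (SUP z\<in>Gamma n. cmod (poly_at n p z / poly_at n q z))"
    have inv: "approx_invertible n q" using approx_invertible_of_nonvanishing[OF compact q] nz by blast
    have "bounded ((\<lambda>z. poly_at n p z / poly_at n q z) ` Gamma n)"
      using nz by (intro compact_imp_bounded compact_continuous_image compact continuous_intros continuous_on_poly_at) auto
    then have "bdd_above ((\<lambda>z. cmod (poly_at n p z / poly_at n q z)) ` Gamma n)"
      unfolding bounded_iff bdd_above_def by auto
    then have K: "cmod (poly_at n p z / poly_at n q z) \<le> K" if "z \<in> Gamma n" for z
      unfolding K_def using that by (rule cSUP_upper2) simp
    have K0: "0 \<le> K" using K[OF Gamma_zero] norm_ge_zero order_trans by blast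
    \<comment> \<open>\<open>q(T) r(T)\<close> is within 1/2 of the identity for a suitable \<open>r\<close>, hence onto\<close>
    have surj: "x \<in> poly_op n q T ` M" if x: "x \<in> M" for x
    proof -
      obtain r where r: "r \<in> polys n" "\<And>w. w \<in> Gamma n \<Longrightarrow> cmod (1 - poly_at n q w * poly_at n r w) \<le> 1/2"
        using inv unfolding approx_invertible_def by (meson zero_less_divide_1_iff zero_less_numeral)
      have "norm (poly_op n (1 - q * r) T y) \<le> 1/2 * norm y" if "y \<in> M" for y
        using r(2) by (intro Gamma_poly_boundedD[OF bd _ _ that] polys_diff polys_mult polys_one q r(1))
          (simp add: poly_at_diff poly_at_mult)
      then have "bij_betw (\<lambda>y. poly_op n (1 - q * r) T y - 1 *\<^sub>C y) M M"
        by (intro bij_betw_diff_scaleC[OF M b, where a = "1/2"]) auto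
      then obtain y where y: "y \<in> M" "x = poly_op n (1 - q * r) T y - 1 *\<^sub>C y"
        using x unfolding bij_betw_def by blast
      have ry: "poly_op n r T y \<in> M" using bounded_op_onD(1)[OF b y(1)] .
      have "x = poly_op n q T (- poly_op n r T y)"
        using y(2) clinear_onD(4)[OF M bounded_op_onD(2)[OF b] ry] by (simp add: poly_op_diff poly_op_mult[OF T y(1)])
      then show ?thesis using closed_csubspaceD(5)[OF M ry] by blast
    qed
    \<comment> \<open>on \<open>\<Gamma>\<^sub>n\<close> the polynomial \<open>p r\<close> is nearly \<open>p / q\<close>, and \<open>p - p r q\<close> is small\<close>
    have key: "norm (poly_op n p T y) \<le> K * norm (poly_op n q T y)" if y: "y \<in> M" for y
    proof -
      obtain C where C: "C > 0" "\<And>w. w \<in> Gamma n \<Longrightarrow> cmod (poly_at n p w) \<le> C"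
        using poly_at_bounded_on_Gamma[OF compact] by blast
      have qy: "poly_op n q T y \<in> M" using bounded_op_onD(1)[OF b y] .
      have "norm (poly_op n p T y) \<le> K * (1 + e) * norm (poly_op n q T y) + C * e * norm y" (is "_ \<le> ?R e") if e: "e > 0" for e
      proof -
        obtain r where r: "r \<in> polys n" "\<And>w. w \<in> Gamma n \<Longrightarrow> cmod (1 - poly_at n q w * poly_at n r w) \<le> e"
          using inv e unfolding approx_invertible_def by meson
        have "norm (poly_op n (p * r) T (poly_op n q T y)) \<le> K * (1 + e) * norm (poly_op n q T y)"
        proof (rule Gamma_poly_boundedD[OF bd polys_mult[OF p r(1)] _ qy])
          fix w assume w: "w \<in> Gamma n"
          have "cmod (poly_at n q w * poly_at n r w) \<le> 1 + e"
            using norm_triangle_ineq[of "poly_at n q w * poly_at n r w - 1" 1] r(2)[OF w]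
            by (simp add: norm_minus_commute)
          then have "cmod (poly_at n p w / poly_at n q w * (poly_at n q w * poly_at n r w)) \<le> K * (1 + e)"
            unfolding norm_mult[of "poly_at n p w / poly_at n q w"] using K[OF w] K0 by (intro mult_mono) auto
          then show "cmod (poly_at n (p * r) w) \<le> K * (1 + e)" using nz w by (simp add: poly_at_mult)
        qed
        moreover have "norm (poly_op n (p * (1 - q * r)) T y) \<le> C * e * norm y"
        proof (rule Gamma_poly_boundedD[OF bd _ _ y])
          show "p * (1 - q * r) \<in> polys n" by (intro polys_mult polys_diff polys_one p q r(1))
          show "cmod (poly_at n (p * (1 - q * r)) w) \<le> C * e" if "w \<in> Gamma n" for w
            using C r(2)[OF that] that by (auto simp: poly_at_mult poly_at_diff norm_mult intro!: mult_mono)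
        qed
        moreover have "poly_op n p T y = poly_op n (p * r) T (poly_op n q T y) + poly_op n (p * (1 - q * r)) T y"
        proof -
          have "p = (p * r) * q + p * (1 - q * r)" by (simp add: algebra_simps)
          then show ?thesis by (metis poly_op_add poly_op_mult[OF T y])
        qed
        ultimately show ?thesis
          using norm_triangle_ineq[of "poly_op n (p * r) T (poly_op n q T y)" "poly_op n (p * (1 - q * r)) T y"]
          by simp
      qed
      then have approx: "e > 0 \<Longrightarrow> norm (poly_op n p T y) \<le> ?R e" for e .
      have *: "norm (poly_op n p T y) \<le> K * (1 + 1 / real (Suc k)) * norm (poly_op n q T y) + C * (1 / real (Suc k)) * norm y" for k
        by (rule approx) simp
      have "(\<lambda>k. K * (1 + 1 / real (Suc k)) * norm (poly_op n q T y) + C * (1 / real (Suc k)) * norm y)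
          \<longlonglongrightarrow> K * (1 + 0) * norm (poly_op n q T y) + C * 0 * norm y"
        by (intro tendsto_intros LIMSEQ_inverse_real_of_nat[unfolded inverse_eq_divide])
      then have "norm (poly_op n p T y) \<le> K * (1 + 0) * norm (poly_op n q T y) + C * 0 * norm y"
        using * by (intro LIMSEQ_le_const) auto
      then show ?thesis by simp
    qed
    have "norm (rat_op n M p q T x) \<le> K * norm x" if x: "x \<in> M" for x
      using key[of "inv_into M (poly_op n q T) x"] inv_into_into[OF surj[OF x]] f_inv_into_f[OF surj[OF x]]
      by (simp add: rat_op_def)
    then show ?thesis using K0 closed_csubspaceD(2)[OF M] unfolding K_def[symmetric]
      by (intro onorm_on_leI) auto
  qed
  then show ?thesis
    unfolding Gamma_contraction_def spectral_set_def using T compact spectrum Gamma_cspace by blast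
qed

lemma Gamma_contraction_restrict:
  assumes T: "Gamma_contraction n M T" and L: "closed_csubspace L" "L \<subseteq> M"
    and inv: "\<And>i. i \<in> {1..n} \<Longrightarrow> T i ` L \<subseteq> L"
  shows "Gamma_contraction n L T"
proof (rule Gamma_contractionI)
  note T' = Gamma_contractionD[OF T]
  show "commuting_tuple n L T"
    unfolding commuting_tuple_def
  proof (intro conjI ballI)
    show "bounded_op_on L (T i)" if "i \<in> {1..n}" for i
      by (rule bounded_op_on_subset[OF commuting_tupleD(2)[OF T'(1) that] L(2) inv[OF that]])
    show "T i (T j x) = T j (T i x)" if "i \<in> {1..n}" "j \<in> {1..n}" "x \<in> L" for i j x
      using that L(2) by (intro commuting_tupleD(3)[OF T'(1)]) auto
  qed (rule L(1))
  show "compact (Gamma n)" by (rule T'(2))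
  show "Gamma_poly_bounded n L T"
    using T'(3) L(2) unfolding Gamma_poly_bounded_def by blast
qed

text \<open>The polynomial \<open>p'\<close> has the conjugate coefficients of \<open>p\<close>.\<close>

lemma poly_op_adjoint:
  assumes T: "commuting_tuple n UNIV T" and T': "commuting_tuple n UNIV (\<lambda>i. adj (T i))"
    and p: "p \<in> polys n"
  shows "\<exists>p'\<in>polys n. (\<forall>s. poly_at n p' s = cnj (poly_at n p (\<lambda>i. cnj (s i)))) \<and>
    (\<forall>x y. cinner (poly_op n p (\<lambda>i. adj (T i)) x) y = cinner x (poly_op n p' T y))"
  using p
proof (induct p rule: polys_induct)
  case (const c)
  show ?case by (rule bexI[of _ "poly_const (cnj c)"]) (auto simp: cinner_scaleC_left cinner_scaleC_right)
next
  case (var i)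
  then show ?case
    using adj_on_props'[OF closed_csubspace_UNIV commuting_tupleD(2)[OF T var]]
    by (intro bexI[of _ "poly_var i"]) auto
next
  case (add p q)
  then obtain p' q' where "p' \<in> polys n" "q' \<in> polys n"
    "\<forall>s. poly_at n p' s = cnj (poly_at n p (\<lambda>i. cnj (s i)))"
    "\<forall>s. poly_at n q' s = cnj (poly_at n q (\<lambda>i. cnj (s i)))"
    "\<forall>x y. cinner (poly_op n p (\<lambda>i. adj (T i)) x) y = cinner x (poly_op n p' T y)"
    "\<forall>x y. cinner (poly_op n q (\<lambda>i. adj (T i)) x) y = cinner x (poly_op n q' T y)" by metis
  then show ?case
    by (intro bexI[of _ "p' + q'"])
      (auto simp: poly_at_add poly_op_add cinner_add_left cinner_add_right intro!: polys_add)
next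
  case (mult p q)
  then obtain p' q' where "p' \<in> polys n" "q' \<in> polys n"
    "\<forall>s. poly_at n p' s = cnj (poly_at n p (\<lambda>i. cnj (s i)))"
    "\<forall>s. poly_at n q' s = cnj (poly_at n q (\<lambda>i. cnj (s i)))"
    "\<forall>x y. cinner (poly_op n p (\<lambda>i. adj (T i)) x) y = cinner x (poly_op n p' T y)"
    "\<forall>x y. cinner (poly_op n q (\<lambda>i. adj (T i)) x) y = cinner x (poly_op n q' T y)" by metis
  then show ?case
    by (intro bexI[of _ "q' * p'"])
      (auto simp: poly_at_mult poly_op_mult[OF T UNIV_I] poly_op_mult[OF T' UNIV_I] mult.commute[where 'a = complex] intro!: polys_mult)
qed

lemma commuting_tuple_adj:
  assumes T: "commuting_tuple n UNIV T"
  shows "commuting_tuple n UNIV (\<lambda>i. adj (T i))"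
  unfolding commuting_tuple_def
proof (intro conjI ballI)
  show "closed_csubspace UNIV" by simp
  show "bounded_op_on UNIV (adj (T i))" if "i \<in> {1..n}" for i
    by (rule bounded_op_on_adj_on'[OF closed_csubspace_UNIV commuting_tupleD(2)[OF T that]])
  show "adj (T i) (adj (T j) x) = adj (T j) (adj (T i) x)" if ij: "i \<in> {1..n}" "j \<in> {1..n}" for i j x
  proof (rule cinner_eqI)
    note a = adj_on_props(2)[OF closed_csubspace_UNIV commuting_tupleD(2)[OF T] UNIV_I, symmetric]
    fix y
    show "cinner y (adj (T i) (adj (T j) x)) = cinner y (adj (T j) (adj (T i) x))"
      using ij by (simp add: a commuting_tupleD(3)[OF T ij UNIV_I])
  qed
qed

text \<open>Conjugation of the coefficients preserves the bounds over \<open>\<Gamma>\<^sub>n\<close>, because \<open>\<Gamma>\<^sub>n\<close> is invariant under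
  complex conjugation.\<close>

lemma Gamma_contraction_adj:
  assumes "Gamma_contraction n UNIV T"
  shows "Gamma_contraction n UNIV (\<lambda>i. adj (T i))"
proof (rule Gamma_contractionI)
  note T = Gamma_contractionD[OF assms]
  show T': "commuting_tuple n UNIV (\<lambda>i. adj (T i))" by (rule commuting_tuple_adj[OF T(1)])
  show "compact (Gamma n)" by (rule T(2))
  show "Gamma_poly_bounded n UNIV (\<lambda>i. adj (T i))"
    unfolding Gamma_poly_bounded_def
  proof (intro ballI allI impI)
    fix p B x assume p: "p \<in> polys n" and B: "\<forall>w\<in>Gamma n. cmod (poly_at n p w) \<le> B"
    obtain p' where p': "p' \<in> polys n" "\<And>s. poly_at n p' s = cnj (poly_at n p (\<lambda>i. cnj (s i)))"
      "\<And>x y. cinner (poly_op n p (\<lambda>i. adj (T i)) x) y = cinner x (poly_op n p' T y)"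
      using poly_op_adjoint[OF T(1) T' p] by blast
    let ?y = "poly_op n p (\<lambda>i. adj (T i)) x"
    have "norm (poly_op n p' T ?y) \<le> B * norm ?y"
      using B Gamma_cnj by (intro Gamma_poly_boundedD[OF T(3) p'(1)]) (auto simp: p'(2))
    then have "norm x * norm (poly_op n p' T ?y) \<le> norm x * (B * norm ?y)" by (intro mult_left_mono) auto
    moreover have "(norm ?y)\<^sup>2 \<le> norm x * norm (poly_op n p' T ?y)"
      using norm_cinner_le[of x "poly_op n p' T ?y"] unfolding p'(3)[symmetric] cinner_self
      by (simp add: norm_power)
    ultimately have "norm ?y * norm ?y \<le> (B * norm x) * norm ?y"
      by (simp add: power2_eq_square mult_ac)
    moreover have "0 \<le> B" using Gamma_bound_nonneg B by blast
    ultimately show "norm ?y \<le> B * norm x" by (cases "norm ?y = 0") auto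
  qed
qed

section \<open>The parts of a contraction\<close>

text \<open>Here \<open>\<parallel>P\<^sup>* P x - x\<parallel>\<^sup>2 = \<parallel>P\<^sup>* P x\<parallel>\<^sup>2 - 2 \<parallel>P x\<parallel>\<^sup>2 + \<parallel>x\<parallel>\<^sup>2 \<le> 0\<close>.\<close>

lemma adjoint_undoes_isometric_vector:
  fixes x :: "'a::chilbert_space"
  assumes P: "bounded_op_on UNIV P" and contr: "\<And>x. norm (P x) \<le> norm x" and x: "norm (P x) = norm x"
  shows "adj P (P x) = x"
proof -
  have "norm (adj P (P x)) \<le> 1 * norm (P x)"
    using bounded_op_on_adj_on(2)[OF closed_csubspace_UNIV P, of 1] contr by simp
  then have le: "(norm (adj P (P x)))\<^sup>2 \<le> (norm x)\<^sup>2" using x by (intro power_mono) auto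
  have "cinner (adj P (P x)) x = cinner (P x) (P x)"
    using adj_on_props'[OF closed_csubspace_UNIV P UNIV_I] by metis
  then have "Re (cinner (adj P (P x)) x) = (norm x)\<^sup>2" using x by (simp add: cinner_self)
  then have "(norm (adj P (P x) - x))\<^sup>2 \<le> 0" using le by (simp add: power2_norm_diff)
  then show ?thesis by simp
qed

locale contraction_operator =
  fixes P :: "'a::chilbert_space \<Rightarrow> 'a"
  assumes bounded: "bounded_op_on UNIV P" and contractive: "norm (P x) \<le> norm x"
begin

lemmas lin_pow = clinear_onD[OF closed_csubspace_UNIV bounded_op_onD(2)[OF bounded_op_on_funpow[OF bounded]], simplified]

lemma norm_pow_le: "norm ((P ^^ k) x) \<le> norm x"
  by (induct k) (auto intro: order_trans[OF contractive])

lemma norm_pow_Suc_le: "norm ((P ^^ Suc k) x) \<le> norm ((P ^^ k) x)"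
  using contractive by simp

lemma norm_adj_le: "norm (adj P x) \<le> norm x"
  using bounded_op_on_adj_on(2)[OF closed_csubspace_UNIV bounded, of 1] contractive by simp

lemma norm_adj_pow_le: "norm ((adj P ^^ k) x) \<le> norm x"
  by (induct k) (auto intro: order_trans[OF norm_adj_le])

lemma isometric_part_iff: "x \<in> isometric_part P \<longleftrightarrow> (\<forall>k. norm ((P ^^ k) x) = norm x)"
proof
  assume "x \<in> isometric_part P"
  then have "(\<lambda>k. norm ((P ^^ k) x)) \<longlonglongrightarrow> norm x" by (simp add: isometric_part_def)
  moreover have "decseq (\<lambda>k. norm ((P ^^ k) x))" using norm_pow_Suc_le by (intro decseq_SucI)
  ultimately have "norm x \<le> norm ((P ^^ k) x)" for k using decseq_ge by blast
  then show "\<forall>k. norm ((P ^^ k) x) = norm x" using norm_pow_le by (meson order_antisym)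
qed (simp add: isometric_part_def)

text \<open>This description of the isometric part is linear, and stable under every operator that
  commutes with \<open>P\<close> and its adjoint.\<close>

lemma isometric_part_iff_adjoint:
  "x \<in> isometric_part P \<longleftrightarrow> (\<forall>k. (adj P ^^ k) ((P ^^ k) x) = x)"
proof
  assume x: "x \<in> isometric_part P"
  have "(adj P ^^ k) ((P ^^ k) x) = x" for k
  proof (induct k)
    case (Suc k)
    have "norm (P ((P ^^ k) x)) = norm ((P ^^ k) x)"
      using x[unfolded isometric_part_iff, rule_format, of "Suc k"] x[unfolded isometric_part_iff, rule_format, of k]
      by simp
    then have "adj P (P ((P ^^ k) x)) = (P ^^ k) x"
      by (intro adjoint_undoes_isometric_vector[OF bounded contractive])
    then show ?case using Suc by (simp add: funpow_swap1)
  qed simp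
  then show "\<forall>k. (adj P ^^ k) ((P ^^ k) x) = x" by blast
next
  assume x: "\<forall>k. (adj P ^^ k) ((P ^^ k) x) = x"
  have "norm x \<le> norm ((P ^^ k) x)" for k
    using norm_adj_pow_le[of k "(P ^^ k) x"] x by simp
  then show "x \<in> isometric_part P"
    unfolding isometric_part_iff using norm_pow_le by (meson order_antisym)
qed

lemma isometric_part_subspace: "closed_csubspace (isometric_part P)"
  unfolding closed_csubspace_def
proof (intro conjI ballI allI)
  show "closed (isometric_part P)"
    unfolding closed_sequential_limits
  proof (intro allI impI)
    fix x l assume x: "(\<forall>j. x j \<in> isometric_part P) \<and> x \<longlonglongrightarrow> l"
    have "norm ((P ^^ k) l) = norm l" for k
    proof (rule LIMSEQ_unique)
      show "(\<lambda>j. norm ((P ^^ k) (x j))) \<longlonglongrightarrow> norm ((P ^^ k) l)"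
        using x by (intro tendsto_norm bounded_op_on_tendsto[OF closed_csubspace_UNIV bounded_op_on_funpow[OF bounded]]) auto
      show "(\<lambda>j. norm ((P ^^ k) (x j))) \<longlonglongrightarrow> norm l"
        using x by (auto simp: isometric_part_iff intro: tendsto_norm)
    qed
    then show "l \<in> isometric_part P" by (simp add: isometric_part_iff)
  qed
  note adj_pow = clinear_onD[OF closed_csubspace_UNIV bounded_op_onD(2)[OF bounded_op_on_funpow[OF
      bounded_op_on_adj_on'[OF closed_csubspace_UNIV bounded]]], simplified]
  show "0 \<in> isometric_part P" by (simp add: isometric_part_iff lin_pow)
  show "x + y \<in> isometric_part P" if "x \<in> isometric_part P" "y \<in> isometric_part P" for x y
    using that unfolding isometric_part_iff_adjoint by (simp add: lin_pow adj_pow)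
  show "c *\<^sub>C x \<in> isometric_part P" if "x \<in> isometric_part P" for c x
    using that unfolding isometric_part_iff by (simp add: lin_pow norm_scaleC)
qed

lemma isometric_part_norm: "x \<in> isometric_part P \<Longrightarrow> norm (P x) = norm x"
  unfolding isometric_part_iff by (drule spec[of _ 1]) simp

lemma isometric_part_invariant: "x \<in> isometric_part P \<Longrightarrow> P x \<in> isometric_part P"
proof -
  assume x: "x \<in> isometric_part P"
  then have "norm ((P ^^ Suc k) x) = norm x" for k unfolding isometric_part_iff by blast
  then show ?thesis unfolding isometric_part_iff isometric_part_norm[OF x] by (simp add: funpow_swap1)
qed

lemma stable_part_subspace: "closed_csubspace (stable_part P)"
  unfolding closed_csubspace_def
proof (intro conjI ballI allI)
  show "closed (stable_part P)"
    unfolding closed_sequential_limits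
  proof (intro allI impI)
    fix x l assume x: "(\<forall>j. x j \<in> stable_part P) \<and> x \<longlonglongrightarrow> l"
    have "(\<lambda>k. norm ((P ^^ k) l)) \<longlonglongrightarrow> 0"
    proof (rule LIMSEQ_I)
      fix e :: real assume e: "e > 0"
      obtain j where j: "norm (x j - l) < e / 2"
        using x e unfolding LIMSEQ_iff by (meson half_gt_zero order_refl)
      have "(\<lambda>k. norm ((P ^^ k) (x j))) \<longlonglongrightarrow> 0" using x by (simp add: stable_part_def)
      then have "\<forall>\<^sub>F k in sequentially. norm ((P ^^ k) (x j)) < e / 2"
        by (rule order_tendstoD(2)) (use e in simp)
      then obtain N where N: "\<And>k. k \<ge> N \<Longrightarrow> norm ((P ^^ k) (x j)) < e / 2"
        by (auto simp: eventually_sequentially)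
      have "norm ((P ^^ k) l) < e" if "k \<ge> N" for k
      proof -
        have "norm ((P ^^ k) l) = norm ((P ^^ k) (x j) - (P ^^ k) (x j - l))" by (simp add: lin_pow)
        also have "\<dots> \<le> norm ((P ^^ k) (x j)) + norm ((P ^^ k) (x j - l))"
          by (rule norm_triangle_ineq4)
        also have "\<dots> < e" using norm_pow_le[of k "x j - l"] N[OF that] j by simp
        finally show ?thesis .
      qed
      then show "\<exists>no. \<forall>n\<ge>no. norm (norm ((P ^^ n) l) - 0) < e" by auto
    qed
    then show "l \<in> stable_part P" by (simp add: stable_part_def)
  qed
  show "0 \<in> stable_part P" by (simp add: stable_part_def lin_pow)
  show "x + y \<in> stable_part P" if "x \<in> stable_part P" "y \<in> stable_part P" for x y
  proof -
    have "(\<lambda>k. norm ((P ^^ k) x) + norm ((P ^^ k) y)) \<longlonglongrightarrow> 0"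
      using tendsto_add[of "\<lambda>k. norm ((P ^^ k) x)" 0 _ "\<lambda>k. norm ((P ^^ k) y)" 0] that
      by (simp add: stable_part_def)
    then have "(\<lambda>k. norm ((P ^^ k) (x + y))) \<longlonglongrightarrow> 0"
      by (rule tendsto_sandwich[of "\<lambda>_. 0" _ _ _ 0, rotated 3]) (auto simp: lin_pow norm_triangle_ineq)
    then show ?thesis by (simp add: stable_part_def)
  qed
  show "c *\<^sub>C x \<in> stable_part P" if "x \<in> stable_part P" for c x
    using that tendsto_mult_right_zero[of "\<lambda>k. norm ((P ^^ k) x)" sequentially "cmod c"]
    by (simp add: stable_part_def lin_pow norm_scaleC)
qed

lemma stable_part_invariant_commuting:
  assumes S: "bounded_op_on UNIV S" and comm: "\<And>x. S (P x) = P (S x)" and x: "x \<in> stable_part P"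
  shows "S x \<in> stable_part P"
proof -
  obtain B where B: "B > 0" "\<And>x. norm (S x) \<le> B * norm x"
    using bounded_op_on_obtain_bound[OF S] by auto
  have "(P ^^ k) (S x) = S ((P ^^ k) x)" for k
    by (rule funpow_commute[of UNIV]) (auto simp: comm)
  then have "norm ((P ^^ k) (S x)) \<le> B * norm ((P ^^ k) x)" for k using B(2) by simp
  moreover have "(\<lambda>k. B * norm ((P ^^ k) x)) \<longlonglongrightarrow> 0"
    using x tendsto_mult_right_zero by (simp add: stable_part_def)
  ultimately have "(\<lambda>k. norm ((P ^^ k) (S x))) \<longlonglongrightarrow> 0"
    by (intro tendsto_sandwich[of "\<lambda>_. 0" "\<lambda>k. norm ((P ^^ k) (S x))" _ "\<lambda>k. B * norm ((P ^^ k) x)"]) auto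
  then show ?thesis by (simp add: stable_part_def)
qed

lemma isometric_part_invariant_commuting:
  assumes "\<And>x. S (P x) = P (S x)" "\<And>x. S (adj P x) = adj P (S x)" "x \<in> isometric_part P"
  shows "S x \<in> isometric_part P"
proof -
  have "(P ^^ k) (S y) = S ((P ^^ k) y)" "(adj P ^^ k) (S y) = S ((adj P ^^ k) y)" for k y
    by (rule funpow_commute[of UNIV], auto simp: assms)+
  then show ?thesis using assms(3) unfolding isometric_part_iff_adjoint by simp
qed

end

lemma middle_part_subspace: "closed_csubspace (middle_part P)"
  unfolding closed_csubspace_def
proof (intro conjI ballI allI)
  have "middle_part P = (\<Inter>y\<in>stable_part P. \<Inter>z\<in>isometric_part P. {x. cinner x (y + z) = 0})"
    by (auto simp: middle_part_def)
  moreover have "closed {x. cinner x (w::'a) = 0}" for w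
    using continuous_closed_vimage[of "{0}" "\<lambda>x. cinner x w"]
      linear_continuous_at[OF bounded_linear_cinner_left[of w]] by (simp add: vimage_def)
  ultimately show "closed (middle_part P)" by (auto intro!: closed_INT)
qed (auto simp: middle_part_def cinner_add_left cinner_scaleC_left)

lemma middle_part_invariant_adj:
  assumes S: "bounded_op_on UNIV S" and "\<And>x. x \<in> stable_part P \<Longrightarrow> S x \<in> stable_part P"
    and "\<And>x. x \<in> isometric_part P \<Longrightarrow> S x \<in> isometric_part P" and x: "x \<in> middle_part P"
  shows "adj S x \<in> middle_part P"
proof -
  have "cinner (adj S x) (y + z) = cinner x (S y + S z)" for y z
    using adj_on_props'[OF closed_csubspace_UNIV S, of "y + z" x]
      clinear_onD(1)[OF closed_csubspace_UNIV bounded_op_onD(2)[OF S]] by simp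
  then show ?thesis using assms unfolding middle_part_def by auto
qed


section \<open>Pure isometries\<close>

lemma isometry_preserves_cinner:
  fixes V :: "'a::chilbert_space \<Rightarrow> 'b::chilbert_space"
  assumes M: "closed_csubspace M" and V: "clinear_on M V" and iso: "\<And>x. x \<in> M \<Longrightarrow> norm (V x) = norm x"
    and xy: "x \<in> M" "y \<in> M"
  shows "cinner (V x) (V y) = cinner x y"
proof -
  note M' = closed_csubspaceD[OF M]
  have Re: "Re (cinner (V a) (V b)) = Re (cinner a b)" if "a \<in> M" "b \<in> M" for a b
    using power2_norm_add[of "V a" "V b"] power2_norm_add[of a b] iso[OF M'(3)[OF that]]
      iso[OF that(1)] iso[OF that(2)] clinear_onD(1)[OF M V that] by simp
  have "Re (cinner (V (\<i> *\<^sub>C x)) (V y)) = Re (cinner (\<i> *\<^sub>C x) y)" using Re M'(4) xy by blast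
  then have "Im (cinner (V x) (V y)) = Im (cinner x y)"
    using clinear_onD(2)[OF M V xy(1)] by (simp add: cinner_scaleC_left)
  then show ?thesis using Re[OF xy] by (simp add: complex_eq_iff)
qed

locale isometry_operator =
  fixes M :: "'a::chilbert_space set" and V :: "'a \<Rightarrow> 'a"
  assumes M: "closed_csubspace M" and bounded: "bounded_op_on M V"
    and isometric: "x \<in> M \<Longrightarrow> norm (V x) = norm x"
begin

abbreviation W :: "'a \<Rightarrow> 'a" where "W \<equiv> adj_on M V"

lemmas sub = closed_csubspaceD[OF M]
lemmas lin = clinear_onD[OF M bounded_op_onD(2)[OF bounded]]

lemma W_bounded: "bounded_op_on M W"
  by (rule bounded_op_on_adj_on'[OF M bounded])

lemmas W_lin = clinear_onD[OF M bounded_op_onD(2)[OF W_bounded]]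

lemma in_M: "x \<in> M \<Longrightarrow> V x \<in> M" "W y \<in> M"
  using bounded_op_onD(1)[OF bounded] adj_on_props(1)[OF M bounded] by auto

lemma pow_in_M: "x \<in> M \<Longrightarrow> (V ^^ k) x \<in> M" "x \<in> M \<Longrightarrow> (W ^^ k) x \<in> M"
  by (auto intro: funpow_in in_M)

lemma V_cinner: "x \<in> M \<Longrightarrow> cinner (V x) y = cinner x (W y)"
  by (rule adj_on_props(2)[OF M bounded])

lemma W_V: "x \<in> M \<Longrightarrow> W (V x) = x"
  by (rule adj_on_eqI[OF M])
    (auto intro: isometry_preserves_cinner[OF M bounded_op_onD(2)[OF bounded] isometric])

lemma W_pow_V_pow: "x \<in> M \<Longrightarrow> (W ^^ k) ((V ^^ k) x) = x"
proof (induct k)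
  case (Suc k)
  then show ?case using W_V[OF pow_in_M(1)[OF Suc(2), of k]] by (simp add: funpow_swap1)
qed simp

lemma norm_V_pow: "x \<in> M \<Longrightarrow> norm ((V ^^ k) x) = norm x"
  by (induct k) (auto simp: isometric pow_in_M)

lemma norm_W_le: "norm (W x) \<le> norm x"
  using bounded_op_on_adj_on(2)[OF M bounded, of 1] isometric by simp

text \<open>The projection onto the orthogonal complement of the range of \<open>V\<close>.\<close>

definition defect :: "'a \<Rightarrow> 'a" where "defect x = x - V (W x)"

lemma defect_in_M: "x \<in> M \<Longrightarrow> defect x \<in> M"
  by (simp add: defect_def sub in_M)

lemma W_defect: "x \<in> M \<Longrightarrow> W (defect x) = 0"
  by (simp add: defect_def W_lin in_M W_V)

lemma norm_defect: "x \<in> M \<Longrightarrow> (norm (defect x))\<^sup>2 = (norm x)\<^sup>2 - (norm (W x))\<^sup>2"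
proof -
  assume x: "x \<in> M"
  have "Re (cinner x (V (W x))) = Re (cinner (V (W x)) x)"
    by (metis cinner_commute complex_cnj(1) complex_surj complex.sel(1))
  also have "\<dots> = (norm (W x))\<^sup>2" by (simp add: V_cinner in_M cinner_self)
  finally show ?thesis by (simp add: defect_def power2_norm_diff isometric in_M)
qed

lemma range_projection_absorb:
  assumes "j \<le> k" "x \<in> M"
  shows "(V ^^ j) ((W ^^ j) ((V ^^ k) x)) = (V ^^ k) x"
proof -
  obtain i where k: "k = j + i" using le_Suc_ex[OF assms(1)] by blast
  show ?thesis unfolding k funpow_add comp_apply
    by (simp add: W_pow_V_pow pow_in_M assms(2))
qed

text \<open>The projections \<open>V\<^sup>k W\<^sup>k\<close> onto the ranges of the powers of \<open>V\<close> decrease, so they converge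
  strongly; the limit lies in all these ranges.\<close>

lemma pure_isometry_adjoint_powers:
  assumes pure: "\<And>x. x \<in> M \<Longrightarrow> (\<And>k. (V ^^ k) ((W ^^ k) x) = x) \<Longrightarrow> x = 0" and x: "x \<in> M"
  shows "(\<lambda>k. norm ((W ^^ k) x)) \<longlonglongrightarrow> 0"
proof -
  define Q where "Q k = (V ^^ k) ((W ^^ k) x)" for k
  define a where "a k = (norm ((W ^^ k) x))\<^sup>2" for k
  have QM: "Q k \<in> M" for k by (simp add: Q_def pow_in_M x)
  have nQ: "norm (Q k) = norm ((W ^^ k) x)" for k by (simp add: Q_def norm_V_pow pow_in_M x)
  have pow_cinner: "cinner ((V ^^ k) u) v = cinner u ((W ^^ k) v)" if "u \<in> M" for u v k
    using that by (induct k arbitrary: u) (auto simp: funpow_swap1 V_cinner in_M pow_in_M)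
  have dist: "(norm (Q k - Q m))\<^sup>2 = a k - a m" if km: "k \<le> m" for k m
  proof -
    obtain i where m: "m = k + i" using le_Suc_ex[OF km] by blast
    have "cinner (Q k) (Q m) = cinner ((W ^^ k) x) ((W ^^ k) (Q m))"
      unfolding Q_def by (rule pow_cinner[OF pow_in_M(2)[OF x]])
    also have "(W ^^ k) (Q m) = (V ^^ i) ((W ^^ m) x)"
      unfolding Q_def m funpow_add comp_apply by (simp add: W_pow_V_pow pow_in_M x)
    also have "cinner ((W ^^ k) x) ((V ^^ i) ((W ^^ m) x)) = cnj (cinner ((W ^^ m) x) ((W ^^ i) ((W ^^ k) x)))"
      by (subst cinner_commute) (simp add: pow_cinner pow_in_M x)
    also have "(W ^^ i) ((W ^^ k) x) = (W ^^ m) x"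
      unfolding m by (metis add.commute comp_apply funpow_add)
    finally have "Re (cinner (Q k) (Q m)) = a m" by (simp add: cinner_self a_def)
    then show ?thesis by (simp add: power2_norm_diff nQ a_def)
  qed
  have "decseq a" unfolding a_def
    by (intro decseq_SucI power_mono) (auto simp: norm_W_le)
  then obtain L where "a \<longlonglongrightarrow> L"
    by (rule decseq_convergent[of a 0]) (simp add: a_def)
  then have "Cauchy a" by (rule LIMSEQ_imp_Cauchy)
  have "Cauchy Q"
  proof (rule metric_CauchyI)
    fix e :: real assume e: "e > 0"
    obtain N where N: "\<And>m k. m \<ge> N \<Longrightarrow> k \<ge> N \<Longrightarrow> dist (a m) (a k) < e\<^sup>2"
      using metric_CauchyD[OF \<open>Cauchy a\<close>, of "e\<^sup>2"] e by auto
    have "dist (Q k) (Q m) < e" if "k \<ge> N" "m \<ge> N" for k m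
    proof -
      have "(norm (Q k - Q m))\<^sup>2 < e\<^sup>2"
      proof (cases "k \<le> m")
        case True
        then show ?thesis using dist[OF True] N[OF that] by (simp add: dist_real_def abs_if split: if_splits)
      next
        case False
        then show ?thesis using dist[of m k] N[OF that(2,1)]
          by (simp add: norm_minus_commute[of "Q k"] dist_real_def abs_if split: if_splits)
      qed
      then show ?thesis using e by (simp add: dist_norm power2_less_imp_less)
    qed
    then show "\<exists>N. \<forall>m\<ge>N. \<forall>n\<ge>N. dist (Q m) (Q n) < e" by blast
  qed
  then obtain y where y: "Q \<longlonglongrightarrow> y" using Cauchy_convergent_iff convergent_def by blast
  have yM: "y \<in> M" using closed_sequentially[OF sub(1) _ y] QM by blast
  have "(V ^^ j) ((W ^^ j) y) = y" for j
  proof (rule LIMSEQ_unique)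
    show "(\<lambda>k. (V ^^ j) ((W ^^ j) (Q (k + j)))) \<longlonglongrightarrow> (V ^^ j) ((W ^^ j) y)"
      by (intro bounded_op_on_tendsto[OF M bounded_op_on_comp[OF bounded_op_on_funpow[OF bounded] bounded_op_on_funpow[OF W_bounded]]]
          QM LIMSEQ_ignore_initial_segment y)
    have "(V ^^ j) ((W ^^ j) (Q (k + j))) = Q (k + j)" for k
      unfolding Q_def by (rule range_projection_absorb) (auto simp: pow_in_M x)
    then show "(\<lambda>k. (V ^^ j) ((W ^^ j) (Q (k + j)))) \<longlonglongrightarrow> y"
      using LIMSEQ_ignore_initial_segment[OF y] by simp
  qed
  then have "y = 0" using pure yM by blast
  then show ?thesis using tendsto_norm[OF y] by (simp add: nQ)
qed

text \<open>The components of \<open>x\<close> in the Wold decomposition of a pure isometry: the squared norms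
  \<open>\<parallel>W\<^sup>k x\<parallel>\<^sup>2 - \<parallel>W\<^sup>k\<^sup>+\<^sup>1 x\<parallel>\<^sup>2\<close> telescope.\<close>

lemma pure_isometry_norm_sums:
  assumes "(\<lambda>k. norm ((W ^^ k) x)) \<longlonglongrightarrow> 0" "x \<in> M"
  shows "(\<lambda>k. (norm (defect ((W ^^ k) x)))\<^sup>2) sums (norm x)\<^sup>2"
proof -
  have "(\<lambda>k. (norm ((W ^^ k) x))\<^sup>2) \<longlonglongrightarrow> 0\<^sup>2" by (intro tendsto_intros assms(1))
  then have "(\<lambda>k. (norm ((W ^^ k) x))\<^sup>2 - (norm ((W ^^ Suc k) x))\<^sup>2) sums ((norm ((W ^^ 0) x))\<^sup>2 - 0\<^sup>2)"
    by (rule telescope_sums')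
  then show ?thesis using assms(2) by (simp add: norm_defect pow_in_M)
qed

subsection \<open>Approximate eigenvectors\<close>

definition wandering :: "'a set" where "wandering = {e \<in> M. W e = 0}"

lemma wandering_subspace: "closed_csubspace wandering"
  unfolding closed_csubspace_def
proof (intro conjI ballI allI)
  show "closed wandering"
    unfolding closed_sequential_limits
  proof (intro allI impI)
    fix x l assume x: "(\<forall>j. x j \<in> wandering) \<and> x \<longlonglongrightarrow> l"
    then have xM: "\<And>j. x j \<in> M" by (simp add: wandering_def)
    have l: "l \<in> M" using closed_sequentially[OF sub(1)] xM x by blast
    have "(\<lambda>j. W (x j)) \<longlonglongrightarrow> W l"
      using x xM by (intro bounded_op_on_tendsto[OF M W_bounded]) auto
    then have "W l = 0" using x by (simp add: wandering_def LIMSEQ_const_iff)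
    then show "l \<in> wandering" using l by (simp add: wandering_def)
  qed
qed (auto simp: wandering_def sub W_lin)

text \<open>The vector \<open>\<Sum>j<m. c\<^sup>j V\<^sup>j f\<close>. If \<open>f\<close> is wandering and \<open>\<bar>c\<bar> = 1\<close>, its norm is \<open>\<surd>m \<parallel>f\<parallel>\<close>, while
  \<open>c V\<close> moves it by at most \<open>2 \<parallel>f\<parallel>\<close>: a unit multiple is an approximate eigenvector of \<open>V\<close> for the
  eigenvalue \<open>cnj c\<close>.\<close>

primrec orbit_sum :: "complex \<Rightarrow> 'a \<Rightarrow> nat \<Rightarrow> 'a" where
  "orbit_sum c f 0 = 0"
| "orbit_sum c f (Suc m) = f + c *\<^sub>C V (orbit_sum c f m)"

lemma orbit_sum_in_M: "f \<in> M \<Longrightarrow> orbit_sum c f m \<in> M"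
  by (induct m) (auto simp: sub in_M)

lemma norm_orbit_sum:
  assumes f: "f \<in> wandering" and c: "cmod c = 1"
  shows "(norm (orbit_sum c f m))\<^sup>2 = real m * (norm f)\<^sup>2"
proof (induct m)
  case (Suc m)
  have fM: "f \<in> M" using f by (simp add: wandering_def)
  let ?u = "orbit_sum c f m"
  have "cinner (V ?u) f = 0"
    using f by (simp add: V_cinner orbit_sum_in_M[OF fM] wandering_def)
  then have "cinner f (V ?u) = 0" by (metis cinner_commute complex_cnj_zero)
  then have "(norm (f + c *\<^sub>C V ?u))\<^sup>2 = (norm f)\<^sup>2 + (norm ?u)\<^sup>2"
    by (simp add: power2_norm_add cinner_scaleC_right norm_scaleC c isometric orbit_sum_in_M[OF fM])
  then show ?case using Suc by (simp add: algebra_simps)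
qed simp

lemma orbit_sum_almost_eigen:
  assumes f: "f \<in> M" and c: "cmod c = 1"
  shows "norm (c *\<^sub>C V (orbit_sum c f m) - orbit_sum c f m) \<le> 2 * norm f"
proof -
  let ?u = "orbit_sum c f"
  have "norm (c *\<^sub>C V (?u m) - ?u m + f) = norm f"
  proof (induct m)
    case (Suc m)
    have u: "?u m \<in> M" "V (?u m) \<in> M" "c *\<^sub>C V (?u m) \<in> M"
      using orbit_sum_in_M[OF f] in_M sub by auto
    have "c *\<^sub>C V (?u (Suc m)) - ?u (Suc m) + f = c *\<^sub>C V (c *\<^sub>C V (?u m) - ?u m + f)"
      using u f by (simp add: lin sub scaleC_add_right scaleC_diff_right)
    then show ?case using u f Suc by (simp add: norm_scaleC c isometric sub)
  qed (simp add: lin)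
  then show ?thesis using norm_triangle_ineq4[of "c *\<^sub>C V (?u m) - ?u m + f" f] by simp
qed

lemma orbit_sum_commute:
  assumes G: "clinear_on M G" "\<And>x. x \<in> M \<Longrightarrow> G x \<in> M" "\<And>x. x \<in> M \<Longrightarrow> G (V x) = V (G x)" and f: "f \<in> M"
  shows "G (orbit_sum c f m) = orbit_sum c (G f) m"
proof (induct m)
  case 0
  then show ?case using clinear_onD(3)[OF M G(1)] by simp
next
  case (Suc m)
  then show ?case
    using f orbit_sum_in_M[OF f] in_M sub by (simp add: clinear_onD(1,2)[OF M G(1)] G(3))
qed

lemma averaged_power_orbit_sum:
  assumes f: "f \<in> M" and c: "cmod c = 1"
  shows "norm (((\<lambda>y. (1/2) *\<^sub>C (y + c *\<^sub>C V y)) ^^ N) (orbit_sum c f m) - orbit_sum c f m) \<le> real N * norm f"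
proof -
  let ?K = "\<lambda>y. (1/2) *\<^sub>C (y + c *\<^sub>C V y)" and ?u = "orbit_sum c f m"
  have u: "?u \<in> M" by (rule orbit_sum_in_M[OF f])
  have KM: "?K y \<in> M" if "y \<in> M" for y using that by (simp add: sub in_M)
  have Kle: "norm (?K y) \<le> norm y" if "y \<in> M" for y
    using norm_triangle_ineq[of y "c *\<^sub>C V y"] that by (simp add: norm_scaleC norm_divide c isometric)
  have Ku: "norm (?K ?u - ?u) \<le> norm f"
  proof -
    have half: "(1/2) *\<^sub>C ?u + (1/2) *\<^sub>C ?u = ?u" by (simp flip: scaleC_add_left)
    have "?K ?u - ((1/2) *\<^sub>C ?u + (1/2) *\<^sub>C ?u) = (1/2) *\<^sub>C (c *\<^sub>C V ?u - ?u)"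
      by (simp add: scaleC_add_right scaleC_diff_right)
    then have "?K ?u - ?u = (1/2) *\<^sub>C (c *\<^sub>C V ?u - ?u)" unfolding half .
    then have "norm (?K ?u - ?u) = norm (c *\<^sub>C V ?u - ?u) / 2" by (simp add: norm_scaleC norm_divide)
    then show ?thesis using orbit_sum_almost_eigen[OF f c, of m] by simp
  qed
  show ?thesis
  proof (induct N)
    case (Suc N)
    have p: "(?K ^^ N) ?u \<in> M" by (rule funpow_in[OF KM u])
    have eq: "(?K ^^ Suc N) ?u - ?u = ?K ((?K ^^ N) ?u - ?u) + (?K ?u - ?u)"
      using p u by (simp add: lin scaleC_diff_right scaleC_add_right algebra_simps)
    have "norm ((?K ^^ Suc N) ?u - ?u) \<le> norm ((?K ^^ N) ?u - ?u) + norm f"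
      unfolding eq by (rule order_trans[OF norm_triangle_ineq add_mono[OF Kle Ku]]) (simp add: sub p u)
    then have "norm ((?K ^^ Suc N) ?u - ?u) \<le> real N * norm f + norm f" using Suc by linarith
    then show ?case unfolding of_nat_Suc distrib_right by simp
  qed simp
qed

end

text \<open>Polarization in a complex space: expand the form at \<open>x + A x\<close> and at \<open>x + \<i> A x\<close>.\<close>

lemma cinner_diagonal_zero:
  assumes E: "closed_csubspace E" and A: "clinear_on E A" "\<And>x. x \<in> E \<Longrightarrow> A x \<in> E"
    and diag: "\<And>x. x \<in> E \<Longrightarrow> cinner x (A x) = 0" and x: "x \<in> E"
  shows "A x = 0"
proof -
  note E' = closed_csubspaceD[OF E]
  have s: "cinner a (A b) + cinner b (A a) = 0" if "a \<in> E" "b \<in> E" for a b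
    using diag[OF E'(3)[OF that]] diag[OF that(1)] diag[OF that(2)] clinear_onD(1)[OF E A(1) that]
    by (simp add: cinner_add_left cinner_add_right add.commute)
  define y where "y = A x"
  have y: "y \<in> E" by (simp add: y_def A(2) x)
  have "cinner x (A y) + cinner y (A x) = 0" by (rule s[OF x y])
  moreover have "- \<i> * cinner x (A y) + \<i> * cinner y (A x) = 0"
    using s[OF x E'(4)[OF y, of \<i>]] clinear_onD(2)[OF E A(1) y]
    by (simp add: cinner_scaleC_left cinner_scaleC_right)
  ultimately have "cinner y (A x) = 0" by (simp add: complex_eq_iff)
  then show ?thesis by (simp add: y_def)
qed

section \<open>Tuples that commute with the adjoint of a pure isometry\<close>

text \<open>For unimodular \<open>\<zeta>\<close>, on the slice \<open>s\<^sub>n = \<zeta>\<^sup>2\<close> of \<open>\<Gamma>\<^sub>n\<close> the second summand is the conjugate of the first, so the value is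
  \<open>2 Re (cnj \<zeta> \<omega> s\<^sub>i)\<close>.\<close>

definition slice_poly :: "nat \<Rightarrow> nat \<Rightarrow> complex \<Rightarrow> complex \<Rightarrow> (nat \<Rightarrow>\<^sub>0 nat) \<Rightarrow>\<^sub>0 complex" where
  "slice_poly n i \<zeta> \<omega> =
     poly_const (cnj \<zeta>) * (poly_const \<omega> * poly_var i + poly_const (cnj \<omega>) * poly_var (n - i))"

text \<open>For unimodular \<open>\<zeta>\<close>, its modulus on \<open>\<Gamma>\<^sub>n\<close> is 1 on the slice \<open>s\<^sub>n = \<zeta>\<^sup>2\<close> and smaller elsewhere.\<close>

definition peak_poly :: "nat \<Rightarrow> complex \<Rightarrow> (nat \<Rightarrow>\<^sub>0 nat) \<Rightarrow>\<^sub>0 complex" where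
  "peak_poly n \<zeta> = poly_const (1/2) * (1 + poly_const ((cnj \<zeta>)\<^sup>2) * poly_var n)"

lemma slice_poly_in: "i \<in> {1..n-1} \<Longrightarrow> slice_poly n i \<zeta> \<omega> \<in> polys n"
  unfolding slice_poly_def by (intro polys_mult polys_add polys_const polys_var) auto

lemma peak_poly_in: "n \<ge> 1 \<Longrightarrow> peak_poly n \<zeta> \<in> polys n"
  unfolding peak_poly_def by (intro polys_mult polys_add polys_const polys_var polys_one) auto

lemma unimodular_cnj: "cmod \<zeta> = 1 \<Longrightarrow> cnj \<zeta> * \<zeta> = 1"
  by (metis complex_norm_square mult.commute of_real_1 power_one)

lemma slice_poly_real:
  assumes w: "w \<in> Gamma n" and z: "cmod \<zeta> = 1" and wn: "w n = \<zeta>\<^sup>2" and i: "i \<in> {1..n-1}"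
  shows "Im (poly_at n (slice_poly n i \<zeta> \<omega>) w) = 0"
proof -
  have "w (n - i) = cnj (w i) * \<zeta>\<^sup>2"
    using Gamma_unimodular_last[OF w _ i] wn z by (simp add: norm_power)
  then have "poly_at n (slice_poly n i \<zeta> \<omega>) w
      = cnj \<zeta> * \<omega> * w i + (cnj \<zeta> * \<zeta>) * (\<zeta> * cnj \<omega> * cnj (w i))"
    using i by (auto simp: slice_poly_def poly_at_mult poly_at_add algebra_simps power2_eq_square)
  also have "\<dots> = cnj \<zeta> * \<omega> * w i + cnj (cnj \<zeta> * \<omega> * w i)"
    by (simp add: unimodular_cnj[OF z])
  also have "\<dots> = complex_of_real (2 * Re (cnj \<zeta> * \<omega> * w i))" by (rule complex_add_cnj)
  finally show ?thesis by (simp only: Im_complex_of_real)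
qed

lemma peak_poly_at: "n \<ge> 1 \<Longrightarrow> poly_at n (peak_poly n \<zeta>) w = (1 + (cnj \<zeta>)\<^sup>2 * w n) / 2"
  by (simp add: peak_poly_def poly_at_mult poly_at_add)

lemma peak_poly_le:
  assumes "n \<ge> 1" "w \<in> Gamma n" "cmod \<zeta> = 1"
  shows "cmod (poly_at n (peak_poly n \<zeta>) w) \<le> 1"
proof -
  have "cmod (1 + (cnj \<zeta>)\<^sup>2 * w n) \<le> 1 + 1"
    using Gamma_last_le[OF assms(2)] assms(3)
    by (intro norm_triangle_le add_mono) (auto simp: norm_mult norm_power)
  then show ?thesis using assms(1) by (simp add: peak_poly_at norm_divide)
qed

lemma peak_poly_eq:
  assumes n: "n \<ge> 1" and w: "w \<in> Gamma n" and z: "cmod \<zeta> = 1"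
    and eq: "cmod (poly_at n (peak_poly n \<zeta>) w) = 1"
  shows "w n = \<zeta>\<^sup>2"
proof -
  define a where "a = (cnj \<zeta>)\<^sup>2 * w n"
  have "cmod (1 + a) = 2" using eq n by (simp add: peak_poly_at norm_divide a_def)
  then have "(cmod (1 + a))\<^sup>2 = 4" by simp
  then have s: "(1 + Re a)\<^sup>2 + (Im a)\<^sup>2 = 4" by (simp add: cmod_power2)
  have "cmod a \<le> 1" using Gamma_last_le[OF w] z by (simp add: a_def norm_mult norm_power)
  then have "(cmod a)\<^sup>2 \<le> 1" by (simp add: power_le_one)
  then have b: "(Re a)\<^sup>2 + (Im a)\<^sup>2 \<le> 1" by (simp add: cmod_power2)
  have "(1 + Re a)\<^sup>2 = 1 + 2 * Re a + (Re a)\<^sup>2" by (simp add: power2_eq_square algebra_simps)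
  then have re: "Re a \<ge> 1" using s b by linarith
  then have "(Re a)\<^sup>2 \<ge> 1" by (simp add: one_le_power)
  then have "(Im a)\<^sup>2 = 0" and "(Re a)\<^sup>2 = 1" using b zero_le_power2[of "Im a"] by linarith+
  then have "Im a = 0" "Re a = 1" using re by (auto simp: power2_eq_1_iff)
  then have "a = 1" by (simp add: complex_eq_iff)
  then have "\<zeta>\<^sup>2 = (cnj \<zeta> * \<zeta>)\<^sup>2 * w n" by (simp add: a_def power_mult_distrib mult_ac)
  then show ?thesis by (simp add: unimodular_cnj[OF z])
qed

text \<open>Multiplying by high powers of the peak polynomial localizes the supremum to the slice
  \<open>w\<^sub>n = \<zeta>\<^sup>2\<close>, where the slice polynomial is real (an argument as for Dini's theorem).\<close>

lemma slice_bound: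
  assumes compact: "compact (Gamma n)" and i: "i \<in> {1..n-1}" and z: "cmod \<zeta> = 1"
    and C: "\<And>w. w \<in> Gamma n \<Longrightarrow> cmod (poly_at n (slice_poly n i \<zeta> \<omega>) w) \<le> C" and e: "e > 0"
  shows "\<exists>N. \<forall>w\<in>Gamma n. cmod (poly_at n (peak_poly n \<zeta> ^ N * (1 + poly_const (\<i> * complex_of_real t) * slice_poly n i \<zeta> \<omega>)) w)
    \<le> sqrt (1 + t\<^sup>2 * C\<^sup>2) + e"
proof -
  define g where "g = poly_at n (slice_poly n i \<zeta> \<omega>)"
  define k where "k = poly_at n (peak_poly n \<zeta>)"
  define h where "h N w = cmod (k w) ^ N * cmod (1 + \<i> * complex_of_real t * g w)" for N w
  define L where "L = sqrt (1 + t\<^sup>2 * C\<^sup>2)"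
  have n: "n \<ge> 1" using i by auto
  have h_eq: "cmod (poly_at n (peak_poly n \<zeta> ^ N * (1 + poly_const (\<i> * complex_of_real t) * slice_poly n i \<zeta> \<omega>)) w) = h N w" for N w
    by (simp add: h_def k_def g_def poly_at_mult poly_at_add poly_at_power norm_mult norm_power)
  have open_h: "open {w. h N w < L + e}" for N
  proof -
    have "continuous_on UNIV (h N)"
      unfolding h_def[abs_def] k_def g_def by (intro continuous_intros continuous_on_poly_at)
    then show ?thesis by (intro open_Collect_less continuous_on_const)
  qed
  have "\<exists>N. h N w < L + e" if w: "w \<in> Gamma n" for w
  proof (cases "cmod (k w) = 1")
    case True
    then have wn: "w n = \<zeta>\<^sup>2" using peak_poly_eq[OF n w z] by (simp add: k_def)
    have "Im (g w) = 0" unfolding g_def by (rule slice_poly_real[OF w z wn i])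
    then have gr: "g w = complex_of_real (Re (g w))" by (simp add: complex_eq_iff)
    have "(cmod (1 + \<i> * complex_of_real t * g w))\<^sup>2 = 1 + t\<^sup>2 * (Re (g w))\<^sup>2"
      by (subst gr) (simp add: cmod_power2 power_mult_distrib)
    moreover have "(Re (g w))\<^sup>2 \<le> C\<^sup>2"
      using C[OF w] abs_Re_le_cmod[of "g w"] unfolding g_def[symmetric]
      by (intro power2_le_iff_abs_le[THEN iffD2]) auto
    ultimately have "(cmod (1 + \<i> * complex_of_real t * g w))\<^sup>2 \<le> 1 + t\<^sup>2 * C\<^sup>2"
      by (simp add: mult_left_mono)
    then have "cmod (1 + \<i> * complex_of_real t * g w) \<le> L" unfolding L_def by (rule real_le_rsqrt)
    then show ?thesis using e by (intro exI[of _ 0]) (simp add: h_def)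
  next
    case False
    then have "cmod (k w) < 1" using peak_poly_le[OF n w z] by (simp add: k_def)
    then have "(\<lambda>N. cmod (k w) ^ N * cmod (1 + \<i> * complex_of_real t * g w)) \<longlonglongrightarrow> 0 * cmod (1 + \<i> * complex_of_real t * g w)"
      by (intro tendsto_mult LIMSEQ_power_zero tendsto_const) simp
    then have "(\<lambda>N. h N w) \<longlonglongrightarrow> 0" by (simp add: h_def)
    moreover have "0 < L + e" using e by (simp add: L_def add_nonneg_pos)
    ultimately have "\<forall>\<^sub>F N in sequentially. h N w < L + e" by (rule order_tendstoD(2))
    then show ?thesis by (auto simp: eventually_sequentially)
  qed
  then have cover: "Gamma n \<subseteq> (\<Union>N\<in>UNIV. {w. h N w < L + e})" by auto
  from compactE_image[OF compact open_h cover] obtain A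
    where A: "finite A" "Gamma n \<subseteq> (\<Union>N\<in>A. {w. h N w < L + e})" by metis
  have "h (Max (insert 0 A)) w \<le> L + e" if w: "w \<in> Gamma n" for w
  proof -
    obtain N where N: "N \<in> A" "h N w < L + e" using A(2) w by auto
    have "N \<le> Max (insert 0 A)" using A(1) N(1) by (intro Max_ge) auto
    then have "cmod (k w) ^ Max (insert 0 A) \<le> cmod (k w) ^ N"
      using peak_poly_le[OF n w z] by (intro power_decreasing) (auto simp: k_def)
    then have "h (Max (insert 0 A)) w \<le> h N w" unfolding h_def by (intro mult_right_mono) auto
    then show ?thesis using N(2) by simp
  qed
  then show ?thesis unfolding h_eq L_def by blast
qed

lemma linear_below_quadratic:
  fixes a b :: real
  assumes "\<And>t. t * a \<le> t\<^sup>2 * b" "b \<ge> 0"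
  shows "a = 0"
proof -
  \<comment> \<open>the choice \<open>t = a / (b + 1)\<close> gives \<open>a\<^sup>2 (b + 1) \<le> a\<^sup>2 b\<close>\<close>
  define c where "c = b + 1"
  have c: "c > 0" using assms(2) by (simp add: c_def)
  have "a / c * a \<le> (a / c)\<^sup>2 * b" by (rule assms(1))
  then have "(a / c * a) * c\<^sup>2 \<le> ((a / c)\<^sup>2 * b) * c\<^sup>2" by (rule mult_right_mono) simp
  moreover have "(a / c * a) * c\<^sup>2 = a\<^sup>2 * c" "((a / c)\<^sup>2 * b) * c\<^sup>2 = a\<^sup>2 * b"
    using c by (simp_all add: power2_eq_square)
  ultimately have "a\<^sup>2 * c \<le> a\<^sup>2 * b" by (simp only:)
  then have "a\<^sup>2 * (b + 1) \<le> a\<^sup>2 * b" unfolding c_def .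
  then have "a\<^sup>2 \<le> 0" by (simp add: algebra_simps)
  then show ?thesis by simp
qed

text \<open>On the slice the polynomial \<open>1 + \<i> t g\<close>, with \<open>g\<close> real, has modulus at most \<open>\<surd>(1 + t\<^sup>2 C\<^sup>2)\<close>; a factor
  \<open>k\<^sup>N\<close>, with \<open>k\<close> the peak polynomial, makes this bound valid on \<open>\<Gamma>\<^sub>n\<close> up to a small error. The estimate
  for the operator \<open>k(T)\<^sup>N (1 + \<i> t g(T))\<close> is applied to a long orbit sum of \<open>e\<close>: the first factor almost
  fixes orbit sums, and the second maps that of \<open>e\<close> to that of \<open>(1 + \<i> t g(T)) e\<close>.\<close>

lemma wandering_slice_bound:
  assumes T: "Gamma_contraction n M T" and iso: "isometry_operator M (T n)" and i: "i \<in> {1..n-1}"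
    and W: "\<And>j x. j \<in> {1..n-1} \<Longrightarrow> x \<in> M \<Longrightarrow> adj_on M (T n) (T j x) = T j (adj_on M (T n) x)"
    and e: "e \<in> isometry_operator.wandering M (T n)" and z: "cmod \<zeta> = 1"
    and C: "\<And>w. w \<in> Gamma n \<Longrightarrow> cmod (poly_at n (slice_poly n i \<zeta> \<omega>) w) \<le> C"
  shows "norm (e + (\<i> * complex_of_real t) *\<^sub>C poly_op n (slice_poly n i \<zeta> \<omega>) T e) \<le> sqrt (1 + t\<^sup>2 * C\<^sup>2) * norm e"
proof -
  interpret isometry_operator M "T n" by (rule iso)
  note T' = Gamma_contractionD[OF T]
  let ?c = "(cnj \<zeta>)\<^sup>2" and ?A = "1 + poly_const (\<i> * complex_of_real t) * slice_poly n i \<zeta> \<omega>"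
  let ?K = "\<lambda>y. (1/2) *\<^sub>C (y + ?c *\<^sub>C T n y)"
  define f where "f = e + (\<i> * complex_of_real t) *\<^sub>C poly_op n (slice_poly n i \<zeta> \<omega>) T e"
  have n: "n \<ge> 1" "n \<in> {1..n}" and i': "i \<in> {1..n}" "n - i \<in> {1..n}" "n - i \<in> {1..n-1}" using i by auto
  have eM: "e \<in> M" and We: "W e = 0" using e by (auto simp: wandering_def)
  have c1: "cmod ?c = 1" using z by (simp add: norm_power)
  have A_in: "?A \<in> polys n" by (intro polys_add polys_one polys_mult polys_const slice_poly_in i)
  have b: "bounded_op_on M (poly_op n p T)" for p by (rule poly_op_bounded[OF T'(1)])
  have TM: "T j x \<in> M" if "j \<in> {1..n}" "x \<in> M" for j x
    using that bounded_op_onD(1)[OF commuting_tupleD(2)[OF T'(1)]] by blast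
  have slice_op: "poly_op n (slice_poly n i \<zeta> \<omega>) T x = cnj \<zeta> *\<^sub>C (\<omega> *\<^sub>C T i x + cnj \<omega> *\<^sub>C T (n - i) x)"
    if "x \<in> M" for x
    using that i' by (simp add: slice_poly_def poly_op_mult[OF T'(1)] poly_op_add)
  have Af: "poly_op n ?A T e = f"
    using eM by (simp add: f_def poly_op_add poly_op_mult[OF T'(1)])
  have T_wandering: "T j e \<in> wandering" if "j \<in> {1..n-1}" for j
    using that TM[of j e] eM W[OF that eM] We clinear_onD(3)[OF M bounded_op_onD(2)[OF commuting_tupleD(2)[OF T'(1)]], of j]
    by (auto simp: wandering_def)
  have fE: "f \<in> wandering"
    unfolding f_def slice_op[OF eM] using T_wandering[OF i] T_wandering[OF i'(3)] e closed_csubspaceD(3,4)[OF wandering_subspace]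
    by simp
  have fM: "f \<in> M" using fE by (simp add: wandering_def)
  have peak: "poly_op n (peak_poly n \<zeta>) T x = ?K x" if "x \<in> M" for x
    using that n by (simp add: peak_poly_def poly_op_mult[OF T'(1)] poly_op_add)
  have peak_pow: "(poly_op n (peak_poly n \<zeta>) T ^^ N) x = (?K ^^ N) x" if "x \<in> M" for x N
  proof (induct N)
    case (Suc N)
    have "(?K ^^ N) x \<in> M" by (rule funpow_in[OF _ that]) (simp add: sub in_M)
    then show ?case using Suc peak by simp
  qed simp
  have bound_eps: "norm f \<le> (sqrt (1 + t\<^sup>2 * C\<^sup>2) + d) * norm e" if d: "d > 0" for d
  proof (rule ccontr)
    define B where "B = sqrt (1 + t\<^sup>2 * C\<^sup>2) + d"
    assume "\<not> norm f \<le> (sqrt (1 + t\<^sup>2 * C\<^sup>2) + d) * norm e"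
    then have pos: "0 < norm f - B * norm e" by (simp add: B_def)
    obtain N where N: "\<And>w. w \<in> Gamma n \<Longrightarrow> cmod (poly_at n (peak_poly n \<zeta> ^ N * ?A) w) \<le> B"
      using slice_bound[OF T'(2) i z C d, of t] unfolding B_def by blast
    have main: "real m * (norm f - B * norm e) \<le> real N * norm f" for m
    proof -
      \<comment> \<open>\<open>m\<^sup>2\<close> summands, so that norms are multiplied by \<open>m\<close>\<close>
      let ?u = "\<lambda>x. orbit_sum ?c x (m\<^sup>2)"
      have norm_u: "norm (?u x) = real m * norm x" if "x \<in> wandering" for x
      proof -
        have "(norm (?u x))\<^sup>2 = (real m * norm x)\<^sup>2"
          using norm_orbit_sum[OF that c1, of "m\<^sup>2"] by (simp add: power_mult_distrib)
        then show ?thesis by (simp add: power2_eq_iff_nonneg)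
      qed
      have uM: "?u e \<in> M" by (rule orbit_sum_in_M[OF eM])
      have "poly_op n ?A T (?u e) = ?u (poly_op n ?A T e)"
        using poly_op_commute_var[OF T'(1) A_in n(2)]
        by (intro orbit_sum_commute bounded_op_onD[OF b] eM) auto
      then have "poly_op n (peak_poly n \<zeta> ^ N * ?A) T (?u e) = (?K ^^ N) (?u f)"
        unfolding poly_op_mult[OF T'(1) uM] Af
        by (simp add: poly_op_power[OF T'(1)] peak_pow orbit_sum_in_M[OF fM])
      then have up: "norm ((?K ^^ N) (?u f)) \<le> B * (real m * norm e)"
        using Gamma_poly_boundedD[OF T'(3) _ N uM] peak_poly_in[OF n(1)] A_in norm_u[OF e]
        by (simp add: polys_mult polys_power)
      have "real m * norm f \<le> norm ((?K ^^ N) (?u f)) + real N * norm f"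
        using norm_triangle_ineq4[of "(?K ^^ N) (?u f)" "(?K ^^ N) (?u f) - ?u f"]
          averaged_power_orbit_sum[OF fM c1, of N "m\<^sup>2"] norm_u[OF fE] by simp
      then show ?thesis using up by (simp add: algebra_simps)
    qed
    obtain m :: nat where "real N * norm f < real m * (norm f - B * norm e)"
      using reals_Archimedean3[OF pos] by blast
    then show False using main[of m] by simp
  qed
  have "norm f \<le> sqrt (1 + t\<^sup>2 * C\<^sup>2) * norm e + d" if d: "d > 0" for d
  proof -
    have p: "0 < norm e + 1" using norm_ge_zero[of e] by linarith
    then have "d / (norm e + 1) * norm e \<le> d"
      using d by (simp add: pos_divide_le_eq distrib_left)
    moreover have "norm f \<le> (sqrt (1 + t\<^sup>2 * C\<^sup>2) + d / (norm e + 1)) * norm e"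
      by (rule bound_eps) (use d p in simp)
    ultimately show ?thesis by (simp add: distrib_right)
  qed
  then show ?thesis unfolding f_def[symmetric] by (rule field_le_epsilon)
qed

text \<open>Letting \<open>t\<close> tend to 0 in the slice bound, from both sides, shows that \<open>g(T)\<close> has a real quadratic
  form on the wandering subspace, for all unimodular \<open>\<zeta>\<close> and \<open>\<omega>\<close>. Since \<open>\<zeta>\<close> only enters as a factor of
  the form, the form of \<open>\<omega> T\<^sub>i + cnj \<omega> T\<^sub>n\<^sub>-\<^sub>i\<close> vanishes for all \<open>\<omega>\<close>, and so does that of \<open>T\<^sub>i\<close>.\<close>

lemma wandering_vanish:
  assumes T: "Gamma_contraction n M T" and iso: "isometry_operator M (T n)" and i: "i \<in> {1..n-1}"
    and W: "\<And>j x. j \<in> {1..n-1} \<Longrightarrow> x \<in> M \<Longrightarrow> adj_on M (T n) (T j x) = T j (adj_on M (T n) x)"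
    and e: "e \<in> isometry_operator.wandering M (T n)"
  shows "T i e = 0"
proof -
  interpret isometry_operator M "T n" by (rule iso)
  note T' = Gamma_contractionD[OF T]
  have i': "i \<in> {1..n}" "n - i \<in> {1..n}" "n - i \<in> {1..n-1}" using i by auto
  have self_adjoint: "Im (\<zeta> * (cnj \<omega> * cinner x (T i x) + \<omega> * cinner x (T (n - i) x))) = 0"
    if x: "x \<in> wandering" and z: "cmod \<zeta> = 1" for x \<zeta> \<omega>
  proof -
    have xM: "x \<in> M" using x by (simp add: wandering_def)
    define G where "G = poly_op n (slice_poly n i \<zeta> \<omega>) T x"
    obtain C where C: "C > 0" "\<And>w. w \<in> Gamma n \<Longrightarrow> cmod (poly_at n (slice_poly n i \<zeta> \<omega>) w) \<le> C"
      using poly_at_bounded_on_Gamma[OF T'(2)] by blast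
    have "t * (2 * Im (cinner x G)) \<le> t\<^sup>2 * (C\<^sup>2 * (norm x)\<^sup>2)" for t
    proof -
      have "norm (x + (\<i> * complex_of_real t) *\<^sub>C G) \<le> sqrt (1 + t\<^sup>2 * C\<^sup>2) * norm x"
        unfolding G_def by (rule wandering_slice_bound[OF T iso i W x z C(2)])
      then have "(norm (x + (\<i> * complex_of_real t) *\<^sub>C G))\<^sup>2 \<le> (sqrt (1 + t\<^sup>2 * C\<^sup>2) * norm x)\<^sup>2"
        by (intro power_mono) auto
      also have "\<dots> = (1 + t\<^sup>2 * C\<^sup>2) * (norm x)\<^sup>2" by (simp add: power_mult_distrib)
      finally have "2 * Re (cinner x ((\<i> * complex_of_real t) *\<^sub>C G)) + (norm ((\<i> * complex_of_real t) *\<^sub>C G))\<^sup>2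
          \<le> t\<^sup>2 * (C\<^sup>2 * (norm x)\<^sup>2)"
        unfolding power2_norm_add by (simp add: algebra_simps)
      moreover have "Re (cinner x ((\<i> * complex_of_real t) *\<^sub>C G)) = t * Im (cinner x G)"
        by (simp add: cinner_scaleC_right)
      moreover have "0 \<le> (norm ((\<i> * complex_of_real t) *\<^sub>C G))\<^sup>2" by simp
      ultimately show ?thesis by linarith
    qed
    then have "2 * Im (cinner x G) = 0" by (rule linear_below_quadratic) simp
    moreover have "cinner x G = \<zeta> * (cnj \<omega> * cinner x (T i x) + \<omega> * cinner x (T (n - i) x))"
      unfolding G_def slice_poly_def
      using i' xM by (simp add: poly_op_mult[OF T'(1)] poly_op_add cinner_scaleC_right cinner_add_right)
    ultimately show ?thesis by simp
  qed
  have diag: "cinner x (T i x) = 0" if x: "x \<in> wandering" for x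
  proof -
    have z: "cnj \<omega> * cinner x (T i x) + \<omega> * cinner x (T (n - i) x) = 0" for \<omega>
      using self_adjoint[OF x, of 1 \<omega>] self_adjoint[OF x, of \<i> \<omega>] by (simp add: complex_eq_iff)
    have "cinner x (T i x) + cinner x (T (n - i) x) = 0" using z[of 1] by simp
    moreover have "- \<i> * cinner x (T i x) + \<i> * cinner x (T (n - i) x) = 0" using z[of \<i>] by simp
    ultimately show ?thesis by (simp add: complex_eq_iff)
  qed
  note bT = commuting_tupleD(2)[OF T'(1) i'(1)]
  show ?thesis
  proof (rule cinner_diagonal_zero[OF wandering_subspace _ _ diag e])
    show "clinear_on wandering (T i)"
      using bounded_op_onD(2)[OF bT] unfolding clinear_on_def wandering_def by blast
    show "T i x \<in> wandering" if "x \<in> wandering" for x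
      using that bounded_op_onD(1)[OF bT] W[OF i] clinear_onD(3)[OF M bounded_op_onD(2)[OF bT]]
      by (auto simp: wandering_def)
  qed
qed

text \<open>\<open>T\<^sub>i\<close> commutes with the projections onto the components of the Wold decomposition, and on each of
  them it is determined by the wandering subspace.\<close>

lemma pure_isometry_vanish:
  assumes T: "Gamma_contraction n M T" and iso: "isometry_operator M (T n)" and i: "i \<in> {1..n-1}"
    and W: "\<And>j x. j \<in> {1..n-1} \<Longrightarrow> x \<in> M \<Longrightarrow> adj_on M (T n) (T j x) = T j (adj_on M (T n) x)"
    and pure: "\<And>x. x \<in> M \<Longrightarrow> (\<lambda>k. norm ((adj_on M (T n) ^^ k) x)) \<longlonglongrightarrow> 0" and x: "x \<in> M"
  shows "T i x = 0"
proof -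
  interpret isometry_operator M "T n" by (rule iso)
  note T' = Gamma_contractionD[OF T]
  have i': "i \<in> {1..n}" "n \<in> {1..n}" using i by auto
  note bT = commuting_tupleD(2)[OF T'(1) i'(1)]
  have Tx: "T i x \<in> M" using bounded_op_onD(1)[OF bT] x by blast
  have "defect ((W ^^ k) (T i x)) = 0" for k
  proof -
    have "(W ^^ k) (T i x) = T i ((W ^^ k) x)"
      by (rule funpow_commute[of M]) (use in_M W[OF i] x in auto)
    then have "defect ((W ^^ k) (T i x)) = T i (defect ((W ^^ k) x))"
      using pow_in_M(2)[OF x, of k] in_M
      by (simp add: defect_def W[OF i] commuting_tupleD(3)[OF T'(1) i'(1) i'(2)]
          clinear_onD(5)[OF M bounded_op_onD(2)[OF bT]])
    also have "\<dots> = 0"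
      by (rule wandering_vanish[OF T iso i W])
        (auto simp: wandering_def defect_in_M W_defect pow_in_M x)
    finally show ?thesis .
  qed
  then have "(\<lambda>k. 0) sums (norm (T i x))\<^sup>2"
    using pure_isometry_norm_sums[OF pure[OF Tx] Tx] by simp
  then show ?thesis using sums_unique2[OF sums_zero] by fastforce
qed


section \<open>The bilateral shift\<close>

text \<open>The index set \<open>\<nat>\<close> carries the two-sided orbit \<open>\<dots>, 5, 3, 1, 0, 2, 4, \<dots>\<close>:
  even indices are the nonnegative integers, odd indices the negative ones.\<close>

definition orbit_next :: "nat \<Rightarrow> nat" where
  "orbit_next i = (if even i then i + 2 else if i = 1 then 0 else i - 2)"

definition orbit_prev :: "nat \<Rightarrow> nat" where
  "orbit_prev i = (if odd i then i + 2 else if i = 0 then 1 else i - 2)"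

lemma orbit_next_prev: "orbit_next (orbit_prev i) = i"
  unfolding orbit_next_def orbit_prev_def by presburger

lemma orbit_prev_next: "orbit_prev (orbit_next i) = i"
  unfolding orbit_next_def orbit_prev_def by presburger

definition reindex :: "(nat \<Rightarrow> nat) \<Rightarrow> 'a::chilbert_space ell2 \<Rightarrow> 'a ell2" where
  "reindex \<sigma> f = Abs_ell2 (\<lambda>i. seq_of f (\<sigma> i))"

lemma seq_of_reindex:
  assumes "inj \<sigma>"
  shows "seq_of (reindex \<sigma> f) i = seq_of f (\<sigma> i)"
proof -
  have "summable ((\<lambda>i. (norm (seq_of f i))\<^sup>2) \<circ> \<sigma>)"
    by (rule summable_reindex[OF summable_seq_of assms]) simp
  then show ?thesis by (simp add: reindex_def Abs_ell2_inverse comp_def)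
qed

lemma ell2_eqI: "(\<And>i. seq_of f i = seq_of g i) \<Longrightarrow> f = g"
  by (metis ext seq_of_inject)

lemma norm_reindex:
  assumes "bij \<sigma>"
  shows "norm (reindex \<sigma> f) = norm f"
proof -
  have "suminf ((\<lambda>i. (norm (seq_of f i))\<^sup>2) \<circ> \<sigma>) = suminf (\<lambda>i. (norm (seq_of f i))\<^sup>2)"
    by (rule suminf_reindex[OF summable_seq_of bij_is_inj[OF assms]]) (use bij_is_surj[OF assms] in auto)
  then show ?thesis by (simp add: norm_ell2_def seq_of_reindex[OF bij_is_inj[OF assms]] comp_def)
qed

lemma bounded_op_on_reindex:
  assumes "bij \<sigma>"
  shows "bounded_op_on UNIV (reindex \<sigma>)"
proof (rule bounded_op_onI[where B = 1])
  note s = seq_of_reindex[OF bij_is_inj[OF assms]]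
  show "reindex \<sigma> (f + g) = reindex \<sigma> f + reindex \<sigma> g" for f g :: "'a ell2"
    by (rule ell2_eqI) (simp add: s plus_ell2.rep_eq)
  show "reindex \<sigma> (c *\<^sub>C f) = c *\<^sub>C reindex \<sigma> f" for c and f :: "'a ell2"
    by (rule ell2_eqI) (simp add: s scaleC_ell2.rep_eq)
qed (simp_all add: norm_reindex[OF assms])

lemma bij_orbit: "bij orbit_next" "bij orbit_prev"
  by (rule o_bij[of orbit_prev] o_bij[of orbit_next]; simp add: fun_eq_iff orbit_next_prev orbit_prev_next)+

abbreviation shift :: "'a::chilbert_space ell2 \<Rightarrow> 'a ell2" where
  "shift \<equiv> reindex orbit_prev"

abbreviation unshift :: "'a::chilbert_space ell2 \<Rightarrow> 'a ell2" where
  "unshift \<equiv> reindex orbit_next"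

lemma shift_unshift: "shift (unshift f) = f" "unshift (shift f) = f"
  by (rule ell2_eqI; simp add: seq_of_reindex bij_is_inj bij_orbit orbit_next_prev orbit_prev_next)+

lemma adj_shift: "adj shift f = unshift f"
proof (rule adj_on_eqI[OF closed_csubspace_UNIV UNIV_I])
  fix g :: "'a ell2"
  have "cinner (shift g) (shift (unshift f)) = cinner g (unshift f)"
    by (rule isometry_preserves_cinner[OF closed_csubspace_UNIV bounded_op_onD(2)[OF bounded_op_on_reindex]])
      (simp_all add: bij_orbit norm_reindex)
  then show "cinner (shift g) f = cinner g (unshift f)" by (simp add: shift_unshift)
qed

definition axis_shift :: "nat \<Rightarrow> nat \<Rightarrow> 'a::chilbert_space ell2 \<Rightarrow> 'a ell2" where
  "axis_shift n i = (if i = n then shift else (\<lambda>_. 0))"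

text \<open>For \<open>c \<noteq> 0\<close> the operator is \<open>- c shift (unshift - 1 / c)\<close>, and \<open>\<bar>1 / c\<bar>\<close> exceeds the norm of the
  backward shift.\<close>

lemma shift_diff_bij:
  assumes "cmod c < 1"
  shows "bij_betw (\<lambda>x. shift x - c *\<^sub>C x) UNIV (UNIV :: 'a::chilbert_space ell2 set)"
proof (cases "c = 0")
  case True
  then show ?thesis by (intro o_bij[of unshift]) (auto simp: fun_eq_iff shift_unshift)
next
  case False
  note lin = clinear_onD[OF closed_csubspace_UNIV bounded_op_onD(2)[OF bounded_op_on_reindex[OF bij_orbit(2)]], simplified]
  have "bij (\<lambda>x. unshift x - (1/c) *\<^sub>C (x :: 'a ell2))"
    by (rule bij_betw_diff_scaleC[OF closed_csubspace_UNIV bounded_op_on_reindex[OF bij_orbit(1)], where a = 1])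
      (use assms False in \<open>auto simp: norm_reindex[OF bij_orbit(1)] norm_divide less_divide_eq\<close>)
  moreover have "bij (\<lambda>v. (- c) *\<^sub>C shift (v :: 'a ell2))"
    using False
    by (intro o_bij[of "\<lambda>v. unshift ((- 1 / c) *\<^sub>C v)"])
      (simp_all add: fun_eq_iff shift_unshift scaleC_scaleC)
  ultimately have "bij ((\<lambda>v. (- c) *\<^sub>C shift (v :: 'a ell2)) \<circ> (\<lambda>x. unshift x - (1/c) *\<^sub>C x))"
    by (rule bij_comp)
  moreover have "(- c) *\<^sub>C shift (unshift x - (1/c) *\<^sub>C x) = shift x - c *\<^sub>C x" for x :: "'a ell2"
    using False by (simp add: lin(2,5) shift_unshift scaleC_diff_right scaleC_scaleC scaleC_minus_left)
  ultimately show ?thesis by (simp add: comp_def)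
qed

text \<open>Every other component of the tuple is 0, so the Taylor spectrum consists of points \<open>(0, \<dots>, 0, c)\<close>;
  and \<open>\<bar>c\<bar> = 1\<close> because the shift is unitary.\<close>

lemma Gamma_unitary_axis_shift:
  assumes n: "n \<ge> 1"
  shows "Gamma_unitary n UNIV (axis_shift n :: nat \<Rightarrow> 'a::chilbert_space ell2 \<Rightarrow> 'a ell2)"
proof -
  let ?U = "axis_shift n :: nat \<Rightarrow> 'a ell2 \<Rightarrow> 'a ell2"
  have zero: "bounded_op_on UNIV (\<lambda>_. 0 :: 'a ell2)"
    by (rule bounded_op_onI[where B = 0]) auto
  have lin0: "shift (0 :: 'a ell2) = 0"
    by (rule clinear_onD(3)[OF closed_csubspace_UNIV bounded_op_onD(2)[OF bounded_op_on_reindex[OF bij_orbit(2)]]])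
  have T: "commuting_tuple n UNIV ?U"
    unfolding commuting_tuple_def axis_shift_def
    using zero bounded_op_on_reindex[OF bij_orbit(2)] lin0 by auto
  have normal: "normal_on UNIV (?U i)" for i
  proof (cases "i = n")
    case True
    then show ?thesis
      by (simp add: normal_on_def axis_shift_def adj_shift shift_unshift bounded_op_on_reindex bij_orbit)
  next
    case False
    have "adj (\<lambda>_. 0 :: 'a ell2) y = 0" for y
      by (rule adj_on_eqI) auto
    then show ?thesis using False zero by (simp add: normal_on_def axis_shift_def)
  qed
  have "z \<in> bGamma n" if z: "z \<in> taylor_spectrum n UNIV ?U" for z
  proof -
    have zc: "z \<in> cspace n" using z by (simp add: taylor_spectrum_def)
    have z0: "z i = 0" if i: "i \<noteq> n" for i
    proof (cases "i \<in> {1..n}")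
      case True
      have "cmod (poly_at n (poly_var i) z) \<le> 0"
        using True i by (intro taylor_spectrum_poly_bound[OF T polys_var z]) (auto simp: axis_shift_def)
      then show ?thesis using True by simp
    qed (use zc in \<open>simp add: cspace_def\<close>)
    have nn: "n \<in> {1..n}" using n by simp
    have "cmod (poly_at n (poly_var n) z) \<le> 1"
      using nn by (intro taylor_spectrum_poly_bound[OF T polys_var z]) (auto simp: axis_shift_def norm_reindex bij_orbit)
    moreover have "\<not> cmod (z n) < 1"
      using shift_diff_bij[of "z n", where 'a = 'a] taylor_spectrum_not_bij[OF T polys_var[OF nn] z] nn
      by (auto simp: axis_shift_def)
    ultimately have "cmod (z n) = 1" using nn by simp
    moreover have "z = (\<lambda>i. if i = n then z n else 0)" using z0 by auto
    ultimately show ?thesis using bGamma_axis[OF n, of "z n"] by simp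
  qed
  then show ?thesis unfolding Gamma_unitary_def using T normal by blast
qed

context isometry_operator
begin

text \<open>The Wold components of \<open>x\<close>, placed at the nonnegative integers of the two-sided orbit, that is,
  at the even indices.\<close>

definition wold_map :: "'a \<Rightarrow> 'a ell2" where
  "wold_map x = Abs_ell2 (\<lambda>i. if even i then defect ((W ^^ (i div 2)) x) else 0)"

context
  assumes pure: "\<And>x. x \<in> M \<Longrightarrow> (\<lambda>k. norm ((W ^^ k) x)) \<longlonglongrightarrow> 0"
begin

lemma wold_sums:
  assumes "x \<in> M"
  shows "(\<lambda>i. (norm (if even i then defect ((W ^^ (i div 2)) x) else 0))\<^sup>2) sums (norm x)\<^sup>2"
proof -
  have "strict_mono ((*) (2::nat))" by (auto simp: strict_mono_def)
  moreover have "even i" if "i \<in> range ((*) (2::nat))" for i using that by auto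
  moreover have "i \<in> range ((*) (2::nat))" if "even i" for i using that by (auto elim: evenE)
  ultimately show ?thesis
    using pure_isometry_norm_sums[OF pure[OF assms] assms]
    by (subst sums_mono_reindex[of "(*) 2", symmetric]) auto
qed

lemma seq_of_wold_map:
  "x \<in> M \<Longrightarrow> seq_of (wold_map x) i = (if even i then defect ((W ^^ (i div 2)) x) else 0)"
  using sums_summable[OF wold_sums] by (simp add: wold_map_def Abs_ell2_inverse)

lemma norm_wold_map: "x \<in> M \<Longrightarrow> norm (wold_map x) = norm x"
  using sums_unique[OF wold_sums, symmetric] by (simp add: norm_ell2_def seq_of_wold_map)

lemma wold_map_linear: "clinear_on M wold_map"
proof -
  note pow = clinear_onD[OF M bounded_op_onD(2)[OF bounded_op_on_funpow[OF W_bounded]]]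
  have add: "defect (x + y) = defect x + defect y" and scale: "defect (c *\<^sub>C x) = c *\<^sub>C defect x"
    if "x \<in> M" "y \<in> M" for x y c
    using that by (simp_all add: defect_def W_lin lin in_M sub scaleC_diff_right)
  show ?thesis
    unfolding clinear_on_def
  proof (intro conjI ballI allI)
    show "wold_map (x + y) = wold_map x + wold_map y" if "x \<in> M" "y \<in> M" for x y
      using that by (intro ell2_eqI) (simp add: seq_of_wold_map plus_ell2.rep_eq sub pow add pow_in_M)
    show "wold_map (c *\<^sub>C x) = c *\<^sub>C wold_map x" if "x \<in> M" for c x
      using that by (intro ell2_eqI) (simp add: seq_of_wold_map scaleC_ell2.rep_eq sub pow scale pow_in_M)
  qed
qed

lemma wold_map_shift:
  assumes x: "x \<in> M"
  shows "wold_map (V x) = shift (wold_map x)"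
proof (rule ell2_eqI)
  fix i
  have Wx: "(W ^^ Suc k) (V x) = (W ^^ k) x" for k by (simp add: funpow_swap1 W_V x)
  show "seq_of (wold_map (V x)) i = seq_of (shift (wold_map x)) i"
  proof (cases "even i")
    case True
    then obtain k where k: "i = 2 * k" by (elim evenE)
    show ?thesis
    proof (cases k)
      case 0
      then show ?thesis using k x
        by (simp add: seq_of_wold_map in_M seq_of_reindex bij_is_inj bij_orbit orbit_prev_def defect_def W_V)
    next
      case (Suc j)
      then have "orbit_prev i = 2 * j" using k by (simp add: orbit_prev_def)
      then show ?thesis using k Suc Wx[of j] x
        by (simp add: seq_of_wold_map in_M seq_of_reindex bij_is_inj bij_orbit del: funpow.simps)
    qed
  next
    case False
    then show ?thesis using x
      by (simp add: seq_of_wold_map in_M seq_of_reindex bij_is_inj bij_orbit orbit_prev_def)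
  qed
qed

lemma Gamma_isometry_axis:
  assumes n: "n \<ge> 1" and Tn: "T n = V" and T0: "\<And>i x. i \<in> {1..n-1} \<Longrightarrow> x \<in> M \<Longrightarrow> T i x = 0"
  shows "Gamma_isometry n M T"
proof -
  have "wold_map (T i x) = axis_shift n i (wold_map x)" "T i x \<in> M" if "i \<in> {1..n}" "x \<in> M" for i x
  proof -
    have T0': "T i x = 0" if "i \<noteq> n" using that \<open>i \<in> {1..n}\<close> \<open>x \<in> M\<close> by (intro T0) auto
    show "T i x \<in> M" using that Tn T0' in_M(1) sub(2) by (cases "i = n") auto
    show "wold_map (T i x) = axis_shift n i (wold_map x)"
    proof (cases "i = n")
      case True
      then show ?thesis using that(2) by (simp add: Tn wold_map_shift axis_shift_def)
    next
      case False
      then show ?thesis using T0' clinear_onD(3)[OF M wold_map_linear] by (simp add: axis_shift_def)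
    qed
  qed
  then show ?thesis
    unfolding Gamma_isometry_def
    using M Gamma_unitary_axis_shift[OF n] wold_map_linear norm_wold_map
    by (intro conjI exI[of _ "UNIV :: 'a ell2 set"] exI[of _ "axis_shift n"] exI[of _ wold_map]) auto
qed

end

end

section \<open>Complete non-unitarity\<close>

lemma unitary_on_isometric:
  assumes L: "closed_csubspace L" and U: "unitary_on L T" and x: "x \<in> L"
  shows "norm (T x) = norm x"
proof -
  have b: "bounded_op_on L T" and adj: "adj_on L T (T x) = x" using U x by (auto simp: unitary_on_def)
  have "cinner (T x) (T x) = cinner x x"
    using adj_on_props(2)[OF L b x, of "T x"] adj by simp
  then have "(norm (T x))\<^sup>2 = (norm x)\<^sup>2" unfolding cinner_self of_real_eq_iff .
  then show ?thesis by (simp add: power2_eq_iff_nonneg)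
qed

lemma unitary_on_surj:
  assumes L: "closed_csubspace L" and U: "unitary_on L T" and x: "x \<in> L"
  obtains y where "y \<in> L" "T y = x"
proof
  have b: "bounded_op_on L T" using U by (auto simp: unitary_on_def)
  show "adj_on L T x \<in> L" by (rule adj_on_props(1)[OF L b])
  show "T (adj_on L T x) = x" using U x by (auto simp: unitary_on_def)
qed

context contraction_operator
begin

lemma isometry_operator_isometric_part: "isometry_operator (isometric_part P) P"
proof
  show "closed_csubspace (isometric_part P)" by (rule isometric_part_subspace)
  show "bounded_op_on (isometric_part P) P"
    using isometric_part_invariant by (intro bounded_op_on_subset[OF bounded]) auto
qed (rule isometric_part_norm)

lemma contraction_on_subset:
  assumes "closed_csubspace L" "P ` L \<subseteq> L"
  shows "contraction_on L P"
  unfolding contraction_on_def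
  using bounded_op_on_subset[OF bounded subset_UNIV assms(2)] closed_csubspaceD(2)[OF assms(1)] contractive
  by (auto intro!: onorm_on_leI)

lemma adj_isometric_part: "x \<in> isometric_part P \<Longrightarrow> adj P (P x) = x"
  by (intro adjoint_undoes_isometric_vector[OF bounded contractive] isometric_part_norm)

text \<open>On the isometric part the adjoint of \<open>P\<close> inverts \<open>P\<close>, so a unitary part of the
  restriction reduces \<open>P\<close> itself.\<close>

lemma cnu_isometric_part:
  assumes cnu: "cnu_on UNIV P"
  shows "cnu_on (isometric_part P) P"
  unfolding cnu_on_def
proof (intro conjI notI)
  show "contraction_on (isometric_part P) P"
    using isometric_part_invariant by (intro contraction_on_subset isometric_part_subspace) auto
  assume "\<exists>L. reducing_subspace (isometric_part P) P L \<and> L \<noteq> {0} \<and> unitary_on L P"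
  then obtain L where red: "reducing_subspace (isometric_part P) P L" and L0: "L \<noteq> {0}" and U: "unitary_on L P"
    by blast
  have L: "closed_csubspace L" "L \<subseteq> isometric_part P" "P ` L \<subseteq> L"
    using red by (auto simp: reducing_subspace_def)
  have "adj P x \<in> L" if x: "x \<in> L" for x
  proof -
    obtain y where y: "y \<in> L" "P y = x" by (rule unitary_on_surj[OF L(1) U x])
    then have "adj P x = y" using adj_isometric_part[of y] L(2) by auto
    then show ?thesis using y(1) by simp
  qed
  then have "reducing_subspace UNIV P L" using L by (auto simp: reducing_subspace_def)
  then show False using cnu L0 U unfolding cnu_on_def by blast
qed

text \<open>The vectors that lie in the range of every power of the isometry form a subspace that reduces
  \<open>P\<close> and on which \<open>P\<close> is unitary.\<close>

lemma isometric_part_pure: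
  assumes cnu: "cnu_on UNIV P" and x: "x \<in> isometric_part P"
    and fix_x: "\<And>k. (P ^^ k) ((adj_on (isometric_part P) P ^^ k) x) = x"
  shows "x = 0"
proof (rule ccontr)
  assume "x \<noteq> 0"
  interpret H: isometry_operator "isometric_part P" P by (rule isometry_operator_isometric_part)
  define L where "L = {y \<in> isometric_part P. \<forall>k. (P ^^ k) ((H.W ^^ k) y) = y}"
  have LM: "L \<subseteq> isometric_part P" by (auto simp: L_def)
  have PW: "P (H.W y) = y" if "y \<in> L" for y
    using that unfolding L_def by (auto dest: spec[of _ "Suc 0"])
  have PW_bounded: "bounded_op_on (isometric_part P) (\<lambda>y. (P ^^ k) ((H.W ^^ k) y))" for k
    by (rule bounded_op_on_comp[OF bounded_op_on_funpow[OF H.bounded] bounded_op_on_funpow[OF H.W_bounded]])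
  note PW_lin = clinear_onD[OF H.M bounded_op_onD(2)[OF PW_bounded]]
  have L: "closed_csubspace L"
    unfolding closed_csubspace_def
  proof (intro conjI ballI allI)
    show "closed L"
      unfolding closed_sequential_limits
    proof (intro allI impI)
      fix u l assume u: "(\<forall>j. u j \<in> L) \<and> u \<longlonglongrightarrow> l"
      then have uM: "\<And>j. u j \<in> isometric_part P" using LM by blast
      have lM: "l \<in> isometric_part P" using closed_sequentially[OF H.sub(1)] uM u by blast
      have "(P ^^ k) ((H.W ^^ k) l) = l" for k
      proof (rule LIMSEQ_unique)
        show "(\<lambda>j. (P ^^ k) ((H.W ^^ k) (u j))) \<longlonglongrightarrow> (P ^^ k) ((H.W ^^ k) l)"
          using u uM by (intro bounded_op_on_tendsto[OF H.M PW_bounded]) auto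
        show "(\<lambda>j. (P ^^ k) ((H.W ^^ k) (u j))) \<longlonglongrightarrow> l" using u by (simp add: L_def)
      qed
      then show "l \<in> L" using lM by (simp add: L_def)
    qed
  qed (auto simp: L_def H.sub PW_lin)
  have P_inv: "P y \<in> L" if y: "y \<in> L" for y
  proof -
    have yM: "y \<in> isometric_part P" using y LM by blast
    have "(P ^^ k) ((H.W ^^ k) (P y)) = P y" for k
    proof (cases k)
      case (Suc j)
      have "(H.W ^^ Suc j) (P y) = (H.W ^^ j) y" by (simp add: funpow_swap1 H.W_V[OF yM])
      then show ?thesis using y Suc by (simp add: L_def)
    qed simp
    then show ?thesis using H.in_M(1)[OF yM] by (simp add: L_def)
  qed
  have W_inv: "H.W y \<in> L" if y: "y \<in> L" for y
  proof -
    have yM: "y \<in> isometric_part P" using y LM by blast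
    have "(P ^^ k) ((H.W ^^ k) (H.W y)) = H.W y" for k
    proof -
      have "(P ^^ Suc k) ((H.W ^^ Suc k) y) = y" using y unfolding L_def by blast
      then have "P ((P ^^ k) ((H.W ^^ k) (H.W y))) = y" by (simp add: funpow_swap1)
      then have "H.W (P ((P ^^ k) ((H.W ^^ k) (H.W y)))) = H.W y" by simp
      then show ?thesis by (simp add: H.W_V H.pow_in_M H.in_M)
    qed
    then show ?thesis using H.in_M(2) by (simp add: L_def)
  qed
  have "adj P y \<in> L" if y: "y \<in> L" for y
    using adj_isometric_part[OF H.in_M(2)[of y]] PW[OF y] W_inv[OF y] by simp
  then have "reducing_subspace UNIV P L" using L P_inv by (auto simp: reducing_subspace_def)
  moreover have "unitary_on L P"
    unfolding unitary_on_def
  proof (intro conjI ballI)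
    show "bounded_op_on L P" using P_inv by (intro bounded_op_on_subset[OF bounded]) auto
    have adjL: "adj_on L P y = H.W y" if "y \<in> L" for y
      using W_inv[OF that] H.V_cinner LM by (intro adj_on_eqI[OF L]) auto
    show "adj_on L P (P y) = y" if "y \<in> L" for y
      using that LM by (simp add: adjL[OF P_inv] H.W_V subset_iff)
    show "P (adj_on L P y) = y" if "y \<in> L" for y
      using that by (simp add: adjL PW)
  qed
  moreover have "x \<in> L" using x fix_x by (simp add: L_def)
  ultimately show False using cnu \<open>x \<noteq> 0\<close> unfolding cnu_on_def by blast
qed

lemma adj_contraction_operator: "contraction_operator (adj P)"
  by standard (rule bounded_op_on_adj_on'[OF closed_csubspace_UNIV bounded], rule norm_adj_le)

lemma adj_adj: "adj (adj P) x = P x"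
  by (rule adj_on_eqI) (auto simp: adj_on_props'[OF closed_csubspace_UNIV bounded])

text \<open>A vector on which the adjoint acts unitarily lies in the isometric part, which is orthogonal
  to the middle part.\<close>

lemma cnu_adj_middle_part:
  assumes inv: "adj P ` middle_part P \<subseteq> middle_part P"
  shows "cnu_on (middle_part P) (adj P)"
  unfolding cnu_on_def
proof (intro conjI notI)
  interpret A: contraction_operator "adj P" by (rule adj_contraction_operator)
  show "contraction_on (middle_part P) (adj P)"
    by (rule A.contraction_on_subset[OF middle_part_subspace inv])
  assume "\<exists>L. reducing_subspace (middle_part P) (adj P) L \<and> L \<noteq> {0} \<and> unitary_on L (adj P)"
  then obtain L where red: "reducing_subspace (middle_part P) (adj P) L" and L0: "L \<noteq> {0}"
    and U: "unitary_on L (adj P)" by blast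
  have L: "closed_csubspace L" "L \<subseteq> middle_part P" using red by (auto simp: reducing_subspace_def)
  have P: "P x \<in> L \<and> norm (P x) = norm x" if x: "x \<in> L" for x
  proof -
    obtain y where y: "y \<in> L" "adj P y = x" by (rule unitary_on_surj[OF L(1) U x])
    have ny: "norm (adj P y) = norm y" by (rule unitary_on_isometric[OF L(1) U y(1)])
    then have "adj (adj P) (adj P y) = y"
      by (intro adjoint_undoes_isometric_vector[OF A.bounded A.contractive])
    then have "P x = y" by (simp add: adj_adj y(2))
    then show ?thesis using y ny by simp
  qed
  have "norm ((P ^^ k) x) = norm x \<and> (P ^^ k) x \<in> L" if "x \<in> L" for x k
    using that P by (induct k) auto
  then have "L \<subseteq> isometric_part P" by (auto simp: isometric_part_iff)
  then have "cinner x (0 + x) = 0" if "x \<in> L" for x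
    using that L(2) closed_csubspaceD(2)[OF stable_part_subspace] unfolding middle_part_def by blast
  then have "L \<subseteq> {0}" by auto
  then show False using L0 closed_csubspaceD(2)[OF L(1)] by blast
qed

text \<open>Both \<open>S\<close> and its adjoint leave the isometric part invariant, so \<open>S\<close> commutes with the
  adjoint taken there.\<close>

lemma commute_adj_on_isometric_part:
  assumes S: "bounded_op_on UNIV S" and SP: "\<And>x. S (P x) = P (S x)" and SA: "\<And>x. S (adj P x) = adj P (S x)"
    and x: "x \<in> isometric_part P"
  shows "adj_on (isometric_part P) P (S x) = S (adj_on (isometric_part P) P x)"
proof (rule adj_on_eqI[OF isometric_part_subspace])
  interpret H: isometry_operator "isometric_part P" P by (rule isometry_operator_isometric_part)
  note p = adj_on_props(2)[OF closed_csubspace_UNIV bounded UNIV_I]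
  note s = adj_on_props(2)[OF closed_csubspace_UNIV S UNIV_I]
  note p' = adj_on_props'[OF closed_csubspace_UNIV bounded UNIV_I]
  note s' = adj_on_props'[OF closed_csubspace_UNIV S UNIV_I]
  show "S (H.W x) \<in> isometric_part P"
    by (rule isometric_part_invariant_commuting[OF SP SA H.in_M(2)])
  have adjS_P: "adj S (P y) = P (adj S y)" for y
  proof (rule cinner_eqI)
    fix z
    have "cinner z (adj S (P y)) = cinner (adj P (S z)) y" by (simp add: s[symmetric] p')
    also have "\<dots> = cinner z (P (adj S y))" by (simp add: p' s[symmetric] SA)
    finally show "cinner z (adj S (P y)) = cinner z (P (adj S y))" .
  qed
  have adjS_A: "adj S (adj P y) = adj P (adj S y)" for y
  proof (rule cinner_eqI)
    fix z show "cinner z (adj S (adj P y)) = cinner z (adj P (adj S y))"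
      by (simp add: s[symmetric] p[symmetric] SP)
  qed
  fix y assume y: "y \<in> isometric_part P"
  have Sy: "adj S y \<in> isometric_part P"
    by (rule isometric_part_invariant_commuting[OF adjS_P adjS_A y])
  have "cinner (P y) (S x) = cinner (P (adj S y)) x" by (simp add: s' adjS_P)
  also have "\<dots> = cinner (adj S y) (H.W x)" by (rule H.V_cinner[OF Sy])
  also have "\<dots> = cinner y (S (H.W x))" by (simp add: s')
  finally show "cinner (P y) (S x) = cinner y (S (H.W x))" .
qed

end


section \<open>The decomposition\<close>

theorem theorem4p13:
  fixes n :: nat
    and S :: "nat \<Rightarrow> 'a::chilbert_space \<Rightarrow> 'a"
    and P :: "'a \<Rightarrow> 'a"
  assumes "n \<ge> 2"
    and "Gamma_contraction n UNIV (S(n := P))"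
    and "cnu_tuple n UNIV (S(n := P))"
    and "\<forall>i\<in>{1..n-1}. \<forall>x. adj P (S i x) = S i (adj P x)"
  shows "(joint_invariant n (S(n := P)) (stable_part P) \<and>
          joint_invariant n (S(n := P)) (isometric_part P)) \<and>
         joint_invariant n (\<lambda>i. adj ((S(n := P)) i)) (middle_part P) \<and>
         (Gamma_contraction n (stable_part P) (S(n := P)) \<and>
          strongly_stable n (stable_part P) (S(n := P))) \<and>
         (Gamma_contraction n (middle_part P) (\<lambda>i. adj ((S(n := P)) i)) \<and>
          cnu_tuple n (middle_part P) (\<lambda>i. adj ((S(n := P)) i))) \<and>
         (Gamma_isometry n (isometric_part P) (S(n := P)) \<and>
          cnu_tuple n (isometric_part P) (S(n := P)))"
proof -
  define T where "T = S(n := P)"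
  have Tn: "T n = P" and Ti: "\<And>i. i \<in> {1..n-1} \<Longrightarrow> T i = S i" using assms(1) by (auto simp: T_def)
  have nn: "n \<in> {1..n}" "n \<ge> 1" using assms(1) by auto
  have T: "Gamma_contraction n UNIV T" and cnu: "cnu_on UNIV P"
    using assms(2,3) by (simp_all add: T_def cnu_tuple_def)
  note T' = Gamma_contractionD[OF T]
  have bT: "bounded_op_on UNIV (T i)" if "i \<in> {1..n}" for i by (rule commuting_tupleD(2)[OF T'(1) that])
  have last_le: "cmod (poly_at n (poly_var n) w) \<le> 1" if "w \<in> Gamma n" for w
    using Gamma_last_le[OF that] nn by simp
  interpret contraction_operator P
  proof
    show "bounded_op_on UNIV P" using bT[OF nn(1)] by (simp add: Tn)
    show "norm (P x) \<le> norm x" for x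
      using Gamma_poly_boundedD[OF T'(3) polys_var[OF nn(1)] last_le UNIV_I, of x] nn by (simp add: Tn)
  qed
  have TP: "T i (P x) = P (T i x)" if "i \<in> {1..n}" for i x
    using commuting_tupleD(3)[OF T'(1) that nn(1) UNIV_I] by (simp add: Tn)
  have TA: "T i (adj P x) = adj P (T i x)" if "i \<in> {1..n-1}" for i x
    using assms(4) that by (simp add: Ti)
  have stable: "T i x \<in> stable_part P" if "i \<in> {1..n}" "x \<in> stable_part P" for i x
    using stable_part_invariant_commuting[OF bT[OF that(1)] TP[OF that(1)] that(2)] .
  have isometric: "T i x \<in> isometric_part P" if "i \<in> {1..n}" "x \<in> isometric_part P" for i x
  proof (cases "i = n")
    case True then show ?thesis using isometric_part_invariant that(2) by (simp add: Tn)
  next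
    case False
    then have "i \<in> {1..n-1}" using that(1) by auto
    then show ?thesis using isometric_part_invariant_commuting[OF TP[OF that(1)] TA that(2)] by blast
  qed
  have middle: "adj (T i) x \<in> middle_part P" if "i \<in> {1..n}" "x \<in> middle_part P" for i x
    by (rule middle_part_invariant_adj[OF bT[OF that(1)] stable[OF that(1)] isometric[OF that(1)] that(2)])
  have "Gamma_contraction n (stable_part P) T"
    using stable by (intro Gamma_contraction_restrict[OF T stable_part_subspace]) auto
  moreover have "Gamma_contraction n (middle_part P) (\<lambda>i. adj (T i))"
    using middle by (intro Gamma_contraction_restrict[OF Gamma_contraction_adj[OF T] middle_part_subspace]) auto
  moreover have "cnu_on (middle_part P) (adj (T n))"
    unfolding Tn using middle[OF nn(1)] by (intro cnu_adj_middle_part) (auto simp: Tn)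
  moreover have "Gamma_isometry n (isometric_part P) T"
  proof -
    interpret H: isometry_operator "isometric_part P" P by (rule isometry_operator_isometric_part)
    have pure: "(\<lambda>k. norm ((H.W ^^ k) x)) \<longlonglongrightarrow> 0" if "x \<in> isometric_part P" for x
      by (rule H.pure_isometry_adjoint_powers[OF isometric_part_pure[OF cnu] that])
    have G: "Gamma_contraction n (isometric_part P) T"
      using isometric by (intro Gamma_contraction_restrict[OF T isometric_part_subspace]) auto
    have W: "H.W (T j x) = T j (H.W x)" if "j \<in> {1..n-1}" "x \<in> isometric_part P" for j x
      using that by (intro commute_adj_on_isometric_part bT TP TA) auto
    have "T i x = 0" if "i \<in> {1..n-1}" "x \<in> isometric_part P" for i x
      by (rule pure_isometry_vanish[OF G _ that(1) _ _ that(2)])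
        (simp_all add: Tn W pure H.isometry_operator_axioms)
    then show ?thesis by (intro H.Gamma_isometry_axis[where n = n and T = T]) (use pure nn(2) Tn in auto)
  qed
  ultimately show ?thesis
    using stable isometric middle stable_part_subspace isometric_part_subspace middle_part_subspace
      cnu_isometric_part[OF cnu]
    unfolding T_def[symmetric] joint_invariant_def strongly_stable_def cnu_tuple_def Tn
    by (auto simp: stable_part_def)
qed

end
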